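(* Let $G$ be a compact, connected Lie group with Lie algebra $\mathfrak{g}$ and let $(\cdot,\cdot)$ be a symmetric invariant bilinear form on $\mathfrak{g}$. The forms $\omega_{LG\times L\mathfrak{g}^*}\in\Omega^2(LG\times L\mathfrak{g}^* )$ and $\omega_D\in\Omega^2(G\times G)$ are related by $$\omega_{LG\times L\mathfrak{g}^*}=f^*\omega_D-\Phi^*(\varpi,\varpi),$$ where $f:LG\times L\mathfrak{g}^*\to G\times G$ is $f(\gamma,A)=(\gamma(0),\mathrm{Hol}(A))$, the map $\Phi:LG\times L\mathfrak{g}^*\to L\mathfrak{g}^*\times L\mathfrak{g}^*$ is $\Phi(\gamma,A)=(\gamma\cdot A,\mathrm{inv}(A))$, and $\varpi\in\Omega^2(L\mathfrak{g}^* )$ is $$\varpi=\frac12\int_0^1\Big(\mathrm{Hol}_s^*\bar\theta,\frac{d}{ds}\mathrm{Hol}_s^*\bar\theta\Big)ds.$$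
   Context: $\mathbb{S}^1=\mathbb{R}/\mathbb{Z}$ with coordinate $s$. $LG$ is the group of smooth maps $\mathbb{S}^1\to G$, $L\mathfrak{g}=\Omega^0(\mathbb{S}^1,\mathfrak{g})$, $L\mathfrak{g}^*:=\Omega^1(\mathbb{S}^1,\mathfrak{g})$, whose elements are also written as functions $A(s)$ via $A=A(s)ds$. $LG$ acts on $L\mathfrak{g}^*$ by the gauge action $\gamma\cdot A=\mathrm{Ad}_\gamma A+(d\gamma)\gamma^{-1}$. The inversion map is $\mathrm{inv}:L\mathfrak{g}^*\to L\mathfrak{g}^*$, $\mathrm{inv}(A)(s)=-A(1-s)$. With $T_{(\gamma,A)}(LG\times L\mathfrak{g}^* )\cong L\mathfrak{g}\times L\mathfrak{g}^*$ via left translations, $$\omega_{LG\times L\mathfrak{g}^*}((v_1,A_1),(v_2,A_2))_{(\gamma,A)}=\int_{\mathbb{S}^1}(A_1,v_2)-(A_2,v_1)-(A,[v_1,v_2])-(v_1,dv_2).$$ $\mathrm{Hol}_s(A)\in G$, $s\in[0,1]$, is the solution of $\mathrm{Hol}_s(A)^{-1}\frac{d}{ds}\mathrm{Hol}_s(A)=-A(s)$, $\mathrm{Hol}_0(A)=e$, and $\mathrm{Hol}(A)=\mathrm{Hol}_1(A)$. $\theta,\bar\theta$ are the left- and right-invariant Maurer–Cartan forms on $G$, $p_1,p_2:G\times G\to G$ the projections, and $$\omega_D|_{(x,y)}=\tfrac12(\mathrm{Ad}_yp_1^*\theta,p_1^*\theta)+\tfrac12(p_1^*\theta,p_2^*\theta+p_2^*\bar\theta).$$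 Conventions: $(\alpha,\beta)(X,Y)=(\alpha(X),\beta(Y))-(\alpha(Y),\beta(X))$ for $\mathfrak{g}$-valued $1$-forms; $(\varpi,\varpi)$ is the $2$-form $\mathrm{pr}_1^*\varpi+\mathrm{pr}_2^*\varpi$ on $L\mathfrak{g}^*\times L\mathfrak{g}^*$. *)

theory Defs
  imports "HOL-Analysis.Analysis" "HOL-Algebra.Group"
begin

section \<open>Smooth manifolds and tangent maps\<close>

primrec C_k_on :: "nat \<Rightarrow> 'a set \<Rightarrow> ('a::real_normed_vector \<Rightarrow> 'b::real_normed_vector) \<Rightarrow> bool" where
  "C_k_on 0 S f \<longleftrightarrow> continuous_on S f"
| "C_k_on (Suc k) S f \<longleftrightarrow>
     (\<forall>x\<in>S. f differentiable (at x)) \<and>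
     (\<forall>v. C_k_on k S (\<lambda>x. frechet_derivative f (at x) v))"

text \<open>To be used for open \<open>S\<close> in finite-dimensional spaces, where directional derivatives suffice.\<close>
definition smooth_on :: "'a set \<Rightarrow> ('a::real_normed_vector \<Rightarrow> 'b::real_normed_vector) \<Rightarrow> bool" where
  "smooth_on S f \<longleftrightarrow> (\<forall>k. C_k_on k S f)"

text \<open>A chart is a domain together with a coordinate map; the values of the coordinate map outside
  the domain are irrelevant.\<close>
type_synonym ('p, 'e) chart = "'p set \<times> ('p \<Rightarrow> 'e)"

definition smooth_atlas :: "'p topology \<Rightarrow> ('p, 'e::real_normed_vector) chart set \<Rightarrow> bool" where
  "smooth_atlas X \<A> \<longleftrightarrow>
     (\<forall>(U, \<phi>)\<in>\<A>. openin X U \<and> open (\<phi> ` U) \<and>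
        homeomorphic_map (subtopology X U) (top_of_set (\<phi> ` U)) \<phi>) \<and>
     (\<Union>(U, \<phi>)\<in>\<A>. U) = topspace X \<and>
     (\<forall>(U, \<phi>)\<in>\<A>. \<forall>(V, \<psi>)\<in>\<A>. smooth_on (\<phi> ` (U \<inter> V)) (\<psi> \<circ> inv_into U \<phi>))"

definition smooth_manifold :: "'p topology \<Rightarrow> ('p, 'e::real_normed_vector) chart set \<Rightarrow> bool" where
  "smooth_manifold X \<A> \<longleftrightarrow> Hausdorff_space X \<and> second_countable X \<and> smooth_atlas X \<A>"

definition smooth_map ::
  "'p topology \<Rightarrow> ('p, 'a::real_normed_vector) chart set \<Rightarrow>
   'q topology \<Rightarrow> ('q, 'b::real_normed_vector) chart set \<Rightarrow> ('p \<Rightarrow> 'q) \<Rightarrow> bool" where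
  "smooth_map X \<A> Y \<B> F \<longleftrightarrow> continuous_map X Y F \<and>
     (\<forall>(U, \<phi>)\<in>\<A>. \<forall>(V, \<psi>)\<in>\<B>. smooth_on (\<phi> ` (U \<inter> F -` V)) (\<psi> \<circ> F \<circ> inv_into U \<phi>))"

definition prod_atlas ::
  "('p, 'a) chart set \<Rightarrow> ('q, 'b) chart set \<Rightarrow> ('p \<times> 'q, 'a \<times> 'b) chart set" where
  "prod_atlas \<A> \<B> = {(U \<times> V, map_prod \<phi> \<psi>) |U \<phi> V \<psi>. (U, \<phi>) \<in> \<A> \<and> (V, \<psi>) \<in> \<B>}"

definition vec_atlas :: "('e, 'e) chart set" where
  "vec_atlas = {(UNIV, id)}"

text \<open>For every point \<open>p\<close> one chart around \<open>p\<close> is chosen. The tangent space at \<open>p\<close> is represented by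
  the model vector space: a vector stands for the tangent vector with these components in the chosen
  chart. Tangent maps and velocities are computed in the chosen charts.\<close>
definition chart_at :: "('p, 'e) chart set \<Rightarrow> 'p \<Rightarrow> ('p, 'e) chart" where
  "chart_at \<A> p = (SOME c. c \<in> \<A> \<and> p \<in> fst c)"

definition coord_at :: "('p, 'e) chart set \<Rightarrow> 'p \<Rightarrow> 'p \<Rightarrow> 'e" where
  "coord_at \<A> p = snd (chart_at \<A> p)"

definition tangent_map ::
  "('p, 'a::real_normed_vector) chart set \<Rightarrow> ('q, 'b::real_normed_vector) chart set \<Rightarrow>
   ('p \<Rightarrow> 'q) \<Rightarrow> 'p \<Rightarrow> 'a \<Rightarrow> 'b" where
  "tangent_map \<A> \<B> F p =
     frechet_derivative
       (coord_at \<B> (F p) \<circ> F \<circ> inv_into (fst (chart_at \<A> p)) (coord_at \<A> p))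
       (at (coord_at \<A> p p))"

text \<open>The continuity condition makes sure that the curve stays in the chosen chart around \<open>c t\<close>.\<close>
definition has_velocity ::
  "'p topology \<Rightarrow> ('p, 'e::real_normed_vector) chart set \<Rightarrow> (real \<Rightarrow> 'p) \<Rightarrow> 'e \<Rightarrow> real \<Rightarrow> real set \<Rightarrow> bool" where
  "has_velocity X \<A> c w t S \<longleftrightarrow>
     limitin X c (c t) (at t within S) \<and>
     ((\<lambda>r. coord_at \<A> (c t) (c r)) has_vector_derivative w) (at t within S)"

definition velocity ::
  "'p topology \<Rightarrow> ('p, 'e::real_normed_vector) chart set \<Rightarrow> (real \<Rightarrow> 'p) \<Rightarrow> real \<Rightarrow> 'e" where
  "velocity X \<A> c t = (THE w. has_velocity X \<A> c w t UNIV)"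

section \<open>Differential forms\<close>

text \<open>A 2-form is a function of a point and two tangent vectors. For vector-valued 1-forms
  \<open>\<alpha>\<close>, \<open>\<beta>\<close> at a point and a bilinear form \<open>b\<close>, \<open>form_pair b \<alpha> \<beta>\<close> is the 2-form \<open>(\<alpha>, \<beta>)\<close>.\<close>
definition form_pair :: "('e \<Rightarrow> 'e \<Rightarrow> real) \<Rightarrow> ('t \<Rightarrow> 'e) \<Rightarrow> ('t \<Rightarrow> 'e) \<Rightarrow> 't \<Rightarrow> 't \<Rightarrow> real" where
  "form_pair b \<alpha> \<beta> X Y = b (\<alpha> X) (\<beta> Y) - b (\<alpha> Y) (\<beta> X)"

definition pullback ::
  "('p \<Rightarrow> 'q) \<Rightarrow> ('p \<Rightarrow> 's \<Rightarrow> 't) \<Rightarrow> ('q \<Rightarrow> 't \<Rightarrow> 't \<Rightarrow> real) \<Rightarrow> 'p \<Rightarrow> 's \<Rightarrow> 's \<Rightarrow> real" where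
  "pullback F dF \<omega> p X Y = \<omega> (F p) (dF p X) (dF p Y)"

text \<open>\<open>pr\<^sub>1\<^sup>*\<omega> + pr\<^sub>2\<^sup>*\<omega>\<close>\<close>
definition sum_form ::
  "('p \<Rightarrow> 't \<Rightarrow> 't \<Rightarrow> real) \<Rightarrow> 'p \<times> 'p \<Rightarrow> 't \<times> 't \<Rightarrow> 't \<times> 't \<Rightarrow> real" where
  "sum_form \<omega> p X Y = \<omega> (fst p) (fst X) (fst Y) + \<omega> (snd p) (snd X) (snd Y)"

section \<open>Lie groups\<close>

record ('g, 'e) lie_data = "'g monoid" +
  gtop :: "'g topology"
  gatlas :: "('g, 'e) chart set"

text \<open>The model space is a finite-dimensional inner product space. The class \<^class>\<open>euclidean_space\<close>
  is not used because it excludes dimension 0; the classes below hold for all finite-dimensional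
  inner product spaces.\<close>
definition lie_group :: "('g, 'e::{real_inner, banach, heine_borel}) lie_data \<Rightarrow> bool" where
  "lie_group G \<longleftrightarrow>
     (\<exists>B::'e set. finite B \<and> span B = UNIV) \<and>
     group G \<and> topspace (gtop G) = carrier G \<and>
     smooth_manifold (gtop G) (gatlas G) \<and>
     smooth_map (prod_topology (gtop G) (gtop G)) (prod_atlas (gatlas G) (gatlas G))
       (gtop G) (gatlas G) (\<lambda>(x, y). x \<otimes>\<^bsub>G\<^esub> y) \<and>
     smooth_map (gtop G) (gatlas G) (gtop G) (gatlas G) (\<lambda>x. inv\<^bsub>G\<^esub> x)"

text \<open>The Lie algebra is the tangent space at \<open>\<one>\<close>, so it is represented by the model space.
  The Maurer-Cartan forms at \<open>g\<close> are maps from the tangent space at \<open>g\<close> to the Lie algebra.\<close>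

definition mc_left :: "('g, 'e::real_normed_vector) lie_data \<Rightarrow> 'g \<Rightarrow> 'e \<Rightarrow> 'e" where
  "mc_left G g = tangent_map (gatlas G) (gatlas G) (\<lambda>x. inv\<^bsub>G\<^esub> g \<otimes>\<^bsub>G\<^esub> x) g"

definition mc_right :: "('g, 'e::real_normed_vector) lie_data \<Rightarrow> 'g \<Rightarrow> 'e \<Rightarrow> 'e" where
  "mc_right G g = tangent_map (gatlas G) (gatlas G) (\<lambda>x. x \<otimes>\<^bsub>G\<^esub> inv\<^bsub>G\<^esub> g) g"

definition Ad :: "('g, 'e::real_normed_vector) lie_data \<Rightarrow> 'g \<Rightarrow> 'e \<Rightarrow> 'e" where
  "Ad G g = tangent_map (gatlas G) (gatlas G) (\<lambda>x. g \<otimes>\<^bsub>G\<^esub> x \<otimes>\<^bsub>G\<^esub> inv\<^bsub>G\<^esub> g) \<one>\<^bsub>G\<^esub>"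

text \<open>\<open>[X, Y] = ad\<^sub>X Y\<close>, where \<open>ad\<close> is the tangent map of \<open>Ad\<close> at \<open>\<one>\<close>; this is the bracket of
  left-invariant vector fields.\<close>
definition lie_bracket :: "('g, 'e::real_normed_vector) lie_data \<Rightarrow> 'e \<Rightarrow> 'e \<Rightarrow> 'e" where
  "lie_bracket G X Y = tangent_map (gatlas G) vec_atlas (\<lambda>g. Ad G g Y) \<one>\<^bsub>G\<^esub> X"

text \<open>The exponential map: \<open>c\<close> is the integral curve through \<open>\<one>\<close> of the left-invariant vector field
  given by \<open>X\<close>.\<close>
definition lie_exp :: "('g, 'e::real_normed_vector) lie_data \<Rightarrow> 'e \<Rightarrow> 'g" where
  "lie_exp G X =
     (SOME c. c 0 = \<one>\<^bsub>G\<^esub> \<and>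
        (\<forall>t. \<exists>w. has_velocity (gtop G) (gatlas G) c w t UNIV \<and> mc_left G (c t) w = X)) 1"

definition invariant_form :: "('g, 'e::real_normed_vector) lie_data \<Rightarrow> ('e \<Rightarrow> 'e \<Rightarrow> real) \<Rightarrow> bool" where
  "invariant_form G b \<longleftrightarrow> (\<forall>g\<in>carrier G. \<forall>X Y. b (Ad G g X) (Ad G g Y) = b X Y)"

definition omega_D ::
  "('g, 'e::real_normed_vector) lie_data \<Rightarrow> ('e \<Rightarrow> 'e \<Rightarrow> real) \<Rightarrow> 'g \<times> 'g \<Rightarrow> 'e \<times> 'e \<Rightarrow> 'e \<times> 'e \<Rightarrow> real" where
  "omega_D G b = (\<lambda>(x, y) X Y.
     1/2 * form_pair b (\<lambda>Z. Ad G y (mc_left G x (fst Z))) (\<lambda>Z. mc_left G x (fst Z)) X Y +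
     1/2 * form_pair b (\<lambda>Z. mc_left G x (fst Z))
             (\<lambda>Z. mc_left G y (snd Z) + mc_right G y (snd Z)) X Y)"

section \<open>Loop groups\<close>

text \<open>Functions on \<open>S\<^sup>1 = \<real>/\<int>\<close> are 1-periodic functions on \<open>\<real>\<close>.\<close>

definition LG :: "('g, 'e::real_normed_vector) lie_data \<Rightarrow> (real \<Rightarrow> 'g) set" where
  "LG G = {\<gamma>. smooth_map euclideanreal vec_atlas (gtop G) (gatlas G) \<gamma> \<and> (\<forall>s. \<gamma> (s + 1) = \<gamma> s)}"

text \<open>The loop Lie algebra, and also its smooth dual: the 1-form \<open>A(s) ds\<close> is represented by the
  function \<open>A\<close>.\<close>
definition Lg :: "(real \<Rightarrow> 'e::real_normed_vector) set" where
  "Lg = {A. smooth_on UNIV A \<and> (\<forall>s. A (s + 1) = A s)}"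

definition gauge ::
  "('g, 'e::real_normed_vector) lie_data \<Rightarrow> (real \<Rightarrow> 'g) \<Rightarrow> (real \<Rightarrow> 'e) \<Rightarrow> real \<Rightarrow> 'e" where
  "gauge G \<gamma> A = (\<lambda>s. Ad G (\<gamma> s) (A s) + mc_right G (\<gamma> s) (velocity (gtop G) (gatlas G) \<gamma> s))"

definition inv_loop :: "(real \<Rightarrow> 'e::real_normed_vector) \<Rightarrow> real \<Rightarrow> 'e" where
  "inv_loop A = (\<lambda>s. - A (1 - s))"

text \<open>\<open>Hol_s(A)\<close> for \<open>s \<in> [0,1]\<close>\<close>
definition hol :: "('g, 'e::real_normed_vector) lie_data \<Rightarrow> (real \<Rightarrow> 'e) \<Rightarrow> real \<Rightarrow> 'g" where
  "hol G A =
     (SOME h. h 0 = \<one>\<^bsub>G\<^esub> \<and>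
        (\<forall>s\<in>{0..1}. \<exists>w. has_velocity (gtop G) (gatlas G) h w s {0..1} \<and>
           mc_left G (h s) w = - A s))"

text \<open>A tangent vector \<open>(v, B)\<close> at \<open>(\<gamma>, A)\<close>, with the first component trivialized by left translation,
  is represented by the curve \<open>t \<mapsto> (\<gamma> exp(tv), A + tB)\<close>. Tangent maps are computed by
  differentiating along these curves at \<open>t = 0\<close>.\<close>

definition affine_line :: "(real \<Rightarrow> 'e::real_normed_vector) \<Rightarrow> (real \<Rightarrow> 'e) \<Rightarrow> real \<Rightarrow> real \<Rightarrow> 'e" where
  "affine_line A B t = (\<lambda>s. A s + t *\<^sub>R B s)"

definition loop_curve ::
  "('g, 'e::real_normed_vector) lie_data \<Rightarrow> (real \<Rightarrow> 'g) \<times> (real \<Rightarrow> 'e) \<Rightarrow>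
   (real \<Rightarrow> 'e) \<times> (real \<Rightarrow> 'e) \<Rightarrow> real \<Rightarrow> (real \<Rightarrow> 'g) \<times> (real \<Rightarrow> 'e)" where
  "loop_curve G p X t =
     ((\<lambda>s. fst p s \<otimes>\<^bsub>G\<^esub> lie_exp G (t *\<^sub>R fst X s)), affine_line (snd p) (snd X) t)"

definition omega_LG ::
  "('g, 'e::{real_normed_vector, banach}) lie_data \<Rightarrow> ('e \<Rightarrow> 'e \<Rightarrow> real) \<Rightarrow>
   (real \<Rightarrow> 'g) \<times> (real \<Rightarrow> 'e) \<Rightarrow> (real \<Rightarrow> 'e) \<times> (real \<Rightarrow> 'e) \<Rightarrow> (real \<Rightarrow> 'e) \<times> (real \<Rightarrow> 'e) \<Rightarrow> real" where
  "omega_LG G b = (\<lambda>(\<gamma>, A) (v1, A1) (v2, A2).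
     integral {0..1} (\<lambda>s. b (A1 s) (v2 s) - b (A2 s) (v1 s)
       - b (A s) (lie_bracket G (v1 s) (v2 s)) - b (v1 s) (vector_derivative v2 (at s))))"

text \<open>The pullback of the right-invariant Maurer-Cartan form under \<open>Hol_s\<close>, at \<open>A\<close>, applied to \<open>B\<close>.\<close>
definition hol_mc_right ::
  "('g, 'e::real_normed_vector) lie_data \<Rightarrow> real \<Rightarrow> (real \<Rightarrow> 'e) \<Rightarrow> (real \<Rightarrow> 'e) \<Rightarrow> 'e" where
  "hol_mc_right G s A B =
     mc_right G (hol G A s) (velocity (gtop G) (gatlas G) (\<lambda>t. hol G (affine_line A B t) s) 0)"

definition varpi ::
  "('g, 'e::real_normed_vector) lie_data \<Rightarrow> ('e \<Rightarrow> 'e \<Rightarrow> real) \<Rightarrow>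
   (real \<Rightarrow> 'e) \<Rightarrow> (real \<Rightarrow> 'e) \<Rightarrow> (real \<Rightarrow> 'e) \<Rightarrow> real" where
  "varpi G b A X Y = 1/2 * integral {0..1} (\<lambda>s.
     form_pair b (hol_mc_right G s A)
       (\<lambda>B. vector_derivative (\<lambda>r. hol_mc_right G r A B) (at s within {0..1})) X Y)"

definition f_map ::
  "('g, 'e::real_normed_vector) lie_data \<Rightarrow> (real \<Rightarrow> 'g) \<times> (real \<Rightarrow> 'e) \<Rightarrow> 'g \<times> 'g" where
  "f_map G p = (fst p 0, hol G (snd p) 1)"

definition d_f_map ::
  "('g, 'e::real_normed_vector) lie_data \<Rightarrow> (real \<Rightarrow> 'g) \<times> (real \<Rightarrow> 'e) \<Rightarrow>
   (real \<Rightarrow> 'e) \<times> (real \<Rightarrow> 'e) \<Rightarrow> 'e \<times> 'e" where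
  "d_f_map G p X =
     (velocity (gtop G) (gatlas G) (\<lambda>t. fst (f_map G (loop_curve G p X t))) 0,
      velocity (gtop G) (gatlas G) (\<lambda>t. snd (f_map G (loop_curve G p X t))) 0)"

definition Phi ::
  "('g, 'e::real_normed_vector) lie_data \<Rightarrow> (real \<Rightarrow> 'g) \<times> (real \<Rightarrow> 'e) \<Rightarrow>
   (real \<Rightarrow> 'e) \<times> (real \<Rightarrow> 'e)" where
  "Phi G p = (gauge G (fst p) (snd p), inv_loop (snd p))"

text \<open>The derivative of a curve in a space of functions of \<open>s\<close> is computed pointwise in \<open>s\<close>.\<close>
definition d_Phi ::
  "('g, 'e::real_normed_vector) lie_data \<Rightarrow> (real \<Rightarrow> 'g) \<times> (real \<Rightarrow> 'e) \<Rightarrow>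
   (real \<Rightarrow> 'e) \<times> (real \<Rightarrow> 'e) \<Rightarrow> (real \<Rightarrow> 'e) \<times> (real \<Rightarrow> 'e)" where
  "d_Phi G p X =
     ((\<lambda>s. vector_derivative (\<lambda>t. fst (Phi G (loop_curve G p X t)) s) (at 0)),
      (\<lambda>s. vector_derivative (\<lambda>t. snd (Phi G (loop_curve G p X t)) s) (at 0)))"

end

theory Submission
  imports Defs
begin

text \<open>Write \<open>h\<close> for \<open>Hol(A)\<close> and let \<open>\<eta>\<close> be the right-trivialised variation of \<open>h\<close> in the direction
  \<open>A\<^sub>1\<close>, so \<open>\<eta>' = - Ad\<^sub>h A\<^sub>1\<close>. Since the holonomies of \<open>\<gamma> \<cdot> A\<close> and \<open>inv(A)\<close> are
  \<open>\<gamma>(0) h(s) \<gamma>(s)\<^sup>-\<^sup>1\<close> and \<open>h(1)\<^sup>-\<^sup>1 h(1 - s)\<close>, their variations are \<open>\<eta> - Ad\<^sub>h v + v(0)\<close> and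
  \<open>\<eta>(1 - s) - \<eta>(1)\<close>, up to the adjoint action of a constant. Hence both sides of the claim are
  integrals over \<open>[0,1]\<close> of expressions in \<open>\<eta>\<close> and \<open>Ad\<^sub>h v\<close>, and the difference of the
  integrands is an exact derivative, whose boundary values give \<open>\<omega>\<^sub>D\<close>.

  Smooth dependence of ordinary differential equations on parameters is not needed: a perturbed
  solution divided by the unperturbed one solves an equation with small right-hand side, and such
  solutions are expanded to first order in one chart around \<open>\<one>\<close>.\<close>

section \<open>Finite-dimensional inner product spaces\<close>

text \<open>Tangent spaces at different points are copies of the model space seen through unrelated
  charts, so velocities along a curve cannot be compared directly. Everything is therefore phrased
  through the logarithmic derivative \<open>LD\<close>, whose values lie in the one fixed Lie
  algebra; its product rule turns uniqueness of solutions into the fact that a curve with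
  logarithmic derivative 0 is constant. The adjoint action is given only as a tangent map at each
  separate group element, so its differentiability in that element has to be extracted from the
  multiplication.

  The factor \<open>inv_loop\<close> in \<open>Phi\<close> is what makes an exact derivative
  possible: reversing the path changes the sign of the terms quadratic in \<eta>, so these cancel
  between the two copies of \<open>varpi\<close>. In what remains, \<eta> is paired with
  \<open>Ad\<^sub>h v\<close> or with a constant, and invariance of the form turns these pairings,
  together with \<open>omega_LG\<close>, into total derivatives.\<close>

lemma finite_dim_coordinates:
  fixes B :: "'e::real_inner set"
  assumes "finite B" "span B = UNIV"
  shows "\<exists>(E::'e set) n. finite E \<and> (\<forall>x. x = (\<Sum>i\<in>E. (x \<bullet> n i) *\<^sub>R i))"
proof -
  obtain C where C: "finite C" "span C = (UNIV::'e set)" "pairwise orthogonal C"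
    using basis_orthogonal[OF assms(1)] assms(2) by metis
  \<comment> \<open>The dual vectors of the orthogonal family \<open>C\<close>. A zero vector in
    \<open>C\<close> is harmless, because its summand vanishes on both sides.\<close>
  define n where "n i = inverse (i \<bullet> i) *\<^sub>R i" for i :: 'e
  have "x = (\<Sum>i\<in>C. (x \<bullet> n i) *\<^sub>R i)" for x
  proof -
    have "x \<in> span C" using C(2) by simp
    then obtain u where u: "x = (\<Sum>i\<in>C. u i *\<^sub>R i)"
      using span_finite[OF C(1)] by auto
    have "(x \<bullet> n j) *\<^sub>R j = u j *\<^sub>R j" if j: "j \<in> C" for j
    proof -
      have "x \<bullet> j = (\<Sum>i\<in>C. u i * (i \<bullet> j))"
        by (simp add: u inner_sum_left)
      also have "\<dots> = (\<Sum>i\<in>C. if i = j then u j * (j \<bullet> j) else 0)"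
        using C(3) j by (intro sum.cong) (auto simp: pairwise_def orthogonal_def)
      also have "\<dots> = u j * (j \<bullet> j)"
        using C(1) j by simp
      finally show ?thesis
        by (cases "j = 0") (auto simp: n_def)
    qed
    then have "(\<Sum>i\<in>C. (x \<bullet> n i) *\<^sub>R i) = (\<Sum>i\<in>C. u i *\<^sub>R i)"
      by (intro sum.cong) auto
    then show ?thesis
      using u by metis
  qed
  then show ?thesis
    using C(1) by blast
qed

text \<open>Finite dimension is a property of the type, given by a spanning set. The expansions of
  \<open>coordinates\<close> against dual vectors take over the role of an orthonormal
  basis.\<close>

locale finite_dim =
  fixes ty :: "'e::{real_inner, banach, heine_borel} itself"
  assumes finite_spanning: "\<exists>B::'e set. finite B \<and> span B = UNIV"
begin

lemma coordinates:
  obtains E :: "'e set" and n where "finite E" "\<And>x. x = (\<Sum>i\<in>E. (x \<bullet> n i) *\<^sub>R i)"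
  using finite_spanning finite_dim_coordinates by metis

text \<open>The constant depends on \<open>f\<close> only through its values on \<open>E\<close>.
  For a family of linear maps it is therefore continuous or bounded in the parameter as soon as
  these finitely many values are.\<close>

lemma linear_bound:
  fixes f :: "'e \<Rightarrow> 'b::real_normed_vector"
  assumes f: "linear f" and E: "finite E" "x = (\<Sum>i\<in>E. (x \<bullet> n i) *\<^sub>R i)"
  shows "norm (f x) \<le> norm x * (\<Sum>i\<in>E. norm (n i) * norm (f i))"
proof -
  interpret linear f by fact
  have "f x = f (\<Sum>i\<in>E. (x \<bullet> n i) *\<^sub>R i)"
    by (rule arg_cong[OF E(2)])
  also have "\<dots> = (\<Sum>i\<in>E. (x \<bullet> n i) *\<^sub>R f i)"
    by (simp add: sum scaleR)
  also have "norm \<dots> \<le> (\<Sum>i\<in>E. norm ((x \<bullet> n i) *\<^sub>R f i))"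
    by (rule norm_sum)
  also have "\<dots> \<le> (\<Sum>i\<in>E. norm x * (norm (n i) * norm (f i)))"
    by (intro sum_mono) (metis Cauchy_Schwarz_ineq2 mult.assoc mult_right_mono norm_ge_zero norm_scaleR)
  finally show ?thesis
    by (simp add: sum_distrib_left)
qed

lemma linear_bounded:
  fixes f :: "'e \<Rightarrow> 'b::real_normed_vector"
  assumes f: "linear f"
  shows "bounded_linear f"
proof -
  obtain E :: "'e set" and n where E: "finite E" "\<And>x. x = (\<Sum>i\<in>E. (x \<bullet> n i) *\<^sub>R i)"
    using coordinates by blast
  show ?thesis
    using f linear_bound[OF f E(1) E(2)]
    by (intro bounded_linear_intro[where K = "\<Sum>i\<in>E. norm (n i) * norm (f i)"])
      (auto simp: linear_add linear_scale)
qed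

lemma bilinear_bounded:
  fixes f :: "'e \<Rightarrow> 'e \<Rightarrow> 'b::real_normed_vector"
  assumes f: "bilinear f"
  shows "bounded_bilinear f"
proof -
  obtain E :: "'e set" and n where E: "finite E" "\<And>x. x = (\<Sum>i\<in>E. (x \<bullet> n i) *\<^sub>R i)"
    using coordinates by blast
  define K where "K = (\<Sum>i\<in>E. norm (n i) * (\<Sum>j\<in>E. norm (n j) * norm (f i j)))"
  have "norm (f x y) \<le> norm x * norm y * K" for x y
  proof -
    have 1: "norm (f i y) \<le> norm y * (\<Sum>j\<in>E. norm (n j) * norm (f i j))" for i
      using f by (intro linear_bound[OF _ E(1) E(2)]) (auto simp: bilinear_def)
    have "norm (f x y) \<le> norm x * (\<Sum>i\<in>E. norm (n i) * norm (f i y))"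
      using f by (intro linear_bound[OF _ E(1) E(2)]) (auto simp: bilinear_def)
    also have "\<dots> \<le> norm x * (\<Sum>i\<in>E. norm (n i) * (norm y * (\<Sum>j\<in>E. norm (n j) * norm (f i j))))"
      by (intro mult_left_mono sum_mono 1) auto
    also have "\<dots> = norm x * norm y * K"
      by (simp add: K_def sum_distrib_left mult_ac)
    finally show ?thesis .
  qed
  then show ?thesis
    using f by (intro bounded_bilinear.intro)
      (auto simp: bilinear_ladd bilinear_radd bilinear_lmul bilinear_rmul)
qed

end

section \<open>Velocities and tangent maps\<close>

lemma has_vector_derivative_cong_eventually:
  assumes "(f has_vector_derivative w) (at t within S)" "\<forall>\<^sub>F r in at t within S. f r = g r" "f t = g t" "t \<in> S"
  shows "(g has_vector_derivative w) (at t within S)"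
  using assms has_derivative_transform_eventually unfolding has_vector_derivative_def by blast

lemma has_vector_derivative_compose_linear:
  assumes "(c has_vector_derivative w) (at t within S)" "(T has_derivative D) (at (c t))"
  shows "((\<lambda>r. T (c r)) has_vector_derivative D w) (at t within S)"
proof -
  have "((\<lambda>r. T (c r)) has_derivative (\<lambda>h. D (h *\<^sub>R w))) (at t within S)"
    using has_derivative_compose[OF assms(1)[unfolded has_vector_derivative_def] assms(2)] .
  then show ?thesis
    using assms(2) by (simp add: has_vector_derivative_def has_derivative_def linear_simps)
qed

text \<open>Near \<open>t\<close> the curve stays in the chart domain, so \<open>F (c r)\<close>
  factors through the coordinates and the ordinary chain rule applies. The topology is arbitrary in
  order to cover changes of chart, maps of the group, and the multiplication on the product.\<close>

lemma vector_derivative_coord_change: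
  assumes inj: "inj_on \<kappa> V" and V: "openin X V" and t: "t \<in> S"
    and lim: "limitin X c (c t) (at t within S)" and cV: "c t \<in> V"
    and diff: "(\<xi> \<circ> F \<circ> inv_into V \<kappa>) differentiable (at (\<kappa> (c t)))"
    and c: "((\<lambda>r. \<kappa> (c r)) has_vector_derivative w) (at t within S)"
  shows "((\<lambda>r. \<xi> (F (c r))) has_vector_derivative
     frechet_derivative (\<xi> \<circ> F \<circ> inv_into V \<kappa>) (at (\<kappa> (c t))) w) (at t within S)"
proof (rule has_vector_derivative_cong_eventually[OF has_vector_derivative_compose_linear[OF c]])
  show "(\<xi> \<circ> F \<circ> inv_into V \<kappa> has_derivative frechet_derivative (\<xi> \<circ> F \<circ> inv_into V \<kappa>) (at (\<kappa> (c t)))) (at (\<kappa> (c t)))"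
    using diff frechet_derivative_works by blast
  have "\<forall>\<^sub>F r in at t within S. c r \<in> V"
    using lim V cV by (rule limitinD)
  then show "\<forall>\<^sub>F r in at t within S. (\<xi> \<circ> F \<circ> inv_into V \<kappa>) (\<kappa> (c r)) = \<xi> (F (c r))"
    by eventually_elim (simp add: inv_into_f_f[OF inj])
  show "(\<xi> \<circ> F \<circ> inv_into V \<kappa>) (\<kappa> (c t)) = \<xi> (F (c t))"
    by (simp add: inv_into_f_f[OF inj] cV)
qed fact

lemma limitin_continuous_map_compose:
  assumes "limitin X c l F" "continuous_map X Y f"
  shows "limitin Y (\<lambda>r. f (c r)) (f l) F"
  using continuous_map_limit[OF assms(2,1)] by (simp add: o_def)

lemma limitin_cong_eventually:
  assumes "limitin X c l F" "\<forall>\<^sub>F r in F. c r = d r"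
  shows "limitin X d l F"
  unfolding limitin_def
proof (intro conjI allI impI)
  show "l \<in> topspace X"
    using assms(1) by (rule limitin_topspace)
  fix U assume "openin X U \<and> l \<in> U"
  then have "\<forall>\<^sub>F r in F. c r \<in> U"
    using assms(1) limitinD by fast
  then show "\<forall>\<^sub>F r in F. d r \<in> U"
    using assms(2) by eventually_elim simp
qed

locale lie_grp =
  fixes G :: "('g, 'e::{real_inner, banach, heine_borel}) lie_data" (structure)
  assumes lie_group: "lie_group G"
begin

sublocale group G
  using lie_group by (simp add: lie_group_def)

sublocale finite_dim "TYPE('e)"
  using lie_group by unfold_locales (simp add: lie_group_def)

abbreviation cdom :: "'g \<Rightarrow> 'g set" where "cdom p \<equiv> fst (chart_at (gatlas G) p)"
abbreviation coord :: "'g \<Rightarrow> 'g \<Rightarrow> 'e" where "coord \<equiv> coord_at (gatlas G)"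
abbreviation par :: "'g \<Rightarrow> 'e \<Rightarrow> 'g" where "par p \<equiv> inv_into (cdom p) (coord p)"
abbreviation vel where "vel \<equiv> has_velocity (gtop G) (gatlas G)"
abbreviation TM where "TM \<equiv> tangent_map (gatlas G) (gatlas G)"

lemma topspace_gtop: "topspace (gtop G) = carrier G"
  using lie_group by (simp add: lie_group_def)

lemma smooth_atlas: "smooth_atlas (gtop G) (gatlas G)"
  using lie_group by (simp add: lie_group_def smooth_manifold_def)

lemma smooth_mult:
  "smooth_map (prod_topology (gtop G) (gtop G)) (prod_atlas (gatlas G) (gatlas G))
       (gtop G) (gatlas G) (\<lambda>(x, y). x \<otimes> y)"
  using lie_group by (simp add: lie_group_def)

lemma atlas_chart:
  assumes "(V, \<kappa>) \<in> gatlas G"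
  shows "openin (gtop G) V" "open (\<kappa> ` V)" "inj_on \<kappa> V"
    "\<And>W. openin (gtop G) W \<Longrightarrow> open (\<kappa> ` (W \<inter> V))" "V \<subseteq> carrier G"
proof -
  have 1: "openin (gtop G) V" "open (\<kappa> ` V)"
    "homeomorphic_map (subtopology (gtop G) V) (top_of_set (\<kappa> ` V)) \<kappa>"
    using smooth_atlas assms unfolding smooth_atlas_def by fast+
  then show "openin (gtop G) V" "open (\<kappa> ` V)" by auto
  show sub: "V \<subseteq> carrier G"
    using openin_subset[OF 1(1)] topspace_gtop by simp
  then show "inj_on \<kappa> V"
    using homeomorphic_imp_injective_map[OF 1(3)] by (simp add: topspace_gtop Int_absorb1)
  show "open (\<kappa> ` (W \<inter> V))" if "openin (gtop G) W" for W
  proof -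
    have "openin (top_of_set (\<kappa> ` V)) (\<kappa> ` (W \<inter> V))"
      using homeomorphic_imp_open_map[OF 1(3)] that
      by (simp add: open_map_def openin_subtopology_Int)
    then show ?thesis
      using 1(2) openin_open_eq by blast
  qed
qed

lemma chart_at_in:
  assumes "p \<in> carrier G"
  shows "(cdom p, coord p) \<in> gatlas G" "p \<in> cdom p"
proof -
  have "\<exists>c. c \<in> gatlas G \<and> p \<in> fst c"
    using smooth_atlas assms unfolding smooth_atlas_def topspace_gtop[symmetric] by force
  then have "chart_at (gatlas G) p \<in> gatlas G \<and> p \<in> fst (chart_at (gatlas G) p)"
    unfolding chart_at_def by (rule someI_ex)
  then show "(cdom p, coord p) \<in> gatlas G" "p \<in> cdom p"
    by (auto simp: coord_at_def)
qed

lemma par_coord: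
  assumes "p \<in> carrier G" "x \<in> cdom p"
  shows "par p (coord p x) = x"
  using assms atlas_chart(3) chart_at_in(1) inv_into_f_f by metis

lemma limitin_par:
  assumes "(V, \<kappa>) \<in> gatlas G" "x \<in> V"
  shows "limitin (gtop G) (inv_into V \<kappa>) x (nhds (\<kappa> x))"
  unfolding limitin_def
proof (intro conjI allI impI)
  show "x \<in> topspace (gtop G)"
    using assms atlas_chart(5) topspace_gtop by auto
  fix W assume W: "openin (gtop G) W \<and> x \<in> W"
  have "\<forall>\<^sub>F u in nhds (\<kappa> x). u \<in> \<kappa> ` (W \<inter> V)"
    using W assms atlas_chart(4) by (intro eventually_nhds_in_open) auto
  then show "\<forall>\<^sub>F u in nhds (\<kappa> x). inv_into V \<kappa> u \<in> W"
    by eventually_elim (use atlas_chart(3)[OF assms(1)] inv_into_f_f in force)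
qed

lemma limitin_par_curve:
  assumes "(V, \<kappa>) \<in> gatlas G" "x \<in> V" "(u \<longlongrightarrow> \<kappa> x) F"
  shows "limitin (gtop G) (\<lambda>r. inv_into V \<kappa> (u r)) x F"
  using limitin_par[OF assms(1,2)] assms(3)
  unfolding limitin_def filterlim_def le_filter_def eventually_filtermap by auto

lemma smooth_transition:
  assumes "(V, \<kappa>) \<in> gatlas G" "(W, \<xi>) \<in> gatlas G" "x \<in> V" "x \<in> W"
  shows "(\<xi> \<circ> (\<lambda>x. x) \<circ> inv_into V \<kappa>) differentiable (at (\<kappa> x))"
proof -
  have "smooth_on (\<kappa> ` (V \<inter> W)) (\<xi> \<circ> inv_into V \<kappa>)"
    using smooth_atlas assms unfolding smooth_atlas_def by fast
  then have "C_k_on (Suc 0) (\<kappa> ` (V \<inter> W)) (\<xi> \<circ> inv_into V \<kappa>)"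
    unfolding smooth_on_def by blast
  then show ?thesis
    using assms by (auto simp: o_def)
qed

lemma chart_change:
  assumes "(V, \<kappa>) \<in> gatlas G" "(W, \<xi>) \<in> gatlas G" "c t \<in> V" "c t \<in> W" "t \<in> S"
    and "limitin (gtop G) c (c t) (at t within S)"
    and "((\<lambda>r. \<kappa> (c r)) has_vector_derivative w) (at t within S)"
  shows "((\<lambda>r. \<xi> (c r)) has_vector_derivative
     frechet_derivative (\<xi> \<circ> (\<lambda>x. x) \<circ> inv_into V \<kappa>) (at (\<kappa> (c t))) w) (at t within S)"
  using vector_derivative_coord_change[where F = "\<lambda>x. x" and c = c and t = t, OF atlas_chart(3,1)[OF assms(1)]]
    assms smooth_transition[OF assms(1-4)] by simp

text \<open>Differentiability is asked for in the two chosen charts, the only ones to which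
  \<open>tangent_map\<close> refers. Continuity is global, so that \<open>F\<close> carries along
  the limit condition of \<open>has_velocity\<close>.\<close>

definition mdiff :: "('g \<Rightarrow> 'g) \<Rightarrow> 'g \<Rightarrow> bool" where
  "mdiff F p \<longleftrightarrow> continuous_map (gtop G) (gtop G) F \<and>
     (coord (F p) \<circ> F \<circ> par p) differentiable (at (coord p p))"

lemma vel_in_carrier: "vel c w t S \<Longrightarrow> c t \<in> carrier G"
  unfolding has_velocity_def topspace_gtop[symmetric] by (auto dest: limitin_topspace)

lemma vel_ev_carrier: "vel c w t S \<Longrightarrow> \<forall>\<^sub>F r in at t within S. c r \<in> carrier G"
  using vel_in_carrier[of c w t S] unfolding has_velocity_def topspace_gtop[symmetric]
  by (auto intro: limitinD)

lemma vel_ev_dom: "vel c w t S \<Longrightarrow> \<forall>\<^sub>F r in at t within S. c r \<in> cdom (c t)"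
  using vel_in_carrier[of c w t S] chart_at_in[of "c t"] atlas_chart(1)[OF chart_at_in(1)[of "c t"]]
  unfolding has_velocity_def by (metis limitinD)

lemma vel_mdiff:
  assumes c: "vel c w t S" and t: "t \<in> S" and F: "mdiff F (c t)"
  shows "vel (\<lambda>r. F (c r)) (TM F (c t) w) t S"
proof -
  have p: "c t \<in> carrier G"
    using c by (rule vel_in_carrier)
  have "((\<lambda>r. coord (F (c t)) (F (c r))) has_vector_derivative TM F (c t) w) (at t within S)"
    using vector_derivative_coord_change[where F = F and c = c and t = t and \<xi> = "coord (F (c t))", OF atlas_chart(3,1)[OF chart_at_in(1)[OF p]] t _ chart_at_in(2)[OF p]] c F
    by (simp add: has_velocity_def mdiff_def tangent_map_def)
  moreover have "limitin (gtop G) (\<lambda>r. F (c r)) (F (c t)) (at t within S)"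
    using limitin_continuous_map_compose[of "gtop G" c "c t" "at t within S" "gtop G" F] c F
    by (simp add: has_velocity_def mdiff_def)
  ultimately show ?thesis
    by (simp add: has_velocity_def)
qed

lemma vel_unique:
  assumes "vel c w t S" "vel c w' t S" "at t within S \<noteq> bot"
  shows "w = w'"
  using assms vector_derivative_unique_within unfolding has_velocity_def by blast

lemma velocity_eq: "vel c w t UNIV \<Longrightarrow> velocity (gtop G) (gatlas G) c t = w"
  unfolding velocity_def by (rule the_equality) (auto intro: vel_unique)

lemma vel_cong:
  assumes "vel c w t S" "\<forall>\<^sub>F r in at t within S. c r = d r" "c t = d t" "t \<in> S"
  shows "vel d w t S"
  unfolding has_velocity_def
proof
  show "limitin (gtop G) d (d t) (at t within S)"
    using assms limitin_cong_eventually unfolding has_velocity_def by fastforce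
  have "((\<lambda>r. coord (c t) (c r)) has_vector_derivative w) (at t within S)"
    using assms(1) by (simp add: has_velocity_def)
  then show "((\<lambda>r. coord (d t) (d r)) has_vector_derivative w) (at t within S)"
    using assms by (elim has_vector_derivative_cong_eventually) (auto elim: eventually_mono)
qed

lemma vel_subset: "vel c w t S \<Longrightarrow> T \<subseteq> S \<Longrightarrow> vel c w t T"
  unfolding has_velocity_def limitin_def using filter_leD[OF at_le[of T S t]]
  by (auto intro: has_vector_derivative_within_subset)

lemma vel_const: "p \<in> carrier G \<Longrightarrow> vel (\<lambda>_. p) 0 t S"
  by (simp add: has_velocity_def topspace_gtop)

text \<open>The coordinate line through \<open>p\<close>. Every tangent vector is thus a velocity,
  and an identity between tangent maps can be proved by computing the velocity of one curve in two
  ways.\<close>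

lemma vel_exists:
  assumes p: "p \<in> carrier G"
  obtains c where "c 0 = p" "vel c w 0 UNIV" "\<And>r. c r = par p (coord p p + r *\<^sub>R w)"
proof -
  define c where "c r = par p (coord p p + r *\<^sub>R w)" for r :: real
  note ch = chart_at_in[OF p] 
  have c0: "c 0 = p"
    by (simp add: c_def par_coord p ch)
  have "((\<lambda>r. coord p p + r *\<^sub>R w) \<longlongrightarrow> coord p p + 0 *\<^sub>R w) (at 0)"
    by (intro tendsto_intros)
  then have lim: "((\<lambda>r. coord p p + r *\<^sub>R w) \<longlongrightarrow> coord p p) (at 0)"
    by simp
  then have "limitin (gtop G) c p (at 0)"
    unfolding c_def by (intro limitin_par_curve ch)
  moreover have "((\<lambda>r. coord p (c r)) has_vector_derivative w) (at 0)"
  proof (rule has_vector_derivative_cong_eventually[where f = "\<lambda>r. coord p p + r *\<^sub>R w"])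
    show "((\<lambda>r. coord p p + r *\<^sub>R w) has_vector_derivative w) (at 0)"
      by (auto intro!: derivative_eq_intros)
    have "\<forall>\<^sub>F r in at 0. coord p p + r *\<^sub>R w \<in> coord p ` cdom p"
      using lim atlas_chart(2)[OF ch(1)] ch(2) by (intro topological_tendstoD) auto
    then show "\<forall>\<^sub>F r in at 0. coord p p + r *\<^sub>R w = coord p (c r)"
      by eventually_elim (simp add: c_def f_inv_into_f)
    show "coord p p + 0 *\<^sub>R w = coord p (c 0)"
      by (simp add: c0)
  qed auto
  ultimately have "vel c w 0 UNIV"
    by (simp add: has_velocity_def c0)
  then show ?thesis
    using that c0 c_def by blast
qed

lemma linear_TM: "mdiff F p \<Longrightarrow> linear (TM F p)"
  unfolding mdiff_def tangent_map_def by (intro linear_frechet_derivative) auto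

text \<open>Group laws hold on the carrier only, so a composite of translations and its simplified
  form may differ elsewhere. Charts have their domains inside the carrier and do not see the
  difference.\<close>

lemma mdiff_cong:
  assumes "mdiff F p" "\<And>x. x \<in> carrier G \<Longrightarrow> F x = K x" "p \<in> carrier G"
  shows "mdiff K p"
proof -
  have "continuous_map (gtop G) (gtop G) K"
    using assms(1,2) continuous_map_eq topspace_gtop unfolding mdiff_def by blast
  moreover have "(coord (K p) \<circ> K \<circ> par p) differentiable (at (coord p p))"
  proof -
    obtain D where D: "(coord (F p) \<circ> F \<circ> par p has_derivative D) (at (coord p p))"
      using assms(1) unfolding mdiff_def differentiable_def by blast
    have "(coord (K p) \<circ> K \<circ> par p has_derivative D) (at (coord p p))"
    proof (rule has_derivative_transform_within_open[OF D])
      show "open (coord p ` cdom p)" "coord p p \<in> coord p ` cdom p"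
        using atlas_chart(2) chart_at_in assms(3) by auto
      fix x assume "x \<in> coord p ` cdom p"
      then have "par p x \<in> carrier G"
        using par_coord assms(3) atlas_chart(5) chart_at_in(1) by fastforce
      then show "(coord (F p) \<circ> F \<circ> par p) x = (coord (K p) \<circ> K \<circ> par p) x"
        using assms by simp
    qed
    then show ?thesis
      unfolding differentiable_def by blast
  qed
  ultimately show ?thesis
    by (simp add: mdiff_def)
qed

lemma mdiff_comp:
  assumes F: "mdiff F p" and H: "mdiff H (F p)" and p: "p \<in> carrier G"
  shows "mdiff (\<lambda>x. H (F x)) p"
  unfolding mdiff_def
proof
  show "continuous_map (gtop G) (gtop G) (\<lambda>x. H (F x))"
    using continuous_map_compose[of "gtop G" "gtop G" F "gtop G" H] F H
    by (simp add: mdiff_def o_def)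
  have Fp: "F p \<in> carrier G"
    using F p topspace_gtop unfolding mdiff_def continuous_map_def by auto
  obtain D where D: "(coord (F p) \<circ> F \<circ> par p has_derivative D) (at (coord p p))"
    using F unfolding mdiff_def differentiable_def by blast
  obtain D' where D': "(coord (H (F p)) \<circ> H \<circ> par (F p) has_derivative D') (at (coord (F p) (F p)))"
    using H unfolding mdiff_def differentiable_def by blast
  have pp: "par p (coord p p) = p"
    using par_coord p chart_at_in by blast
  have "((\<lambda>u. (coord (H (F p)) \<circ> H \<circ> par (F p)) ((coord (F p) \<circ> F \<circ> par p) u)) has_derivative (\<lambda>v. D' (D v))) (at (coord p p))"
    by (rule has_derivative_compose[OF D]) (use D' in \<open>simp add: pp o_def\<close>)
  then have "(coord (H (F p)) \<circ> (\<lambda>x. H (F x)) \<circ> par p has_derivative (\<lambda>v. D' (D v))) (at (coord p p))"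
  proof (rule has_derivative_transform_eventually)
    have "limitin (gtop G) (\<lambda>u. F (par p u)) (F p) (nhds (coord p p))"
      using limitin_continuous_map_compose[OF limitin_par[OF chart_at_in[OF p]], of "gtop G" F] F
      by (simp add: mdiff_def)
    then have "\<forall>\<^sub>F u in nhds (coord p p). F (par p u) \<in> cdom (F p)"
      by (rule limitinD) (use atlas_chart(1)[OF chart_at_in(1)[OF Fp]] chart_at_in(2)[OF Fp] in auto)
    then have "\<forall>\<^sub>F u in at (coord p p). F (par p u) \<in> cdom (F p)"
      by (metis eventually_nhds_conv_at)
    then show "\<forall>\<^sub>F u in at (coord p p). (coord (H (F p)) \<circ> H \<circ> par (F p)) ((coord (F p) \<circ> F \<circ> par p) u)
        = (coord (H (F p)) \<circ> (\<lambda>x. H (F x)) \<circ> par p) u"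
      by eventually_elim (simp add: par_coord Fp)
  qed (simp_all add: pp par_coord[OF Fp chart_at_in(2)[OF Fp]])
  then show "(coord (H (F p)) \<circ> (\<lambda>x. H (F x)) \<circ> par p) differentiable at (coord p p)"
    unfolding differentiable_def by blast
qed

text \<open>Both sides are the velocity of the image of the same test curve. The composite is given
  as a separate map \<open>K\<close> so that it can be stated in a form already simplified by the
  group laws.\<close>

lemma TM_comp:
  assumes F: "mdiff F p" and H: "mdiff H (F p)" and p: "p \<in> carrier G"
    and K: "\<And>x. x \<in> carrier G \<Longrightarrow> H (F x) = K x"
  shows "TM H (F p) (TM F p w) = TM K p w"
proof -
  obtain c where c: "c 0 = p" "vel c w 0 UNIV"
    using vel_exists[OF p] by blast
  have "mdiff K p"
    using mdiff_cong[OF mdiff_comp[OF F H p] K p] by simp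
  then have 1: "vel (\<lambda>r. K (c r)) (TM K p w) 0 UNIV"
    using vel_mdiff[OF c(2), of K] c(1) by simp
  have "vel (\<lambda>r. F (c r)) (TM F p w) 0 UNIV"
    using vel_mdiff[OF c(2), of F] c(1) F by simp
  then have "vel (\<lambda>r. H (F (c r))) (TM H (F p) (TM F p w)) 0 UNIV"
    using vel_mdiff[of "\<lambda>r. F (c r)" _ 0 UNIV H] c(1) H by simp
  then have "vel (\<lambda>r. K (c r)) (TM H (F p) (TM F p w)) 0 UNIV"
    using vel_ev_carrier[OF c(2)] c(1) p K by (elim vel_cong) (auto elim: eventually_mono)
  then show ?thesis
    using 1 vel_unique by force
qed

lemma TM_ident:
  assumes p: "p \<in> carrier G" and K: "\<And>x. x \<in> carrier G \<Longrightarrow> K x = x"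
  shows "mdiff K p" "TM K p w = w"
proof -
  have "((\<lambda>x. x) has_derivative (\<lambda>x. x)) (at (coord p p))"
    by simp
  then have "(coord p \<circ> (\<lambda>x. x) \<circ> par p has_derivative (\<lambda>x. x)) (at (coord p p))"
  proof (rule has_derivative_transform_within_open)
    show "open (coord p ` cdom p)" "coord p p \<in> coord p ` cdom p"
      using atlas_chart(2) chart_at_in p by auto
  qed (auto simp: f_inv_into_f)
  then have "mdiff (\<lambda>x. x) p"
    unfolding mdiff_def differentiable_def by auto
  then show K': "mdiff K p"
    using mdiff_cong p K by metis
  obtain c where c: "c 0 = p" "vel c w 0 UNIV"
    using vel_exists[OF p] by blast
  have "vel (\<lambda>r. K (c r)) w 0 UNIV"
    using c vel_ev_carrier[OF c(2)] c(1) p K by (intro vel_cong[OF c(2)]) (auto elim: eventually_mono)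
  then show "TM K p w = w"
    using vel_mdiff[OF c(2), of K] K' c(1) vel_unique by force
qed

section \<open>Calculus on the group\<close>

definition chart_mult :: "('g, 'e) chart \<Rightarrow> ('g, 'e) chart \<Rightarrow> ('g \<Rightarrow> 'e) \<Rightarrow> 'e \<times> 'e \<Rightarrow> 'e" where
  "chart_mult c d \<zeta> = \<zeta> \<circ> (\<lambda>(x, y). x \<otimes> y) \<circ> inv_into (fst c \<times> fst d) (map_prod (snd c) (snd d))"

lemma inj_on_map_prod_chart:
  assumes "(V, \<kappa>) \<in> gatlas G" "(W, \<xi>) \<in> gatlas G"
  shows "inj_on (map_prod \<kappa> \<xi>) (V \<times> W)"
  using atlas_chart(3)[OF assms(1)] atlas_chart(3)[OF assms(2)] by (rule map_prod_inj_on)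

lemma chart_mult_eq:
  assumes "(V, \<kappa>) \<in> gatlas G" "(W, \<xi>) \<in> gatlas G" "x \<in> V" "y \<in> W"
  shows "chart_mult (V, \<kappa>) (W, \<xi>) \<zeta> (\<kappa> x, \<xi> y) = \<zeta> (x \<otimes> y)"
  using inv_into_f_f[OF inj_on_map_prod_chart[OF assms(1,2)], of "(x, y)"] assms(3,4)
  by (simp add: chart_mult_def)

lemma chart_mult_smooth:
  assumes "(V, \<kappa>) \<in> gatlas G" "(W, \<xi>) \<in> gatlas G" "(Z, \<zeta>) \<in> gatlas G"
  shows "smooth_on (map_prod \<kappa> \<xi> ` (V \<times> W \<inter> (\<lambda>(x, y). x \<otimes> y) -` Z)) (chart_mult (V, \<kappa>) (W, \<xi>) \<zeta>)"
proof -
  have "(V \<times> W, map_prod \<kappa> \<xi>) \<in> prod_atlas (gatlas G) (gatlas G)"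
    using assms unfolding prod_atlas_def by blast
  then show ?thesis
    using smooth_mult assms(3) unfolding smooth_map_def chart_mult_def by fastforce
qed

lemma chart_mult_differentiable:
  assumes "(V, \<kappa>) \<in> gatlas G" "(W, \<xi>) \<in> gatlas G" "(Z, \<zeta>) \<in> gatlas G" "x \<in> V" "y \<in> W" "x \<otimes> y \<in> Z"
  shows "chart_mult (V, \<kappa>) (W, \<xi>) \<zeta> differentiable (at (\<kappa> x, \<xi> y))"
proof -
  have "C_k_on (Suc 0) (map_prod \<kappa> \<xi> ` (V \<times> W \<inter> (\<lambda>(x, y). x \<otimes> y) -` Z)) (chart_mult (V, \<kappa>) (W, \<xi>) \<zeta>)"
    using chart_mult_smooth[OF assms(1-3)] unfolding smooth_on_def by blast
  moreover have "(\<kappa> x, \<xi> y) \<in> map_prod \<kappa> \<xi> ` (V \<times> W \<inter> (\<lambda>(x, y). x \<otimes> y) -` Z)"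
    using assms by (force simp: map_prod_def)
  ultimately show ?thesis
    by (metis C_k_on.simps(2))
qed

lemma continuous_mult: "continuous_map (prod_topology (gtop G) (gtop G)) (gtop G) (\<lambda>(x, y). x \<otimes> y)"
  using smooth_mult by (simp add: smooth_map_def)

lemma limitin_mult:
  assumes "limitin (gtop G) c x F" "limitin (gtop G) d y F"
  shows "limitin (gtop G) (\<lambda>r. c r \<otimes> d r) (x \<otimes> y) F"
proof -
  have "limitin (prod_topology (gtop G) (gtop G)) (\<lambda>r. (c r, d r)) (x, y) F"
    using assms by (simp add: limitin_pairwise o_def)
  from limitin_continuous_map_compose[OF this continuous_mult] show ?thesis
    by simp
qed

lemma chart_mult_curve:
  assumes "(V, \<kappa>) \<in> gatlas G" "(W, \<xi>) \<in> gatlas G" "(Z, \<zeta>) \<in> gatlas G"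
    and "c t \<in> V" "d t \<in> W" "c t \<otimes> d t \<in> Z" "t \<in> S"
    and lim: "limitin (gtop G) c (c t) (at t within S)" "limitin (gtop G) d (d t) (at t within S)"
    and "((\<lambda>r. \<kappa> (c r)) has_vector_derivative v) (at t within S)"
    and "((\<lambda>r. \<xi> (d r)) has_vector_derivative w) (at t within S)"
  shows "((\<lambda>r. \<zeta> (c r \<otimes> d r)) has_vector_derivative
     frechet_derivative (chart_mult (V, \<kappa>) (W, \<xi>) \<zeta>) (at (\<kappa> (c t), \<xi> (d t))) (v, w)) (at t within S)"
proof -
  have 1: "limitin (prod_topology (gtop G) (gtop G)) (\<lambda>r. (c r, d r)) (c t, d t) (at t within S)"
    using lim by (simp add: limitin_pairwise o_def)
  have 2: "((\<lambda>r. map_prod \<kappa> \<xi> (c r, d r)) has_vector_derivative (v, w)) (at t within S)"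
    using has_vector_derivative_Pair[OF assms(10,11)] by simp
  have 3: "openin (prod_topology (gtop G) (gtop G)) (V \<times> W)"
    using assms(1,2) atlas_chart(1) by (simp add: openin_prod_Times_iff)
  have "(\<zeta> \<circ> (\<lambda>(x, y). x \<otimes> y) \<circ> inv_into (V \<times> W) (map_prod \<kappa> \<xi>)) differentiable at (map_prod \<kappa> \<xi> (c t, d t))"
    using chart_mult_differentiable[OF assms(1-6)] by (simp add: chart_mult_def)
  from vector_derivative_coord_change[OF inj_on_map_prod_chart[OF assms(1,2)] 3 assms(7), of "\<lambda>r. (c r, d r)", OF 1 _ this 2]
  show ?thesis
    using assms by (simp add: chart_mult_def)
qed

end

text \<open>Used where two solutions are joined: at the common end point the derivatives from the
  two sides are put together.\<close>

lemma has_vector_derivative_Un: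
  assumes "(f has_vector_derivative w) (at t within S)" "(f has_vector_derivative w) (at t within T)"
  shows "(f has_vector_derivative w) (at t within S \<union> T)"
  using assms unfolding has_vector_derivative_def has_derivative_within[of _ _ t]
  by (simp add: at_within_union filterlim_sup)

context lie_grp
begin

text \<open>A left translation in coordinates is the slice of the multiplication in which the first
  coordinate is frozen at \<open>coord g g\<close>.\<close>

lemma mdiff_left:
  assumes g: "g \<in> carrier G" and p: "p \<in> carrier G"
  shows "mdiff (\<lambda>x. g \<otimes> x) p"
  unfolding mdiff_def
proof
  have "continuous_map (gtop G) (prod_topology (gtop G) (gtop G)) (\<lambda>x. (g, x))"
    using g by (simp add: continuous_map_pairedI topspace_gtop)
  from continuous_map_compose[OF this continuous_mult]
  show "continuous_map (gtop G) (gtop G) (\<lambda>x. g \<otimes> x)"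
    by (simp add: o_def)
  let ?\<mu> = "chart_mult (cdom g, coord g) (cdom p, coord p) (coord (g \<otimes> p))"
  note ch = chart_at_in[OF g] chart_at_in[OF p] chart_at_in[of "g \<otimes> p"]
  have gp: "g \<otimes> p \<in> carrier G" using g p by simp
  obtain D where D: "(?\<mu> has_derivative D) (at (coord g g, coord p p))"
    using chart_mult_differentiable[OF ch(1,3) ch(5)[OF gp] ch(2,4) ch(6)[OF gp]]
    unfolding differentiable_def by blast
  have "((\<lambda>u. (coord g g, u)) has_derivative (\<lambda>h. (0, h))) (at (coord p p))"
    by (auto intro!: derivative_eq_intros)
  from has_derivative_compose[OF this D]
  have "((\<lambda>u. ?\<mu> (coord g g, u)) has_derivative (\<lambda>h. D (0, h))) (at (coord p p))" .
  then have "(coord (g \<otimes> p) \<circ> (\<lambda>x. g \<otimes> x) \<circ> par p has_derivative (\<lambda>h. D (0, h))) (at (coord p p))"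
  proof (rule has_derivative_transform_within_open)
    show "open (coord p ` cdom p)" "coord p p \<in> coord p ` cdom p"
      using atlas_chart(2)[OF ch(3)] ch(4) by auto
    fix u assume "u \<in> coord p ` cdom p"
    then obtain y where y: "y \<in> cdom p" "u = coord p y" by blast
    show "?\<mu> (coord g g, u) = (coord (g \<otimes> p) \<circ> (\<lambda>x. g \<otimes> x) \<circ> par p) u"
      using chart_mult_eq[OF ch(1,3) ch(2) y(1)] y par_coord[OF p] by simp
  qed
  then show "(coord (g \<otimes> p) \<circ> (\<lambda>x. g \<otimes> x) \<circ> par p) differentiable at (coord p p)"
    unfolding differentiable_def by blast
qed

lemma mdiff_right:
  assumes g: "g \<in> carrier G" and p: "p \<in> carrier G"
  shows "mdiff (\<lambda>x. x \<otimes> g) p"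
  unfolding mdiff_def
proof
  have "continuous_map (gtop G) (prod_topology (gtop G) (gtop G)) (\<lambda>x. (x, g))"
    using g by (simp add: continuous_map_pairedI topspace_gtop)
  from continuous_map_compose[OF this continuous_mult]
  show "continuous_map (gtop G) (gtop G) (\<lambda>x. x \<otimes> g)"
    by (simp add: o_def)
  let ?\<mu> = "chart_mult (cdom p, coord p) (cdom g, coord g) (coord (p \<otimes> g))"
  note ch = chart_at_in[OF p] chart_at_in[OF g] chart_at_in[of "p \<otimes> g"]
  have gp: "p \<otimes> g \<in> carrier G" using g p by simp
  obtain D where D: "(?\<mu> has_derivative D) (at (coord p p, coord g g))"
    using chart_mult_differentiable[OF ch(1,3) ch(5)[OF gp] ch(2,4) ch(6)[OF gp]]
    unfolding differentiable_def by blast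
  have "((\<lambda>u. (u, coord g g)) has_derivative (\<lambda>h. (h, 0))) (at (coord p p))"
    by (auto intro!: derivative_eq_intros)
  from has_derivative_compose[OF this D]
  have "((\<lambda>u. ?\<mu> (u, coord g g)) has_derivative (\<lambda>h. D (h, 0))) (at (coord p p))" .
  then have "(coord (p \<otimes> g) \<circ> (\<lambda>x. x \<otimes> g) \<circ> par p has_derivative (\<lambda>h. D (h, 0))) (at (coord p p))"
  proof (rule has_derivative_transform_within_open)
    show "open (coord p ` cdom p)" "coord p p \<in> coord p ` cdom p"
      using atlas_chart(2)[OF ch(1)] ch(2) by auto
    fix u assume "u \<in> coord p ` cdom p"
    then obtain y where y: "y \<in> cdom p" "u = coord p y" by blast
    show "?\<mu> (u, coord g g) = (coord (p \<otimes> g) \<circ> (\<lambda>x. x \<otimes> g) \<circ> par p) u"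
      using chart_mult_eq[OF ch(1,3) y(1) ch(4)] y par_coord[OF p] by simp
  qed
  then show "(coord (p \<otimes> g) \<circ> (\<lambda>x. x \<otimes> g) \<circ> par p) differentiable at (coord p p)"
    unfolding differentiable_def by blast
qed

lemma mdiff_inv:
  assumes p: "p \<in> carrier G"
  shows "mdiff (\<lambda>x. inv x) p"
proof -
  have s: "smooth_map (gtop G) (gatlas G) (gtop G) (gatlas G) (\<lambda>x. inv x)"
    using lie_group by (simp add: lie_group_def)
  have ip: "inv p \<in> carrier G" using p by simp
  have "smooth_on (coord p ` (cdom p \<inter> (\<lambda>x. inv x) -` cdom (inv p))) (coord (inv p) \<circ> (\<lambda>x. inv x) \<circ> par p)"
    using s chart_at_in(1)[OF p] chart_at_in(1)[OF ip] unfolding smooth_map_def by fast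
  then have "C_k_on (Suc 0) (coord p ` (cdom p \<inter> (\<lambda>x. inv x) -` cdom (inv p))) (coord (inv p) \<circ> (\<lambda>x. inv x) \<circ> par p)"
    unfolding smooth_on_def by blast
  moreover have "p \<in> cdom p \<inter> (\<lambda>x. inv x) -` cdom (inv p)"
    using chart_at_in(2)[OF p] chart_at_in(2)[OF ip] by simp
  ultimately have "(coord (inv p) \<circ> (\<lambda>x. inv x) \<circ> par p) differentiable at (coord p p)"
    by (metis C_k_on.simps(2) imageI)
  then show ?thesis
    using s by (simp add: mdiff_def smooth_map_def)
qed

text \<open>The differential of the multiplication is linear, so its value at \<open>(v, w)\<close>
  is the sum of its values at \<open>(v, 0)\<close> and \<open>(0, w)\<close>. Each of these is
  recognised by moving one factor and keeping the other constant.\<close>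

lemma vel_mult:
  assumes c: "vel c v t S" and d: "vel d w t S" and t: "t \<in> S"
  shows "vel (\<lambda>r. c r \<otimes> d r) (TM (\<lambda>x. x \<otimes> d t) (c t) v + TM (\<lambda>x. c t \<otimes> x) (d t) w) t S"
proof -
  note p = vel_in_carrier[OF c] and q = vel_in_carrier[OF d]
  have pq: "c t \<otimes> d t \<in> carrier G" using p q by simp
  note ch = chart_at_in[OF p] chart_at_in[OF q] chart_at_in[OF pq]
  let ?\<mu> = "chart_mult (cdom (c t), coord (c t)) (cdom (d t), coord (d t)) (coord (c t \<otimes> d t))"
  define D where "D = frechet_derivative ?\<mu> (at (coord (c t) (c t), coord (d t) (d t)))"
  \<comment> \<open>Stated for all curves through the two points, at any parameter, so that it
    applies to \<open>c\<close> and \<open>d\<close> as well as to test curves.\<close>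
  have raw: "vel (\<lambda>r. c' r \<otimes> d' r) (D (v', w')) t' S'"
    if "vel c' v' t' S'" "vel d' w' t' S'" "c' t' = c t" "d' t' = d t" "t' \<in> S'" for c' d' v' w' t' S'
    using chart_mult_curve[OF ch(1,3,5), of c' t' d' S' v' w'] ch(2,4,6) that
      limitin_mult[of c' "c t" "at t' within S'" d' "d t"]
    by (simp add: has_velocity_def D_def)
  have "linear D"
    unfolding D_def using chart_mult_differentiable[OF ch(1,3,5,2,4,6)] by (rule linear_frechet_derivative)
  then have "D ((v, 0) + (0, w)) = D (v, 0) + D (0, w)"
    by (rule linear_add)
  moreover have "D (v, 0) = TM (\<lambda>x. x \<otimes> d t) (c t) v"
  proof -
    obtain e where e: "e 0 = c t" "vel e v 0 UNIV"
      using vel_exists[OF p] by blast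
    have "vel (\<lambda>r. e r \<otimes> d t) (D (v, 0)) 0 UNIV"
      using raw[OF e(2) vel_const[OF q]] e by simp
    moreover have "vel (\<lambda>r. e r \<otimes> d t) (TM (\<lambda>x. x \<otimes> d t) (c t) v) 0 UNIV"
      using vel_mdiff[OF e(2) _ mdiff_right[OF q]] e p by simp
    ultimately show ?thesis
      using vel_unique by force
  qed
  moreover have "D (0, w) = TM (\<lambda>x. c t \<otimes> x) (d t) w"
  proof -
    obtain e where e: "e 0 = d t" "vel e w 0 UNIV"
      using vel_exists[OF q] by blast
    have "vel (\<lambda>r. c t \<otimes> e r) (D (0, w)) 0 UNIV"
      using raw[OF vel_const[OF p] e(2)] e by simp
    moreover have "vel (\<lambda>r. c t \<otimes> e r) (TM (\<lambda>x. c t \<otimes> x) (d t) w) 0 UNIV"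
      using vel_mdiff[OF e(2) _ mdiff_left[OF p]] e q by simp
    ultimately show ?thesis
      using vel_unique by force
  qed
  ultimately show ?thesis
    using raw[OF c d refl refl t] by simp
qed

section \<open>Maurer-Cartan forms and the adjoint representation\<close>

lemma mdiff_conj:
  assumes "g \<in> carrier G" "p \<in> carrier G"
  shows "mdiff (\<lambda>x. g \<otimes> x \<otimes> inv g) p"
  using assms by (intro mdiff_comp[OF mdiff_left mdiff_right]) auto

lemma mc_left_TM_left:
  assumes "g \<in> carrier G" "p \<in> carrier G"
  shows "mc_left G (g \<otimes> p) (TM (\<lambda>x. g \<otimes> x) p w) = mc_left G p w"
proof -
  have "inv (g \<otimes> p) \<otimes> (g \<otimes> x) = inv p \<otimes> x" if "x \<in> carrier G" for x
  proof -
    have "inv p \<otimes> inv g \<otimes> g = inv p"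
      using assms m_assoc[of "inv p" "inv g" g] by simp
    then show ?thesis
      using assms that by (simp add: inv_mult_group m_assoc[symmetric])
  qed
  then show ?thesis
    unfolding mc_left_def using assms by (intro TM_comp mdiff_left) auto
qed

text \<open>The map x \<mapsto> (pg)^-1 x g is also x \<mapsto> g^-1 (p^-1 x) g. Its tangent map at
  \<open>p\<close>, factored in these two ways, gives the two sides.\<close>

lemma mc_left_TM_right:
  assumes "g \<in> carrier G" "p \<in> carrier G"
  shows "mc_left G (p \<otimes> g) (TM (\<lambda>x. x \<otimes> g) p w) = Ad G (inv g) (mc_left G p w)"
proof -
  let ?K = "\<lambda>x. inv (p \<otimes> g) \<otimes> (x \<otimes> g)"
  have "TM (\<lambda>x. inv (p \<otimes> g) \<otimes> x) (p \<otimes> g) (TM (\<lambda>x. x \<otimes> g) p w) = TM ?K p w"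
    using assms by (intro TM_comp[where F = "\<lambda>x. x \<otimes> g"] mdiff_left mdiff_right) auto
  moreover have "TM (\<lambda>x. inv g \<otimes> x \<otimes> inv (inv g)) (inv p \<otimes> p) (TM (\<lambda>x. inv p \<otimes> x) p w) = TM ?K p w"
    using assms by (intro TM_comp[where F = "\<lambda>x. inv p \<otimes> x"] mdiff_left mdiff_conj) (auto simp: inv_mult_group m_assoc)
  ultimately show ?thesis
    using assms by (simp add: mc_left_def Ad_def)
qed

text \<open>From x p^-1 = p (p^-1 x) p^-1.\<close>

lemma mc_right_eq:
  assumes "p \<in> carrier G"
  shows "mc_right G p w = Ad G p (mc_left G p w)"
proof -
  have "TM (\<lambda>x. p \<otimes> x \<otimes> inv p) (inv p \<otimes> p) (TM (\<lambda>x. inv p \<otimes> x) p w) = TM (\<lambda>x. x \<otimes> inv p) p w"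
    using assms by (intro TM_comp[where F = "\<lambda>x. inv p \<otimes> x"] mdiff_left mdiff_conj) (auto simp: m_assoc[symmetric])
  then show ?thesis
    using assms by (simp add: mc_left_def mc_right_def Ad_def)
qed

lemma TM_mc_left:
  assumes "p \<in> carrier G"
  shows "TM (\<lambda>x. p \<otimes> x) \<one> (mc_left G p w) = w"
proof -
  have "TM (\<lambda>x. p \<otimes> x) (inv p \<otimes> p) (TM (\<lambda>x. inv p \<otimes> x) p w) = TM (\<lambda>x. x) p w"
    using assms by (intro TM_comp[where F = "\<lambda>x. inv p \<otimes> x"] mdiff_left) (auto simp: m_assoc[symmetric])
  then show ?thesis
    using assms TM_ident(2)[OF assms, of "\<lambda>x. x"] by (simp add: mc_left_def)
qed

lemma mc_left_one: "mc_left G \<one> w = w"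
  unfolding mc_left_def by (rule TM_ident(2)) auto

lemma linear_mc_left: "p \<in> carrier G \<Longrightarrow> linear (mc_left G p)"
  unfolding mc_left_def by (intro linear_TM mdiff_left) auto

lemma linear_Ad: "g \<in> carrier G \<Longrightarrow> linear (Ad G g)"
  unfolding Ad_def by (intro linear_TM mdiff_conj) auto

lemma bounded_linear_Ad: "g \<in> carrier G \<Longrightarrow> bounded_linear (Ad G g)"
  by (intro linear_bounded linear_Ad)

lemma Ad_one [simp]: "Ad G \<one> X = X"
  unfolding Ad_def by (rule TM_ident(2)) auto

lemma Ad_mult:
  assumes "g \<in> carrier G" "h \<in> carrier G"
  shows "Ad G (g \<otimes> h) X = Ad G g (Ad G h X)"
proof -
  have "TM (\<lambda>x. g \<otimes> x \<otimes> inv g) (h \<otimes> \<one> \<otimes> inv h) (TM (\<lambda>x. h \<otimes> x \<otimes> inv h) \<one> X) = TM (\<lambda>x. g \<otimes> h \<otimes> x \<otimes> inv (g \<otimes> h)) \<one> X"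
    using assms by (intro TM_comp[where F = "\<lambda>x. h \<otimes> x \<otimes> inv h"] mdiff_conj) (auto simp: m_assoc inv_mult_group)
  then show ?thesis
    using assms by (simp add: Ad_def)
qed

lemma Ad_inv [simp]:
  assumes "g \<in> carrier G"
  shows "Ad G (inv g) (Ad G g X) = X" "Ad G g (Ad G (inv g) X) = X"
  using assms Ad_mult[of "inv g" g X] Ad_mult[of g "inv g" X] by auto

lemma Ad_minus: "g \<in> carrier G \<Longrightarrow> Ad G g (- X) = - Ad G g X"
  by (intro linear_neg linear_Ad)

lemma Ad_zero [simp]: "g \<in> carrier G \<Longrightarrow> Ad G g 0 = 0"
  by (intro linear_0 linear_Ad)

lemma Ad_add: "g \<in> carrier G \<Longrightarrow> Ad G g (X + Y) = Ad G g X + Ad G g Y"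
  by (intro linear_add linear_Ad)

lemma Ad_diff: "g \<in> carrier G \<Longrightarrow> Ad G g (X - Y) = Ad G g X - Ad G g Y"
  by (intro linear_diff linear_Ad)

lemma Ad_scale: "g \<in> carrier G \<Longrightarrow> Ad G g (a *\<^sub>R X) = a *\<^sub>R Ad G g X"
  by (intro linear_scale linear_Ad)

text \<open>Logarithmic derivative: \<open>c(t)\<^sup>-\<^sup>1 c'(t) = X\<close>, where the derivative is taken within \<open>S\<close>.\<close>
definition LD :: "(real \<Rightarrow> 'g) \<Rightarrow> 'e \<Rightarrow> real \<Rightarrow> real set \<Rightarrow> bool" where
  "LD c X t S \<longleftrightarrow> t \<in> S \<and> (\<exists>w. vel c w t S \<and> mc_left G (c t) w = X)"

text \<open>Left translation by \<open>c t\<close> inverts \<open>mc_left\<close> at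
  \<open>c t\<close>, so the velocity can be written down explicitly and the existential quantifier
  disappears.\<close>

lemma LD_iff: "LD c X t S \<longleftrightarrow> t \<in> S \<and> c t \<in> carrier G \<and> vel c (TM (\<lambda>x. c t \<otimes> x) \<one> X) t S"
proof -
  have "mc_left G (c t) (TM (\<lambda>x. c t \<otimes> x) \<one> X) = X" if "c t \<in> carrier G"
    using mc_left_TM_left[OF that one_closed] that by (simp add: mc_left_one)
  then show ?thesis
    unfolding LD_def using TM_mc_left vel_in_carrier by metis
qed

lemma LD_carrier: "LD c X t S \<Longrightarrow> c t \<in> carrier G"
  by (simp add: LD_iff)

lemma LD_unique: "LD c X t S \<Longrightarrow> LD c Y t S \<Longrightarrow> at t within S \<noteq> bot \<Longrightarrow> X = Y"
  unfolding LD_def using vel_unique by blast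

lemma LD_subset: "LD c X t S \<Longrightarrow> T \<subseteq> S \<Longrightarrow> t \<in> T \<Longrightarrow> LD c X t T"
  unfolding LD_def using vel_subset by blast

lemma LD_const: "p \<in> carrier G \<Longrightarrow> t \<in> S \<Longrightarrow> LD (\<lambda>_. p) 0 t S"
  unfolding LD_def using vel_const linear_0[OF linear_mc_left] by blast

lemma LD_cong_eventually:
  "LD c X t S \<Longrightarrow> \<forall>\<^sub>F r in at t within S. c r = d r \<Longrightarrow> c t = d t \<Longrightarrow> LD d X t S"
  unfolding LD_def using vel_cong by metis

lemma LD_cong:
  assumes "LD c X t S" "\<And>r. r \<in> S \<Longrightarrow> c r = d r"
  shows "LD d X t S"
proof -
  have "\<forall>\<^sub>F r in at t within S. c r = d r"
    using assms(2) by (simp add: eventually_at_filter)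
  then show ?thesis
    using assms LD_cong_eventually LD_def by blast
qed

lemma LD_mult:
  assumes "LD c X t S" "LD d Y t S"
  shows "LD (\<lambda>r. c r \<otimes> d r) (Ad G (inv (d t)) X + Y) t S"
proof -
  obtain v w where c: "vel c v t S" "mc_left G (c t) v = X" and d: "vel d w t S" "mc_left G (d t) w = Y"
    and t: "t \<in> S" using assms unfolding LD_def by blast
  note p = vel_in_carrier[OF c(1)] and q = vel_in_carrier[OF d(1)]
  have "mc_left G (c t \<otimes> d t) (TM (\<lambda>x. x \<otimes> d t) (c t) v + TM (\<lambda>x. c t \<otimes> x) (d t) w)
     = Ad G (inv (d t)) X + Y"
    using linear_add[OF linear_mc_left] mc_left_TM_right mc_left_TM_left p q c d by simp
  then show ?thesis
    using vel_mult[OF c(1) d(1) t] t unfolding LD_def by blast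
qed

lemma LD_left_translate:
  assumes "LD c X t S" "g \<in> carrier G"
  shows "LD (\<lambda>r. g \<otimes> c r) X t S"
proof -
  have "t \<in> S" "c t \<in> carrier G" using assms(1) by (auto simp: LD_iff)
  then show ?thesis
    using LD_mult[OF LD_const assms(1), of g] assms(2) by simp
qed

lemma LD_right_translate:
  assumes "LD c X t S" "g \<in> carrier G"
  shows "LD (\<lambda>r. c r \<otimes> g) (Ad G (inv g) X) t S"
proof -
  have "t \<in> S" using assms(1) by (auto simp: LD_iff)
  then show ?thesis
    using LD_mult[OF assms(1) LD_const, of g] assms(2) by simp
qed

lemma LD_inv:
  assumes "LD c X t S"
  shows "LD (\<lambda>r. inv (c r)) (- Ad G (c t) X) t S"
proof -
  obtain w where c: "vel c w t S" "mc_left G (c t) w = X" and t: "t \<in> S"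
    using assms unfolding LD_def by blast
  note p = vel_in_carrier[OF c(1)]
  \<comment> \<open>The tangent map of inversion comes from differentiating e e^-1 = 1. This is done
    along a test curve on the whole line, since \<open>t\<close> may be isolated in \<open>S\<close>
    and derivatives within \<open>S\<close> are then not unique.\<close>
  have Z: "mc_left G (inv (c t)) (TM (\<lambda>x. inv x) (c t) v) = - Ad G (c t) (mc_left G (c t) v)" for v
  proof -
    let ?Z = "mc_left G (inv (c t)) (TM (\<lambda>x. inv x) (c t) v)"
    obtain e where e: "e 0 = c t" "vel e v 0 UNIV"
      using vel_exists[OF p] by blast
    have "LD (\<lambda>r. inv (e r)) ?Z 0 UNIV"
      using vel_mdiff[OF e(2) _ mdiff_inv] e p unfolding LD_def by auto
    moreover have "LD e (mc_left G (c t) v) 0 UNIV"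
      using e unfolding LD_def by auto
    ultimately have "LD (\<lambda>r. e r \<otimes> inv (e r)) (Ad G (c t) (mc_left G (c t) v) + ?Z) 0 UNIV"
      using LD_mult[of e _ 0 UNIV] e p by fastforce
    then have "LD (\<lambda>r. \<one>) (Ad G (c t) (mc_left G (c t) v) + ?Z) 0 UNIV"
      by (rule LD_cong_eventually) (use vel_ev_carrier[OF e(2)] e p in \<open>auto elim: eventually_mono\<close>)
    then have "Ad G (c t) (mc_left G (c t) v) + ?Z = 0"
      using LD_const[of \<one> 0 UNIV] LD_unique by force
    then show ?thesis
      by (simp add: eq_neg_iff_add_eq_0 add.commute)
  qed
  then show ?thesis
    using vel_mdiff[OF c(1) t mdiff_inv[OF p]] t Z[of w] c(2) unfolding LD_def by auto
qed

section \<open>Reparametrising, joining and comparing curves by their logarithmic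
  derivatives\<close>

lemma limitin_within_nhds:
  assumes "limitin X c (c t) (at t within S)" "openin X U" "c t \<in> U"
  obtains T where "open T" "t \<in> T" "\<And>r. r \<in> T \<Longrightarrow> r \<in> S \<Longrightarrow> c r \<in> U"
proof -
  have "\<forall>\<^sub>F r in at t within S. c r \<in> U"
    using assms by (rule limitinD)
  then obtain T where "open T" "t \<in> T" "\<And>r. r \<in> T \<Longrightarrow> r \<noteq> t \<Longrightarrow> r \<in> S \<Longrightarrow> c r \<in> U"
    unfolding eventually_at_topological by blast
  then show ?thesis
    using that[of T] assms(3) by blast
qed

lemma LD_affine:
  assumes "LD c X (k * t + m) S'" "\<And>r. r \<in> S \<Longrightarrow> k * r + m \<in> S'" "t \<in> S"
  shows "LD (\<lambda>r. c (k * r + m)) (k *\<^sub>R X) t S"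
proof -
  obtain w where c: "vel c w (k * t + m) S'" "mc_left G (c (k * t + m)) w = X"
    using assms unfolding LD_def by blast
  \<comment> \<open>Argued with open sets instead of punctured neighbourhoods: \<open>k\<close> may
    be 0, and then every \<open>r\<close> is sent to the limit point itself.\<close>
  have "limitin (gtop G) (\<lambda>r. c (k * r + m)) (c (k * t + m)) (at t within S)"
    unfolding limitin_def
  proof (intro conjI allI impI)
    show "c (k * t + m) \<in> topspace (gtop G)"
      using vel_in_carrier[OF c(1)] topspace_gtop by simp
    fix U assume "openin (gtop G) U \<and> c (k * t + m) \<in> U"
    then obtain T where T: "open T" "k * t + m \<in> T" "\<And>r. r \<in> T \<Longrightarrow> r \<in> S' \<Longrightarrow> c r \<in> U"
      using c(1) limitin_within_nhds[where t = "k * t + m" and c = c and S = S'] unfolding has_velocity_def by metis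
    have "open ((\<lambda>r. k * r + m) -` T)"
      using T(1) by (intro open_vimage continuous_intros)
    then show "\<forall>\<^sub>F r in at t within S. c (k * r + m) \<in> U"
      unfolding eventually_at_topological
      by (intro exI[of _ "(\<lambda>r. k * r + m) -` T"]) (use T assms(2) in auto)
  qed
  moreover have "((\<lambda>r. coord (c (k * t + m)) (c (k * r + m))) has_vector_derivative (k *\<^sub>R w)) (at t within S)"
  proof -
    have 1: "((\<lambda>r. k * r + m) has_vector_derivative k) (at t within S)"
      by (auto intro!: derivative_eq_intros simp: has_vector_derivative_def)
    have "((\<lambda>x. coord (c (k * t + m)) (c x)) has_vector_derivative w) (at (k * t + m) within (\<lambda>r. k * r + m) ` S)"
      using c(1) assms(2) unfolding has_velocity_def by (auto intro: has_vector_derivative_within_subset)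
    from vector_diff_chain_within[OF 1 this] show ?thesis
      by (simp add: o_def)
  qed
  ultimately have "vel (\<lambda>r. c (k * r + m)) (k *\<^sub>R w) t S"
    by (simp add: has_velocity_def)
  moreover have "mc_left G (c (k * t + m)) (k *\<^sub>R w) = k *\<^sub>R X"
    using linear_scale[OF linear_mc_left] vel_in_carrier[OF c(1)] c(2) by simp
  ultimately show ?thesis
    using assms(3) unfolding LD_def by blast
qed

lemma LD_Un:
  assumes "LD c X t S" "LD c X t T"
  shows "LD c X t (S \<union> T)"
  using assms unfolding LD_iff has_velocity_def limitin_def at_within_union[of t S T] eventually_sup
  using has_vector_derivative_Un[of _ _ t S T] by (auto simp: at_within_union)

text \<open>Inside a single chart this is the constancy of a function with zero derivative on a
  convex set. So the curve is locally constant, and connectedness of \<open>S\<close> does the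
  rest.\<close>

lemma LD_zero_const:
  assumes S: "convex S" and LD: "\<And>s. s \<in> S \<Longrightarrow> LD c 0 s S" and "s \<in> S" "s' \<in> S"
  shows "c s = c s'"
proof (rule connected_local_const[of S])
  show "connected S" using S by (rule convex_connected)
  show "\<forall>s0\<in>S. \<forall>\<^sub>F r in at s0 within S. c s0 = c r"
  proof
    fix s0 assume s0: "s0 \<in> S"
    have vel: "vel c 0 s S" if "s \<in> S" for s
      using LD[OF that] linear_0[OF linear_TM[OF mdiff_left[of "c s" \<one>]]] by (simp add: LD_iff)
    have p: "c s0 \<in> carrier G"
      using LD[OF s0] by (rule LD_carrier)
    note ch = chart_at_in[OF p]
    obtain T where T: "open T" "s0 \<in> T" "\<And>r. r \<in> T \<Longrightarrow> r \<in> S \<Longrightarrow> c r \<in> cdom (c s0)"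
      using limitin_within_nhds[of "gtop G" c s0 S "cdom (c s0)"] vel[OF s0] atlas_chart(1)[OF ch(1)] ch(2)
      unfolding has_velocity_def by metis
    obtain d where d: "d > 0" "ball s0 d \<subseteq> T"
      using T(1,2) openE by blast
    have "((\<lambda>r. coord (c s0) (c r)) has_vector_derivative 0) (at r within S \<inter> ball s0 d)"
      if r: "r \<in> S \<inter> ball s0 d" for r
    proof -
      have q: "c r \<in> carrier G"
        using LD[of r] r LD_carrier by blast
      have *: "c r \<in> cdom (c s0)"
        using T(3)[of r] r d by blast
      \<comment> \<open>The velocity at \<open>r\<close> is known in the chart around
        \<open>c r\<close>. Its passage to the chart around \<open>c s0\<close> is linear and keeps
        it 0.\<close>
      have "((\<lambda>r. coord (c s0) (c r)) has_vector_derivative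
          frechet_derivative (coord (c s0) \<circ> (\<lambda>x. x) \<circ> par (c r)) (at (coord (c r) (c r))) 0) (at r within S)"
        using vel[of r] r by (intro chart_change[where c = c and t = r, OF chart_at_in(1)[OF q] ch(1) chart_at_in(2)[OF q] *])
          (auto simp: has_velocity_def)
      moreover have "frechet_derivative (coord (c s0) \<circ> (\<lambda>x. x) \<circ> par (c r)) (at (coord (c r) (c r))) 0 = 0"
        using linear_0[OF linear_frechet_derivative[OF smooth_transition[OF chart_at_in(1)[OF q] ch(1) chart_at_in(2)[OF q] *]]] .
      ultimately show ?thesis
        by (auto intro: has_vector_derivative_within_subset)
    qed
    then obtain k where k: "\<And>r. r \<in> S \<inter> ball s0 d \<Longrightarrow> coord (c s0) (c r) = k"
      using has_vector_derivative_zero_constant[of "S \<inter> ball s0 d" "\<lambda>r. coord (c s0) (c r)"] S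
      by (metis convex_Int convex_ball)
    have "c s0 = c r" if r: "r \<in> S" "dist r s0 < d" for r
    proof -
      have "coord (c s0) (c r) = coord (c s0) (c s0)"
        using k[of r] k[of s0] r s0 d(1) by (simp add: dist_commute)
      moreover have "c r \<in> cdom (c s0)"
        using T(3)[of r] r d by (metis dist_commute mem_ball subsetD)
      ultimately show ?thesis
        using atlas_chart(3)[OF ch(1)] ch(2) unfolding inj_on_def by metis
    qed
    then show "\<forall>\<^sub>F r in at s0 within S. c s0 = c r"
      unfolding eventually_at using d(1) by blast
  qed
qed fact+

text \<open>The curve c d^-1 has logarithmic derivative Ad(d) a - Ad(d) a = 0. The group structure
  thus gives uniqueness without any Lipschitz or Gronwall estimate.\<close>

lemma LD_eq:
  assumes S: "convex S" and c: "\<And>s. s \<in> S \<Longrightarrow> LD c (a s) s S" and d: "\<And>s. s \<in> S \<Longrightarrow> LD d (a s) s S"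
    and "s0 \<in> S" "c s0 = d s0" "s \<in> S"
  shows "c s = d s"
proof -
  have carr: "c s \<in> carrier G" "d s \<in> carrier G" if "s \<in> S" for s
    using c d that LD_carrier by blast+
  have "c s \<otimes> inv (d s) = c s0 \<otimes> inv (d s0)"
  proof (rule LD_zero_const[OF S])
    show "LD (\<lambda>r. c r \<otimes> inv (d r)) 0 s S" if "s \<in> S" for s
      using LD_mult[OF c[OF that] LD_inv[OF d[OF that]]] carr[OF that] by simp
  qed fact+
  then have "c s \<otimes> inv (d s) = \<one>"
    using carr assms by simp
  then show ?thesis
    using carr[OF \<open>s \<in> S\<close>] by (metis inv_equality inv_inv inv_closed)
qed

text \<open>The bridge from \<open>LD\<close> to \<open>velocity\<close>, in which the gauge action
  and the derivatives of \<open>f_map\<close> and of the holonomy are expressed.\<close>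

lemma LD_velocity:
  assumes "LD c X t UNIV"
  shows "mc_left G (c t) (velocity (gtop G) (gatlas G) c t) = X"
    "mc_right G (c t) (velocity (gtop G) (gatlas G) c t) = Ad G (c t) X"
proof -
  obtain w where w: "vel c w t UNIV" "mc_left G (c t) w = X"
    using assms unfolding LD_def by blast
  show 1: "mc_left G (c t) (velocity (gtop G) (gatlas G) c t) = X"
    using velocity_eq[OF w(1)] w(2) by simp
  show "mc_right G (c t) (velocity (gtop G) (gatlas G) c t) = Ad G (c t) X"
    using mc_right_eq[OF LD_carrier[OF assms]] 1 by simp
qed


section \<open>Translation-invariant vector fields in a chart at the identity\<close>

abbreviation origin :: 'e where "origin \<equiv> coord \<one> \<one>"
abbreviation chart_dom :: "'e set" where "chart_dom \<equiv> coord \<one> ` cdom \<one>"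
abbreviation mult_one :: "'e \<times> 'e \<Rightarrow> 'e" where
  "mult_one \<equiv> chart_mult (cdom \<one>, coord \<one>) (cdom \<one>, coord \<one>) (coord \<one>)"

text \<open>The coordinate expression at \<open>u\<close> of the left-invariant vector field with
  value \<open>Y\<close> at the identity; \<open>right_field\<close> is its right-invariant
  counterpart. The identity has coordinates \<open>origin\<close>, which need not be 0.\<close>

definition left_field :: "'e \<Rightarrow> 'e \<Rightarrow> 'e" where
  "left_field u Y = frechet_derivative mult_one (at (u, origin)) (0, Y)"

definition right_field :: "'e \<Rightarrow> 'e \<Rightarrow> 'e" where
  "right_field u Y = frechet_derivative mult_one (at (origin, u)) (Y, 0)"

lemma chart_one: "(cdom \<one>, coord \<one>) \<in> gatlas G" "\<one> \<in> cdom \<one>" "open chart_dom" "origin \<in> chart_dom"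
  using chart_at_in[OF one_closed] atlas_chart(2)[OF chart_at_in(1)[OF one_closed]] by auto

lemma par_one: "par \<one> origin = \<one>" "\<And>u. u \<in> chart_dom \<Longrightarrow> par \<one> u \<in> cdom \<one>"
  "\<And>u. u \<in> chart_dom \<Longrightarrow> coord \<one> (par \<one> u) = u" "\<And>u. u \<in> chart_dom \<Longrightarrow> par \<one> u \<in> carrier G"
proof -
  show "par \<one> origin = \<one>"
    using par_coord chart_one by simp
  show *: "par \<one> u \<in> cdom \<one>" if "u \<in> chart_dom" for u
    using that by (rule inv_into_into)
  show "coord \<one> (par \<one> u) = u" if "u \<in> chart_dom" for u
    using that by (rule f_inv_into_f)
  show "par \<one> u \<in> carrier G" if "u \<in> chart_dom" for u
    using *[OF that] atlas_chart(5)[OF chart_one(1)] by blast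
qed

abbreviation mult_dom :: "('e \<times> 'e) set" where
  "mult_dom \<equiv> map_prod (coord \<one>) (coord \<one>) ` (cdom \<one> \<times> cdom \<one> \<inter> (\<lambda>(x, y). x \<otimes> y) -` cdom \<one>)"

lemma mult_domI: "u \<in> cdom \<one> \<Longrightarrow> v \<in> cdom \<one> \<Longrightarrow> u \<otimes> v \<in> cdom \<one> \<Longrightarrow> (coord \<one> u, coord \<one> v) \<in> mult_dom"
  by (intro image_eqI[where x = "(u, v)"]) auto

lemma mult_one_derivative_smooth:
  fixes Y :: "'e \<times> 'e"
  defines "D \<equiv> \<lambda>q. frechet_derivative mult_one (at q) Y"
  shows "q \<in> mult_dom \<Longrightarrow> D differentiable (at q)"
    "continuous_on mult_dom (\<lambda>q. frechet_derivative D (at q) h)"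
proof -
  have "smooth_on mult_dom mult_one"
    by (intro chart_mult_smooth chart_one)
  then have "C_k_on (Suc (Suc 0)) mult_dom mult_one"
    unfolding smooth_on_def by blast
  then have 1: "\<forall>q\<in>mult_dom. D differentiable (at q)" "continuous_on mult_dom (\<lambda>q. frechet_derivative D (at q) h)" for h
    unfolding D_def C_k_on.simps by blast+
  show "D differentiable (at q)" if "q \<in> mult_dom"
    by (rule bspec[OF 1(1) that])
  show "continuous_on mult_dom (\<lambda>q. frechet_derivative D (at q) h)"
    by (rule 1(2))
qed

text \<open>Provides the Lipschitz bound for the vector field. Continuity of \<open>L u h\<close>
  for each fixed \<open>h\<close> is enough, because finitely many directions control the operator
  norm.\<close>

lemma left_field_C1:
  obtains L where "\<And>u. u \<in> chart_dom \<Longrightarrow> ((\<lambda>u. left_field u Y) has_derivative L u) (at u)"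
    "\<And>h. continuous_on chart_dom (\<lambda>u. L u h)"
proof -
  let ?D = "\<lambda>q. frechet_derivative mult_one (at q) (0, Y)"
  define L where "L u h = frechet_derivative ?D (at (u, origin)) (h, 0)" for u h
  have in_dom: "\<exists>g. u = coord \<one> g \<and> g \<in> cdom \<one> \<and> g \<otimes> \<one> \<in> cdom \<one>" if "u \<in> chart_dom" for u
  proof -
    obtain g where "u = coord \<one> g" "g \<in> cdom \<one>" using \<open>u \<in> chart_dom\<close> by blast
    moreover have "g \<otimes> \<one> = g"
      using \<open>g \<in> cdom \<one>\<close> atlas_chart(5)[OF chart_one(1)] by auto
    ultimately show ?thesis by auto
  qed
  have "((\<lambda>u. left_field u Y) has_derivative L u) (at u)" if u: "u \<in> chart_dom" for u
  proof -
    obtain g where g: "u = coord \<one> g" "g \<in> cdom \<one>" "g \<otimes> \<one> \<in> cdom \<one>"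
      using in_dom[OF u] by blast
    have "(?D has_derivative frechet_derivative ?D (at (u, origin))) (at (u, origin))"
      using mult_one_derivative_smooth(1)[OF mult_domI[OF g(2) chart_one(2) g(3)]] g(1) frechet_derivative_works by blast
    moreover have "((\<lambda>u. (u, origin)) has_derivative (\<lambda>h. (h, 0))) (at u)"
      by (auto intro!: derivative_eq_intros)
    ultimately show ?thesis
      unfolding left_field_def L_def by (rule has_derivative_compose[rotated])
  qed
  moreover have "continuous_on chart_dom (\<lambda>u. L u h)" for h
  proof -
    have "(\<lambda>u. (u, origin)) ` chart_dom \<subseteq> mult_dom"
    proof (rule image_subsetI)
      fix u assume "u \<in> chart_dom"
      then obtain g where "u = coord \<one> g" "g \<in> cdom \<one>" "g \<otimes> \<one> \<in> cdom \<one>"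
        using in_dom by blast
      then show "(u, origin) \<in> mult_dom"
        using mult_domI[OF _ chart_one(2), of g] by simp
    qed
    then have "continuous_on ((\<lambda>u. (u, origin)) ` chart_dom) (\<lambda>q. frechet_derivative ?D (at q) (h, 0))"
      by (rule continuous_on_subset[OF mult_one_derivative_smooth(2)])
    from continuous_on_compose2[OF this, of chart_dom "\<lambda>u. (u, origin)"] show ?thesis
      unfolding L_def by (simp add: continuous_intros)
  qed
  ultimately show ?thesis
    using that by blast
qed

lemma right_field_differentiable:
  "(\<lambda>u. right_field u Y) differentiable (at origin)"
proof -
  let ?D = "\<lambda>q. frechet_derivative mult_one (at q) (Y, 0)"
  have "(?D has_derivative frechet_derivative ?D (at (origin, origin))) (at (origin, origin))"
    using mult_one_derivative_smooth(1)[OF mult_domI[OF chart_one(2) chart_one(2)]] chart_one(2) frechet_derivative_works by auto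
  moreover have "((\<lambda>u. (origin, u)) has_derivative (\<lambda>h. (0, h))) (at origin)"
    by (auto intro!: derivative_eq_intros)
  ultimately have "((\<lambda>u. right_field u Y) has_derivative (\<lambda>h. frechet_derivative ?D (at (origin, origin)) (0, h))) (at origin)"
    unfolding right_field_def by (rule has_derivative_compose[rotated])
  then show ?thesis
    unfolding differentiable_def by blast
qed

lemma left_field_curve:
  assumes "g \<in> cdom \<one>" "vel d Y t S" "d t = \<one>" "t \<in> S"
  shows "((\<lambda>r. coord \<one> (g \<otimes> d r)) has_vector_derivative left_field (coord \<one> g) Y) (at t within S)"
  using chart_mult_curve[OF chart_one(1) chart_one(1) chart_one(1), of "\<lambda>_. g" t d S 0 Y] assms chart_one(2)
    atlas_chart(5)[OF chart_one(1)]
  by (auto simp: has_velocity_def left_field_def topspace_gtop)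

lemma right_field_curve:
  assumes "g \<in> cdom \<one>" "vel d Y t S" "d t = \<one>" "t \<in> S"
  shows "((\<lambda>r. coord \<one> (d r \<otimes> g)) has_vector_derivative right_field (coord \<one> g) Y) (at t within S)"
  using chart_mult_curve[OF chart_one(1) chart_one(1) chart_one(1), of d t "\<lambda>_. g" S Y 0] assms chart_one(2)
    atlas_chart(5)[OF chart_one(1)]
  by (auto simp: has_velocity_def right_field_def topspace_gtop)

lemma linear_left_field: "u \<in> chart_dom \<Longrightarrow> linear (left_field u)"
proof -
  assume "u \<in> chart_dom"
  then obtain g where g: "u = coord \<one> g" "g \<in> cdom \<one>" "g \<otimes> \<one> \<in> cdom \<one>"
    using atlas_chart(5)[OF chart_one(1)] by auto
  then have "linear (frechet_derivative mult_one (at (u, origin)))"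
    using chart_mult_differentiable[OF chart_one(1) chart_one(1) chart_one(1) g(2) chart_one(2) g(3)]
    by (intro linear_frechet_derivative) simp
  then have "linear (frechet_derivative mult_one (at (u, origin)) \<circ> (\<lambda>Y. (0, Y)))"
    by (intro linear_compose[of "\<lambda>Y. (0, Y)"]) (auto simp: linear_iff)
  then show ?thesis
    by (simp add: o_def left_field_def[abs_def])
qed

lemma linear_right_field: "u \<in> chart_dom \<Longrightarrow> linear (right_field u)"
proof -
  assume "u \<in> chart_dom"
  then obtain g where g: "u = coord \<one> g" "g \<in> cdom \<one>" "\<one> \<otimes> g \<in> cdom \<one>"
    using atlas_chart(5)[OF chart_one(1)] by auto
  then have "linear (frechet_derivative mult_one (at (origin, u)))"
    using chart_mult_differentiable[OF chart_one(1) chart_one(1) chart_one(1) chart_one(2) g(2) g(3)]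
    by (intro linear_frechet_derivative) simp
  then have "linear (frechet_derivative mult_one (at (origin, u)) \<circ> (\<lambda>Y. (Y, 0)))"
    by (intro linear_compose[of "\<lambda>Y. (Y, 0)"]) (auto simp: linear_iff)
  then show ?thesis
    by (simp add: o_def right_field_def[abs_def])
qed

lemma left_field_origin: "left_field origin Y = Y"
proof -
  obtain d where d: "d 0 = \<one>" "vel d Y 0 UNIV"
    using vel_exists[OF one_closed] by blast
  have "\<forall>\<^sub>F r in at 0. d r = \<one> \<otimes> d r"
    using vel_ev_carrier[OF d(2)] by eventually_elim simp
  then have "vel (\<lambda>r. \<one> \<otimes> d r) Y 0 UNIV"
    using d(1) by (intro vel_cong[OF d(2)]) auto
  then have "((\<lambda>r. coord \<one> (\<one> \<otimes> d r)) has_vector_derivative Y) (at 0)"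
    by (simp add: has_velocity_def d)
  then show ?thesis
    using vector_derivative_unique_at[OF left_field_curve[OF chart_one(2) d(2,1) UNIV_I]] by simp
qed

lemma right_field_origin: "right_field origin Y = Y"
proof -
  obtain d where d: "d 0 = \<one>" "vel d Y 0 UNIV"
    using vel_exists[OF one_closed] by blast
  have "\<forall>\<^sub>F r in at 0. d r = d r \<otimes> \<one>"
    using vel_ev_carrier[OF d(2)] by eventually_elim simp
  then have "vel (\<lambda>r. d r \<otimes> \<one>) Y 0 UNIV"
    using d(1) by (intro vel_cong[OF d(2)]) auto
  then have "((\<lambda>r. coord \<one> (d r \<otimes> \<one>)) has_vector_derivative Y) (at 0)"
    by (simp add: has_velocity_def d)
  then show ?thesis
    using vector_derivative_unique_at[OF right_field_curve[OF chart_one(2) d(2,1) UNIV_I]] by simp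
qed

text \<open>Passes from a differential equation in coordinates back to the group. The curve
  \<open>c s \<otimes> d r\<close> has logarithmic derivative \<open>Z\<close> and the same
  coordinate velocity as \<open>c\<close>; the change to the chart around \<open>c s\<close> is the
  same linear map \<open>T\<close> for both.\<close>

lemma LD_chart:
  assumes "c s \<in> cdom \<one>" "s \<in> S" "limitin (gtop G) c (c s) (at s within S)"
    and c: "((\<lambda>r. coord \<one> (c r)) has_vector_derivative left_field (coord \<one> (c s)) Z) (at s within S)"
  shows "LD c Z s S"
proof -
  have p: "c s \<in> carrier G"
    using assms(1) atlas_chart(5)[OF chart_one(1)] by blast
  note ch = chart_at_in[OF p]
  obtain d where d: "d 0 = \<one>" "vel d Z 0 UNIV"
    using vel_exists[OF one_closed] by blast
  define e where "e r = c s \<otimes> d r" for r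
  have e0: "e 0 = c s" using p d(1) by (simp add: e_def)
  have "LD d Z 0 UNIV"
    using d mc_left_one unfolding LD_def by auto
  then have "LD e Z 0 UNIV"
    unfolding e_def using p by (rule LD_left_translate)
  then obtain W where W: "vel e W 0 UNIV" "mc_left G (c s) W = Z"
    unfolding LD_def e0 by blast
  define T where "T = frechet_derivative (coord (c s) \<circ> (\<lambda>x. x) \<circ> par \<one>) (at (coord \<one> (c s)))"
  have "((\<lambda>r. coord \<one> (e r)) has_vector_derivative left_field (coord \<one> (c s)) Z) (at 0)"
    unfolding e_def by (rule left_field_curve[OF assms(1) d(2,1)]) simp
  then have "((\<lambda>r. coord (c s) (e r)) has_vector_derivative T (left_field (coord \<one> (c s)) Z)) (at 0)"
    using chart_change[OF chart_one(1) ch(1), of e 0 UNIV] assms(1) ch(2) W(1)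
    by (simp add: e0 T_def has_velocity_def)
  then have "W = T (left_field (coord \<one> (c s)) Z)"
    using W(1) vector_derivative_unique_at unfolding has_velocity_def e0 by blast
  moreover have "((\<lambda>r. coord (c s) (c r)) has_vector_derivative T (left_field (coord \<one> (c s)) Z)) (at s within S)"
    using chart_change[OF chart_one(1) ch(1), of c s S] assms ch(2) by (simp add: T_def)
  ultimately have "vel c W s S"
    using assms(3) by (simp add: has_velocity_def)
  then show ?thesis
    using W(2) assms(2) unfolding LD_def by blast
qed

text \<open>In the chart, \<open>g exp(tY) = exp(t Ad\<^sub>g Y) g\<close> reads as follows.\<close>
lemma right_field_Ad:
  assumes g: "g \<in> cdom \<one>"
  shows "right_field (coord \<one> g) (Ad G g Y) = left_field (coord \<one> g) Y"
proof -
  have gc: "g \<in> carrier G"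
    using g atlas_chart(5)[OF chart_one(1)] by blast
  obtain d where d: "d 0 = \<one>" "vel d Y 0 UNIV"
    using vel_exists[OF one_closed] by blast
  have 1: "((\<lambda>r. coord \<one> (g \<otimes> d r)) has_vector_derivative left_field (coord \<one> g) Y) (at 0)"
    by (rule left_field_curve[OF g d(2,1)]) simp
  have "vel (\<lambda>r. g \<otimes> d r \<otimes> inv g) (Ad G g Y) 0 UNIV"
    using vel_mdiff[OF d(2) _ mdiff_conj[OF gc, of "d 0"]] d(1) by (simp add: Ad_def)
  from right_field_curve[OF g this] have
    "((\<lambda>r. coord \<one> (g \<otimes> d r \<otimes> inv g \<otimes> g)) has_vector_derivative right_field (coord \<one> g) (Ad G g Y)) (at 0)"
    using d(1) gc by simp
  then have "((\<lambda>r. coord \<one> (g \<otimes> d r)) has_vector_derivative right_field (coord \<one> g) (Ad G g Y)) (at 0)"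
  proof (rule has_vector_derivative_cong_eventually)
    show "\<forall>\<^sub>F r in at 0. coord \<one> (g \<otimes> d r \<otimes> inv g \<otimes> g) = coord \<one> (g \<otimes> d r)"
      using vel_ev_carrier[OF d(2)] by eventually_elim (simp add: gc m_assoc)
  qed (simp_all add: gc d)
  then show ?thesis
    using 1 vector_derivative_unique_at by blast
qed

section \<open>Differentiability of the adjoint representation, and the Lie bracket\<close>

lemma right_field_near_id:
  assumes "\<epsilon> > 0"
  shows "\<forall>\<^sub>F u in nhds origin. \<forall>Y. norm (right_field u Y - Y) \<le> \<epsilon> * norm Y"
proof -
  obtain E :: "'e set" and n where E: "finite E" "\<And>x. x = (\<Sum>i\<in>E. (x \<bullet> n i) *\<^sub>R i)"
    using coordinates by blast
  \<comment> \<open>A bound, up to the factor \<open>norm Y\<close>, for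
    \<open>right_field u Y - Y\<close>; it is continuous and vanishes at \<open>origin\<close>,
    where \<open>right_field\<close> is the identity.\<close>
  define K where "K u = (\<Sum>i\<in>E. norm (n i) * norm (right_field u i - i))" for u
  have "isCont (\<lambda>u. right_field u i) origin" for i
    using right_field_differentiable differentiable_imp_continuous_within by blast
  then have "isCont K origin"
    unfolding K_def by (intro continuous_intros) 
  then have "(K \<longlongrightarrow> K origin) (nhds origin)"
    by (simp add: continuous_at tendsto_at_iff_tendsto_nhds)
  then have "\<forall>\<^sub>F u in nhds origin. K u < \<epsilon>"
    by (rule order_tendstoD) (simp add: K_def right_field_origin assms)
  moreover have "\<forall>\<^sub>F u in nhds origin. u \<in> chart_dom"
    using chart_one by (intro eventually_nhds_in_open)
  ultimately show ?thesis
  proof eventually_elim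
    case (elim u)
    have "norm (right_field u Y - Y) \<le> \<epsilon> * norm Y" for Y
    proof -
      have "linear (\<lambda>Y. right_field u Y - Y)"
        using linear_right_field[OF elim(2)] by (intro linear_compose_sub linear_ident) 
      from linear_bound[OF this E(1) E(2)] have "norm (right_field u Y - Y) \<le> norm Y * K u"
        by (simp add: K_def)
      also have "\<dots> \<le> norm Y * \<epsilon>"
        using elim(1) by (intro mult_left_mono) auto
      finally show ?thesis by (simp add: mult.commute)
    qed
    then show ?case by blast
  qed
qed

text \<open>By \<open>right_field_Ad\<close>, the increment
  \<open>d u = Ad G (par \<one> u) Y - Y\<close> solves \<open>right_field u (d u) = q u\<close>,
  and \<open>q\<close> is differentiable at \<open>origin\<close>. Since
  \<open>right_field u\<close> is close to the identity, \<open>d\<close> and \<open>q\<close>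
  differ only to higher order and have the same derivative; \<open>right_field\<close> is never
  inverted.\<close>

lemma Ad_differentiable:
  "(\<lambda>u. Ad G (par \<one> u) Y) differentiable (at origin)"
proof -
  define d where "d u = Ad G (par \<one> u) Y - Y" for u
  define q where "q u = left_field u Y - right_field u Y" for u
  have q0: "q origin = 0" "d origin = 0"
    by (simp_all add: q_def d_def left_field_origin right_field_origin par_one)
  obtain L1 where "((\<lambda>u. left_field u Y) has_derivative L1) (at origin)"
    using left_field_C1 chart_one(4) by metis
  moreover obtain L2 where "((\<lambda>u. right_field u Y) has_derivative L2) (at origin)"
    using right_field_differentiable unfolding differentiable_def by blast
  ultimately obtain L where L: "(q has_derivative L) (at origin)"
    unfolding q_def using has_derivative_diff by blast
  then interpret L: bounded_linear L
    by (rule has_derivative_bounded_linear)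
  obtain K where K: "K > 0" "\<And>h. norm (L h) \<le> norm h * K"
    using L.pos_bounded by blast
  have dq: "right_field u (d u) = q u" if "u \<in> chart_dom" for u
    using right_field_Ad[OF par_one(2)[OF that], of Y] par_one(3)[OF that] linear_diff[OF linear_right_field[OF that]]
    by (simp add: d_def q_def)
  have "(d has_derivative L) (at origin)"
    unfolding has_derivative_at_alt
  proof (intro conjI allI impI)
    show "bounded_linear L" by (rule L.bounded_linear_axioms)
    fix e :: real assume e: "e > 0"
    \<comment> \<open>\<open>e1\<close> is the error allowed in the linearisation of
      \<open>q\<close>. The bound \<open>e2 \<le> 1/2\<close> lets \<open>norm (d u)\<close> be
      absorbed into \<open>2 * norm (q u)\<close>, and the second bound on \<open>e2\<close> makes
      \<open>q u - d u\<close> at most \<open>e / 2\<close> times the increment.\<close>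
    define e1 where "e1 = min 1 (e / 2)"
    define e2 where "e2 = min (1 / 2) (e / (4 * (K + 1)))"
    have e12: "e1 > 0" "e2 > 0" "e1 \<le> 1" "e1 \<le> e / 2" "e2 \<le> 1 / 2" "e2 \<le> e / (4 * (K + 1))"
      using e K(1) by (auto simp: e1_def e2_def min_def)
    obtain \<delta>1 where \<delta>1: "\<delta>1 > 0" "\<And>u. norm (u - origin) < \<delta>1 \<Longrightarrow> norm (q u - q origin - L (u - origin)) \<le> e1 * norm (u - origin)"
      using L e12(1) unfolding has_derivative_at_alt by blast
    have "\<forall>\<^sub>F u in nhds origin. u \<in> chart_dom"
      using chart_one by (intro eventually_nhds_in_open)
    with right_field_near_id[OF e12(2)]
    have "\<forall>\<^sub>F u in nhds origin. u \<in> chart_dom \<and> (\<forall>Y. norm (right_field u Y - Y) \<le> e2 * norm Y)"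
      by eventually_elim simp
    then obtain \<delta>2 where \<delta>2: "\<delta>2 > 0" "\<And>u. dist u origin < \<delta>2 \<Longrightarrow> u \<in> chart_dom"
      "\<And>u Y. dist u origin < \<delta>2 \<Longrightarrow> norm (right_field u Y - Y) \<le> e2 * norm Y"
      unfolding eventually_nhds_metric by blast
    have "norm (d u - d origin - L (u - origin)) \<le> e * norm (u - origin)" if u: "norm (u - origin) < min \<delta>1 \<delta>2" for u
    proof -
      let ?h = "u - origin"
      have u': "u \<in> chart_dom" and near: "norm (right_field u (d u) - d u) \<le> e2 * norm (d u)"
        using \<delta>2(2,3) u by (auto simp: dist_norm)
      have qL: "norm (q u - L ?h) \<le> e1 * norm ?h"
        using \<delta>1(2) u q0 by fastforce
      have qd: "norm (q u - d u) \<le> e2 * norm (d u)"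
        using near dq[OF u'] by simp
      have "norm (q u) \<le> norm (L ?h) + norm (q u - L ?h)"
        using norm_triangle_ineq[of "L ?h" "q u - L ?h"] by simp
      also have "\<dots> \<le> norm ?h * K + 1 * norm ?h"
        using K(2) qL e12(3) by (intro add_mono order_trans[OF qL] mult_right_mono) auto
      finally have q_le: "norm (q u) \<le> (K + 1) * norm ?h"
        by (simp add: algebra_simps)
      have "norm (d u) \<le> norm (q u) + norm (q u - d u)"
        using norm_triangle_sub[of "d u" "q u"] by (simp add: norm_minus_commute)
      also have "\<dots> \<le> norm (q u) + 1 / 2 * norm (d u)"
        using qd e12(5) by (intro add_mono order_trans[OF qd] mult_right_mono) auto
      finally have "norm (d u) \<le> 2 * norm (q u)" by simp
      then have d_le: "norm (d u) \<le> 2 * ((K + 1) * norm ?h)"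
        using q_le by linarith
      have "norm (q u - d u) \<le> e / (4 * (K + 1)) * (2 * ((K + 1) * norm ?h))"
        using d_le e12 by (intro order_trans[OF qd] mult_mono) auto
      also have "\<dots> = e / 2 * norm ?h"
        using K(1) by (simp add: field_simps)
      finally have "norm (q u - d u) \<le> e / 2 * norm ?h" .
      moreover have "norm (q u - L ?h) \<le> e / 2 * norm ?h"
        using e12(4) by (intro order_trans[OF qL] mult_right_mono) auto
      moreover have "norm (d u - L ?h) \<le> norm (q u - d u) + norm (q u - L ?h)"
        using norm_triangle_ineq4[of "q u - L ?h" "q u - d u"] by (simp add: norm_minus_commute algebra_simps)
      ultimately show ?thesis
        using q0 by (simp add: field_simps)
    qed
    then show "\<exists>\<delta>>0. \<forall>u. norm (u - origin) < \<delta> \<longrightarrow> norm (d u - d origin - L (u - origin)) \<le> e * norm (u - origin)"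
      using \<delta>1(1) \<delta>2(1) by (intro exI[of _ "min \<delta>1 \<delta>2"]) auto
  qed
  then have "((\<lambda>u. d u + Y) has_derivative L) (at origin)"
    by (auto intro!: derivative_eq_intros)
  then show ?thesis
    unfolding differentiable_def d_def by auto
qed

lemma lie_bracket_eq:
  "lie_bracket G X Y = frechet_derivative (\<lambda>u. Ad G (par \<one> u) Y) (at origin) X"
proof -
  have "coord_at (vec_atlas :: ('e, 'e) chart set) q = id" for q
    unfolding coord_at_def chart_at_def vec_atlas_def by (rule someI2[of _ "(UNIV, id)"]) auto
  then show ?thesis
    by (simp add: lie_bracket_def tangent_map_def o_def)
qed

text \<open>Left translation by the inverse of \<open>c t\<close> moves the curve to the identity,
  where the derivative of \<open>Ad\<close> is the bracket by definition; multiplicativity of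
  \<open>Ad\<close> restores the factor \<open>Ad G (c t)\<close>.\<close>

lemma Ad_LD:
  assumes c: "LD c X t S"
  shows "((\<lambda>r. Ad G (c r) Y) has_vector_derivative Ad G (c t) (lie_bracket G X Y)) (at t within S)"
proof -
  have t: "t \<in> S" and p: "c t \<in> carrier G"
    using c by (auto simp: LD_iff)
  define d where "d r = inv (c t) \<otimes> c r" for r
  have dt: "d t = \<one>" using p by (simp add: d_def)
  have "LD d X t S"
    unfolding d_def using c p by (intro LD_left_translate) auto
  then have d: "vel d X t S"
    unfolding LD_def dt mc_left_one by auto
  have ev: "\<forall>\<^sub>F r in at t within S. par \<one> (coord \<one> (d r)) = d r"
    using vel_ev_dom[OF d] unfolding dt by eventually_elim (simp add: par_coord)
  have "((\<lambda>r. coord \<one> (d r)) has_vector_derivative X) (at t within S)"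
    using d by (simp add: has_velocity_def dt)
  moreover have "((\<lambda>u. Ad G (par \<one> u) Y) has_derivative frechet_derivative (\<lambda>u. Ad G (par \<one> u) Y) (at origin)) (at (coord \<one> (d t)))"
    using Ad_differentiable frechet_derivative_works dt by auto
  ultimately have "((\<lambda>r. Ad G (par \<one> (coord \<one> (d r))) Y) has_vector_derivative lie_bracket G X Y) (at t within S)"
    unfolding lie_bracket_eq by (rule has_vector_derivative_compose_linear)
  then have "((\<lambda>r. Ad G (d r) Y) has_vector_derivative lie_bracket G X Y) (at t within S)"
    using ev t by (elim has_vector_derivative_cong_eventually) (auto elim: eventually_mono simp: dt par_one)
  then have "((\<lambda>r. Ad G (c t) (Ad G (d r) Y)) has_vector_derivative Ad G (c t) (lie_bracket G X Y)) (at t within S)"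
    by (rule bounded_linear.has_vector_derivative[OF bounded_linear_Ad[OF p]])
  then show ?thesis
  proof (rule has_vector_derivative_cong_eventually)
    obtain w where "vel c w t S" using c unfolding LD_def by blast
    from vel_ev_carrier[OF this]
    show "\<forall>\<^sub>F r in at t within S. Ad G (c t) (Ad G (d r) Y) = Ad G (c r) Y"
      by eventually_elim (simp add: d_def p Ad_mult)
    show "Ad G (c t) (Ad G (d t) Y) = Ad G (c t) Y"
      by (simp add: dt)
  qed fact
qed

text \<open>Linearity in the first argument is that of a derivative. In the second it is inherited
  from \<open>Ad G (c r)\<close>, differentiated along a curve with velocity
  \<open>X\<close>.\<close>

lemma bilinear_lie_bracket: "bilinear (lie_bracket G)"
  unfolding bilinear_def
proof (intro conjI allI)
  show "linear (\<lambda>X. lie_bracket G X Y)" for Y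
    unfolding lie_bracket_eq using linear_frechet_derivative[OF Ad_differentiable] by simp
  show "linear (lie_bracket G X)" for X
  proof -
    obtain c where c: "c 0 = \<one>" "vel c X 0 UNIV"
      using vel_exists[OF one_closed] by blast
    then have LD: "LD c X 0 UNIV"
      unfolding LD_def using mc_left_one by auto
    have ev: "\<forall>\<^sub>F r in at 0. c r \<in> carrier G"
      by (rule vel_ev_carrier[OF c(2)])
    have D: "((\<lambda>r. Ad G (c r) Y) has_vector_derivative lie_bracket G X Y) (at 0)" for Y
      using Ad_LD[OF LD, of Y] c(1) by simp
    show ?thesis
    proof (rule linearI)
      fix Y Z
      have "((\<lambda>r. Ad G (c r) (Y + Z)) has_vector_derivative (lie_bracket G X Y + lie_bracket G X Z)) (at 0)"
        using ev c(1) by (intro has_vector_derivative_cong_eventually[OF has_vector_derivative_add[OF D[of Y] D[of Z]]])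
          (auto elim: eventually_mono simp: Ad_add)
      then show "lie_bracket G X (Y + Z) = lie_bracket G X Y + lie_bracket G X Z"
        using D vector_derivative_unique_at by blast
    next
      fix a :: real and Y
      have "((\<lambda>r. a *\<^sub>R Ad G (c r) Y) has_vector_derivative a *\<^sub>R lie_bracket G X Y) (at 0)"
        using D[of Y] by (auto intro!: derivative_eq_intros)
      then have "((\<lambda>r. Ad G (c r) (a *\<^sub>R Y)) has_vector_derivative a *\<^sub>R lie_bracket G X Y) (at 0)"
        using ev c(1) by (elim has_vector_derivative_cong_eventually) (auto elim: eventually_mono simp: Ad_scale)
      then show "lie_bracket G X (a *\<^sub>R Y) = a *\<^sub>R lie_bracket G X Y"
        using D vector_derivative_unique_at by blast
    qed
  qed
qed

lemma bounded_bilinear_lie_bracket: "bounded_bilinear (lie_bracket G)"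
  by (rule bilinear_bounded[OF bilinear_lie_bracket])

end

section \<open>Ordinary differential equations\<close>

lemma continuous_on_lipschitz_field:
  fixes F :: "'e \<Rightarrow> 'e \<Rightarrow> 'e::real_normed_vector"
  assumes lip: "\<And>x y Z. x \<in> D \<Longrightarrow> y \<in> D \<Longrightarrow> norm (F x Z - F y Z) \<le> K * norm (x - y) * norm Z"
    and lin: "\<And>x. x \<in> D \<Longrightarrow> linear (F x)"
    and bnd: "\<And>x Z. x \<in> D \<Longrightarrow> norm (F x Z) \<le> N * norm Z"
    and a: "continuous_on T a" and u: "continuous_on T u" and uD: "u ` T \<subseteq> D"
  shows "continuous_on T (\<lambda>r. F (u r) (a r))"
  unfolding continuous_on_def
proof
  fix r0 assume r0: "r0 \<in> T"
  have "((\<lambda>r. F (u r) (a r) - F (u r0) (a r0)) \<longlongrightarrow> 0) (at r0 within T)"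
  proof (rule Lim_null_comparison)
    have "norm (F (u r) (a r) - F (u r0) (a r0)) \<le> K * norm (u r - u r0) * norm (a r) + N * norm (a r - a r0)"
      if r: "r \<in> T" for r
    proof -
      have D: "u r \<in> D" "u r0 \<in> D" using uD r r0 by auto
      have "F (u r) (a r) - F (u r0) (a r0) = (F (u r) (a r) - F (u r0) (a r)) + F (u r0) (a r - a r0)"
        using linear_diff[OF lin[OF D(2)]] by simp
      also have "norm \<dots> \<le> K * norm (u r - u r0) * norm (a r) + N * norm (a r - a r0)"
        using lip[OF D] bnd[OF D(2)] by (intro order_trans[OF norm_triangle_ineq] add_mono) auto
      finally show ?thesis .
    qed
    then show "\<forall>\<^sub>F r in at r0 within T. norm (F (u r) (a r) - F (u r0) (a r0))
        \<le> K * norm (u r - u r0) * norm (a r) + N * norm (a r - a r0)"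
      by (simp add: eventually_at_filter)
    have "((\<lambda>r. K * norm (u r - u r0) * norm (a r) + N * norm (a r - a r0)) \<longlongrightarrow>
        K * norm (u r0 - u r0) * norm (a r0) + N * norm (a r0 - a r0)) (at r0 within T)"
      using a u r0 by (intro tendsto_intros) (auto simp: continuous_on_def)
    then show "((\<lambda>r. K * norm (u r - u r0) * norm (a r) + N * norm (a r - a r0)) \<longlongrightarrow> 0) (at r0 within T)"
      by simp
  qed
  then show "((\<lambda>r. F (u r) (a r)) \<longlongrightarrow> F (u r0) (a r0)) (at r0 within T)"
    by (simp add: LIM_zero_iff)
qed

text \<open>The Banach fixed point theorem for the integral equation.
  \<open>N * M * T \<le> R\<close> keeps the iterates in the ball and
  \<open>K * M * T \<le> 1/2\<close> makes the iteration a contraction.\<close>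

lemma picard:
  fixes F :: "'e \<Rightarrow> 'e \<Rightarrow> 'e::banach"
  assumes lip: "\<And>x y Z. x \<in> cball z R \<Longrightarrow> y \<in> cball z R \<Longrightarrow> norm (F x Z - F y Z) \<le> K * norm (x - y) * norm Z"
    and lin: "\<And>x. x \<in> cball z R \<Longrightarrow> linear (F x)"
    and bnd: "\<And>x Z. x \<in> cball z R \<Longrightarrow> norm (F x Z) \<le> N * norm Z"
    and a: "continuous_on {0..T} a" and M: "\<And>s. s \<in> {0..T} \<Longrightarrow> norm (a s) \<le> M"
    and "0 \<le> R" "0 \<le> K" "0 \<le> N" "0 \<le> M" "0 \<le> T" "N * M * T \<le> R" "K * M * T \<le> 1/2"
  obtains x where "continuous_on {0..T} x" "x ` {0..T} \<subseteq> cball z R"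
    "\<And>s. s \<in> {0..T} \<Longrightarrow> x s = z + integral {0..s} (\<lambda>r. F (x r) (a r))"
proof -
  \<comment> \<open>Bounded continuous functions live on the whole line, so time is clamped to the
    interval.\<close>
  define cl where "cl s = max 0 (min T s)" for s
  have cl: "cl s \<in> {0..T}" "continuous_on UNIV cl" for s
    using \<open>0 \<le> T\<close> by (auto simp: cl_def[abs_def] intro!: continuous_intros)
  define P where "P u s = z + integral {0..cl s} (\<lambda>r. F (u r) (a r))" for u s
  define C where "C = {u :: real \<Rightarrow>\<^sub>C 'e. \<forall>s. u s \<in> cball z R}"
  have cont: "continuous_on {0..T} (\<lambda>r. F (apply_bcontfun u r) (a r))" if "u \<in> C" for u
    using that by (intro continuous_on_lipschitz_field[where D = "cball z R", OF lip lin bnd a]) (auto simp: C_def)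
  have int_le: "norm (integral {0..cl s} f) \<le> B * T"
    if f: "continuous_on {0..T} f" "\<And>r. r \<in> {0..T} \<Longrightarrow> norm (f r) \<le> B" for f :: "real \<Rightarrow> 'e" and B s
  proof -
    have "0 \<le> B"
      using order_trans[OF norm_ge_zero f(2)[of 0]] \<open>0 \<le> T\<close> by simp
    have "norm (integral {0..cl s} f) \<le> B * (cl s - 0)"
      using f cl(1)[of s] by (intro integral_bound continuous_on_subset[OF f(1)]) auto
    also have "\<dots> \<le> B * T"
      using cl(1)[of s] \<open>0 \<le> B\<close> by (intro mult_left_mono) auto
    finally show ?thesis .
  qed
  have PC: "P u s \<in> cball z R" if u: "u \<in> C" for u :: "real \<Rightarrow>\<^sub>C 'e" and s
  proof -
    have "norm (integral {0..cl s} (\<lambda>r. F (u r) (a r))) \<le> (N * M) * T"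
    proof (intro int_le cont u)
      fix r assume r: "r \<in> {0..T}"
      have "norm (F (u r) (a r)) \<le> N * norm (a r)" using u by (intro bnd) (auto simp: C_def)
      also have "\<dots> \<le> N * M" using M[OF r] \<open>0 \<le> N\<close> by (rule mult_left_mono)
      finally show "norm (F (u r) (a r)) \<le> N * M" .
    qed
    then show ?thesis
      using assms by (simp add: P_def dist_norm)
  qed
  have Pcont: "continuous_on UNIV (P u)" if u: "u \<in> C" for u :: "real \<Rightarrow>\<^sub>C 'e"
  proof -
    have "continuous_on {0..T} (\<lambda>s. integral {0..s} (\<lambda>r. F (u r) (a r)))"
      by (intro indefinite_integral_continuous_1 integrable_continuous_real cont u)
    then have "continuous_on UNIV (\<lambda>s. integral {0..cl s} (\<lambda>r. F (u r) (a r)))"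
      by (rule continuous_on_compose2[OF _ cl(2)]) (use cl(1) in auto)
    then show ?thesis
      unfolding P_def[abs_def] by (intro continuous_intros)
  qed
  have app: "apply_bcontfun (Bcontfun (P u)) = P u" if "u \<in> C" for u :: "real \<Rightarrow>\<^sub>C 'e"
  proof (rule Bcontfun_inverse)
    have "range (P u) \<subseteq> cball z R" using PC[OF that] by auto
    then show "P u \<in> bcontfun"
      using Pcont[OF that] bounded_subset[OF bounded_cball] by (auto simp: bcontfun_def)
  qed
  define Q :: "(real \<Rightarrow>\<^sub>C 'e) \<Rightarrow> real \<Rightarrow>\<^sub>C 'e" where "Q u = Bcontfun (P (apply_bcontfun u))" for u
  have app: "apply_bcontfun (Q u) = P u" if "u \<in> C" for u
    using app[OF that] by (simp add: Q_def)
  have "\<exists>!u\<in>C. Q u = u"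
  proof (rule Banach_fix[where c = "1/2"])
    have "C = PiC UNIV (\<lambda>_. cball z R)"
      unfolding C_def by (auto simp: mem_PiC_iff Pi_iff)
    then show "complete C"
      using closed_PiC[of UNIV "\<lambda>_. cball z R"] by (simp add: complete_eq_closed)
    have "const_bcontfun z \<in> C"
      using \<open>0 \<le> R\<close> by (simp add: C_def const_bcontfun.rep_eq)
    then show "C \<noteq> {}" by blast
    show "Q ` C \<subseteq> C"
      using app PC by (auto simp: C_def)
    fix u v assume uv: "u \<in> C" "v \<in> C"
    show "dist (Q u) (Q v) \<le> 1/2 * dist u v"
    proof (rule dist_bound)
      fix s
      have "integral {0..cl s} (\<lambda>r. F (u r) (a r) - F (v r) (a r)) =
          integral {0..cl s} (\<lambda>r. F (u r) (a r)) - integral {0..cl s} (\<lambda>r. F (v r) (a r))"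
        using cl(1)[of s] by (intro Henstock_Kurzweil_Integration.integral_diff integrable_continuous_real continuous_on_subset[OF cont[OF uv(1)]] continuous_on_subset[OF cont[OF uv(2)]]) auto
      moreover have "norm (integral {0..cl s} (\<lambda>r. F (u r) (a r) - F (v r) (a r))) \<le> (K * dist u v * M) * T"
      proof (intro int_le continuous_on_diff cont uv)
        fix r assume r: "r \<in> {0..T}"
        have "norm (F (u r) (a r) - F (v r) (a r)) \<le> K * norm (u r - v r) * norm (a r)"
          using uv by (intro lip) (auto simp: C_def)
        also have "\<dots> \<le> K * dist u v * M"
          using M[OF r] \<open>0 \<le> K\<close> dist_bounded[of u r v] by (intro mult_mono mult_left_mono) (auto simp: dist_norm)
        finally show "norm (F (u r) (a r) - F (v r) (a r)) \<le> K * dist u v * M" .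
      qed
      moreover have "(K * dist u v * M) * T \<le> 1/2 * dist u v"
        using mult_right_mono[OF \<open>K * M * T \<le> 1/2\<close>, of "dist u v"] by (simp add: mult_ac)
      ultimately show "dist (apply_bcontfun (Q u) s) (apply_bcontfun (Q v) s) \<le> 1/2 * dist u v"
        by (simp add: app uv P_def dist_norm)
    qed
  qed auto
  then obtain u where u: "u \<in> C" "Q u = u" by blast
  then have "P u = u"
    using app by metis
  show thesis
  proof
    show "continuous_on {0..T} u" by simp
    show "u ` {0..T} \<subseteq> cball z R" using u(1) by (auto simp: C_def)
    show "u s = z + integral {0..s} (\<lambda>r. F (u r) (a r))" if "s \<in> {0..T}" for s
      using fun_cong[OF \<open>P u = u\<close>, of s] that by (simp add: P_def cl_def)
  qed
qed

context lie_grp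
begin

text \<open>For each fixed \<open>i\<close> the derivative of \<open>left_field u i\<close> in
  \<open>u\<close> is bounded on a compact ball, and convexity gives the mean value inequality.
  Linearity in \<open>Z\<close> then combines the finitely many bounds for \<open>i\<close> in
  \<open>E\<close>.\<close>

lemma left_field_lipschitz:
  obtains R K where "R > 0" "cball origin R \<subseteq> chart_dom" "K \<ge> 0"
    "\<And>x y Z. x \<in> cball origin R \<Longrightarrow> y \<in> cball origin R \<Longrightarrow>
       norm (left_field x Z - left_field y Z) \<le> K * norm (x - y) * norm Z"
proof -
  obtain E :: "'e set" and n where E: "finite E" "\<And>x. x = (\<Sum>i\<in>E. (x \<bullet> n i) *\<^sub>R i)"
    using coordinates by blast
  obtain R where R: "R > 0" "cball origin R \<subseteq> chart_dom"
    using chart_one open_contains_cball by blast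
  have "\<exists>B\<ge>0. \<forall>x\<in>cball origin R. \<forall>y\<in>cball origin R. norm (left_field x i - left_field y i) \<le> B * norm (x - y)" for i
  proof -
    obtain L where L: "\<And>u. u \<in> chart_dom \<Longrightarrow> ((\<lambda>u. left_field u i) has_derivative L u) (at u)"
      "\<And>h. continuous_on chart_dom (\<lambda>u. L u h)"
      using left_field_C1[of i] by blast
    define b where "b u = (\<Sum>j\<in>E. norm (n j) * norm (L u j))" for u
    have "continuous_on (cball origin R) b"
      unfolding b_def by (intro continuous_intros continuous_on_subset[OF L(2) R(2)])
    then have "compact (b ` cball origin R)"
      by (intro compact_continuous_image compact_cball)
    then have "bounded (b ` cball origin R)"
      by (rule compact_imp_bounded)
    then obtain B where B: "\<And>u. u \<in> cball origin R \<Longrightarrow> norm (b u) \<le> B"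
      unfolding bounded_iff by blast
    have onorm: "onorm (L u) \<le> B" if u: "u \<in> cball origin R" for u
    proof (rule onorm_bound)
      show "0 \<le> B"
        using order_trans[OF norm_ge_zero B[OF u]] .
    next
      fix h
      have "linear (L u)"
        using L(1) R(2) u has_derivative_linear by blast
      from linear_bound[OF this E(1) E(2)] have "norm (L u h) \<le> norm h * b u"
        by (simp add: b_def)
      also have "\<dots> \<le> norm h * B"
        using B[OF u] by (intro mult_left_mono) auto
      finally show "norm (L u h) \<le> B * norm h"
        by (simp add: mult.commute)
    qed
    have "norm (left_field x i - left_field y i) \<le> B * norm (x - y)" if "x \<in> cball origin R" "y \<in> cball origin R" for x y
    proof (rule differentiable_bound[of "cball origin R" "\<lambda>u. left_field u i" L])
      show "((\<lambda>u. left_field u i) has_derivative L u) (at u within cball origin R)" if "u \<in> cball origin R" for u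
        using L(1) R(2) that by (blast intro: has_derivative_at_withinI)
    qed (use that onorm in auto)
    moreover have "0 \<le> B"
      using B[of origin] R(1) norm_ge_zero order_trans by fastforce
    ultimately show ?thesis by blast
  qed
  then obtain B where B: "\<And>i. 0 \<le> B i"
    "\<And>i x y. x \<in> cball origin R \<Longrightarrow> y \<in> cball origin R \<Longrightarrow> norm (left_field x i - left_field y i) \<le> B i * norm (x - y)"
    by metis
  define K where "K = (\<Sum>i\<in>E. norm (n i) * B i)"
  have "norm (left_field x Z - left_field y Z) \<le> K * norm (x - y) * norm Z"
    if x: "x \<in> cball origin R" and y: "y \<in> cball origin R" for x y Z
  proof -
    have "linear (\<lambda>Z. left_field x Z - left_field y Z)"
      using x y R(2) by (intro linear_compose_sub linear_left_field) auto
    from linear_bound[OF this E(1) E(2)]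
    have "norm (left_field x Z - left_field y Z) \<le> norm Z * (\<Sum>i\<in>E. norm (n i) * norm (left_field x i - left_field y i))" .
    also have "\<dots> \<le> norm Z * (\<Sum>i\<in>E. norm (n i) * (B i * norm (x - y)))"
      using B(2)[OF x y] by (intro mult_left_mono sum_mono) auto
    also have "\<dots> = K * norm (x - y) * norm Z"
      by (simp add: K_def sum_distrib_left sum_distrib_right mult_ac)
    finally show ?thesis .
  qed
  moreover have "K \<ge> 0"
    unfolding K_def using B(1) by (intro sum_nonneg) auto
  ultimately show ?thesis
    using that R by blast
qed

text \<open>The bounds involve only products of \<open>M\<close> and \<open>T\<close>: for existence
  the interval is shortened, for dependence on parameters \<open>T = 1\<close> and \<open>M\<close>
  tends to 0. The final estimate is quadratic in \<open>M\<close>, one factor coming from the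
  distance of \<open>x\<close> to \<open>origin\<close> and one from the size of \<open>a\<close>;
  this makes first-order expansions possible.\<close>

lemma local_solution:
  obtains R K N :: real where "R > 0" "K \<ge> 0" "N \<ge> 0"
    "\<And>T a M. 0 \<le> T \<Longrightarrow> continuous_on {0..T} a \<Longrightarrow> (\<And>s. s \<in> {0..T} \<Longrightarrow> norm (a s) \<le> M) \<Longrightarrow> 0 \<le> M \<Longrightarrow>
      N * M * T \<le> R \<Longrightarrow> K * M * T \<le> 1/2 \<Longrightarrow>
      \<exists>x. x 0 = origin \<and> (\<forall>s\<in>{0..T}. x s \<in> chart_dom \<and> LD (\<lambda>s. par \<one> (x s)) (a s) s {0..T} \<and>
         norm (x s - origin - integral {0..s} a) \<le> K * (N * M * T) * M * T)"
proof -
  obtain R K where R: "R > 0" "cball origin R \<subseteq> chart_dom" "K \<ge> 0"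
    and lip: "\<And>x y Z. x \<in> cball origin R \<Longrightarrow> y \<in> cball origin R \<Longrightarrow>
       norm (left_field x Z - left_field y Z) \<le> K * norm (x - y) * norm Z"
    using left_field_lipschitz by blast
  \<comment> \<open>\<open>left_field origin\<close> is the identity, and the Lipschitz bound adds
    at most \<open>K * R\<close> on the ball.\<close>
  define N where "N = 1 + K * R"
  have N: "N \<ge> 0" using R by (simp add: N_def)
  have lin: "linear (left_field x)" if "x \<in> cball origin R" for x
    using that R(2) by (intro linear_left_field) auto
  have bnd: "norm (left_field x Z) \<le> N * norm Z" if x: "x \<in> cball origin R" for x Z
  proof -
    have "norm (left_field x Z) \<le> norm Z + norm (left_field x Z - left_field origin Z)"
      using norm_triangle_sub[of "left_field x Z" Z] by (simp add: left_field_origin)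
    also have "\<dots> \<le> norm Z + K * R * norm Z"
      using x R lip[OF x, of origin Z]
      by (intro add_left_mono order_trans[OF lip[OF x, of origin Z]] mult_right_mono mult_left_mono) (auto simp: dist_norm norm_minus_commute)
    finally show ?thesis by (simp add: N_def algebra_simps)
  qed
  have "\<exists>x. x 0 = origin \<and> (\<forall>s\<in>{0..T}. x s \<in> chart_dom \<and> LD (\<lambda>s. par \<one> (x s)) (a s) s {0..T} \<and>
         norm (x s - origin - integral {0..s} a) \<le> K * (N * M * T) * M * T)"
    if T: "0 \<le> T" and a: "continuous_on {0..T} a" and M: "\<And>s. s \<in> {0..T} \<Longrightarrow> norm (a s) \<le> M" "0 \<le> M"
      and small: "N * M * T \<le> R" "K * M * T \<le> 1/2" for T a M
  proof -
    obtain x where x: "continuous_on {0..T} x" "x ` {0..T} \<subseteq> cball origin R"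
      "\<And>s. s \<in> {0..T} \<Longrightarrow> x s = origin + integral {0..s} (\<lambda>r. left_field (x r) (a r))"
    proof (rule picard[where F = left_field and z = origin and R = R and K = K and N = N, OF lip lin bnd a M(1)])
      show "0 \<le> R" "0 \<le> K" "0 \<le> N" "0 \<le> M" "0 \<le> T" "N * M * T \<le> R" "K * M * T \<le> 1/2"
        using R N M(2) T small by auto
    qed auto
    let ?f = "\<lambda>r. left_field (x r) (a r)"
    have f: "continuous_on {0..T} ?f"
      by (rule continuous_on_lipschitz_field[where D = "cball origin R", OF lip lin bnd a x(1,2)])
    have xd: "x s \<in> chart_dom" if "s \<in> {0..T}" for s
      using subset_trans[OF x(2) R(2)] that by blast
    have "LD (\<lambda>s. par \<one> (x s)) (a s) s {0..T}" if s: "s \<in> {0..T}" for s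
    proof (rule LD_chart)
      show "par \<one> (x s) \<in> cdom \<one>"
        using xd[OF s] by (rule par_one)
      have "(x \<longlongrightarrow> x s) (at s within {0..T})"
        using x(1) s by (auto simp: continuous_on_def)
      then show "limitin (gtop G) (\<lambda>s. par \<one> (x s)) (par \<one> (x s)) (at s within {0..T})"
        using limitin_par_curve[OF chart_one(1) par_one(2)[OF xd[OF s]]] par_one(3)[OF xd[OF s]] by simp
      have "((\<lambda>s. origin + integral {0..s} ?f) has_vector_derivative ?f s) (at s within {0..T})"
        using integral_has_vector_derivative[OF f s] by (auto intro!: derivative_eq_intros)
      then have "((\<lambda>s. coord \<one> (par \<one> (x s))) has_vector_derivative ?f s) (at s within {0..T})"
        by (rule has_vector_derivative_transform[OF s, rotated]) (rule trans[OF par_one(3)[OF xd] x(3)])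
      then show "((\<lambda>s. coord \<one> (par \<one> (x s))) has_vector_derivative left_field (coord \<one> (par \<one> (x s))) (a s)) (at s within {0..T})"
        using par_one(3)[OF xd[OF s]] by simp
    qed fact
    moreover have "norm (x s - origin - integral {0..s} a) \<le> K * (N * M * T) * M * T" if s: "s \<in> {0..T}" for s
    proof -
      have int: "?f integrable_on {0..s}" "a integrable_on {0..s}"
        using s by (auto intro!: integrable_continuous_real continuous_on_subset[OF f] continuous_on_subset[OF a])
      have xr: "norm (x r - origin) \<le> N * M * T" if r: "r \<in> {0..T}" for r
      proof -
        have "norm (integral {0..r} ?f) \<le> (N * M) * (r - 0)"
        proof (rule integral_bound)
          fix t assume t: "t \<in> {0..r}"
          have "norm (?f t) \<le> N * norm (a t)"
            using x(2) t r by (intro bnd) (auto simp: image_subset_iff)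
          also have "\<dots> \<le> N * M"
            using M(1)[of t] t r N by (intro mult_left_mono) auto
          finally show "norm (?f t) \<le> N * M" .
        qed (use r in \<open>auto intro: continuous_on_subset[OF f]\<close>)
        also have "\<dots> \<le> N * M * T"
          using r N M(2) by (intro mult_left_mono) auto
        finally show ?thesis
          using x(3)[OF r] by simp
      qed
      have "x s - origin - integral {0..s} a = integral {0..s} (\<lambda>r. ?f r - a r)"
        using x(3)[OF s] int by (simp add: Henstock_Kurzweil_Integration.integral_diff)
      also have "norm \<dots> \<le> (K * (N * M * T) * M) * (s - 0)"
      proof (rule integral_bound)
        show "continuous_on {0..s} (\<lambda>r. ?f r - a r)"
          using s by (auto intro!: continuous_intros continuous_on_subset[OF f] continuous_on_subset[OF a])
        fix r assume "r \<in> {0..s}"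
        then have r: "r \<in> {0..T}" using s by auto
        have "norm (?f r - a r) \<le> K * norm (x r - origin) * norm (a r)"
          using lip[of "x r" origin "a r"] x(2) r R(1) by (auto simp: left_field_origin image_subset_iff)
        also have "\<dots> \<le> K * (N * M * T) * M"
          using xr[OF r] M(1)[OF r] R(3) N M(2) T by (intro mult_mono mult_left_mono) auto
        finally show "norm (?f r - a r) \<le> K * (N * M * T) * M" .
      qed (use s in auto)
      also have "\<dots> \<le> K * (N * M * T) * M * T"
        using s R(3) N M(2) T by (intro mult_left_mono) auto
      finally show ?thesis .
    qed
    moreover have "x 0 = origin"
      using x(3)[of 0] T by simp
    ultimately show ?thesis
      using xd by blast
  qed
  then show thesis
    using that R N by blast
qed

section \<open>Continuation of solutions to the whole line\<close>

lemma LD_localize: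
  assumes "LD c X t S" "open U" "t \<in> U" "S \<inter> U = T \<inter> U"
  shows "LD c X t T"
proof -
  have "at t within S = at t within T"
    using at_within_nhd[of t U S T] assms by auto
  then show ?thesis
    using assms by (auto simp: LD_def has_velocity_def)
qed

text \<open>One step length serves for every step: by left invariance each new piece may start again
  at the identity, with a shifted right-hand side that obeys the same bound
  \<open>M\<close>.\<close>

lemma finite_interval_solution:
  assumes a: "continuous_on UNIV a" and M: "\<And>s. norm (a s) \<le> M"
  obtains \<delta> where "\<delta> > 0"
    "\<And>n :: nat. \<exists>c. c \<alpha> = \<one> \<and> (\<forall>s\<in>{\<alpha>..\<alpha> + real (Suc n) * \<delta>}. LD c (a s) s {\<alpha>..\<alpha> + real (Suc n) * \<delta>})"
proof -
  have M0: "0 \<le> M" using M[of 0] norm_ge_zero order_trans by blast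
  obtain R K N :: real where RKN: "R > 0" "K \<ge> 0" "N \<ge> 0"
    and sol: "\<And>T a M. 0 \<le> T \<Longrightarrow> continuous_on {0..T} a \<Longrightarrow> (\<And>s. s \<in> {0..T} \<Longrightarrow> norm (a s) \<le> M) \<Longrightarrow> 0 \<le> M \<Longrightarrow>
      N * M * T \<le> R \<Longrightarrow> K * M * T \<le> 1/2 \<Longrightarrow>
      \<exists>x. x 0 = origin \<and> (\<forall>s\<in>{0..T}. x s \<in> chart_dom \<and> LD (\<lambda>s. par \<one> (x s)) (a s) s {0..T} \<and>
         norm (x s - origin - integral {0..s} a) \<le> K * (N * M * T) * M * T)"
    using local_solution by blast
  \<comment> \<open>Chosen to give \<open>N * M * \<delta> \<le> R\<close> and
    \<open>K * M * \<delta> \<le> 1/2\<close>; the added 1 keeps the denominators positive.\<close>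
  define \<delta> where "\<delta> = min (R / (N * M + 1)) (1 / (2 * (K * M + 1)))"
  have NM: "0 \<le> N * M" "0 \<le> K * M" using RKN M0 by auto
  then have \<delta>: "\<delta> > 0" using RKN by (simp add: \<delta>_def)
  have "N * M * \<delta> \<le> (N * M + 1) * (R / (N * M + 1))"
    using NM \<delta> by (intro mult_mono) (auto simp: \<delta>_def)
  then have \<delta>1: "N * M * \<delta> \<le> R" using NM by simp
  have "K * M * \<delta> \<le> (K * M + 1) * (1 / (2 * (K * M + 1)))"
    using NM \<delta> by (intro mult_mono) (auto simp: \<delta>_def)
  also have "\<dots> = 1/2" using NM by (simp add: field_simps)
  finally have \<delta>2: "K * M * \<delta> \<le> 1/2" .
  have step: "\<exists>c. c 0 = \<one> \<and> (\<forall>s\<in>{0..\<delta>}. LD c (a (s + \<beta>)) s {0..\<delta>})" for \<beta>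
  proof -
    have "continuous_on {0..\<delta>} (\<lambda>s. a (s + \<beta>))"
      by (intro continuous_on_compose2[OF a] continuous_intros) auto
    with sol[of \<delta> "\<lambda>s. a (s + \<beta>)" M] obtain x where
      "x 0 = origin" "\<forall>s\<in>{0..\<delta>}. LD (\<lambda>s. par \<one> (x s)) (a (s + \<beta>)) s {0..\<delta>}"
      using M M0 \<delta> \<delta>1 \<delta>2 by fastforce
    then show ?thesis
      by (intro exI[of _ "\<lambda>s. par \<one> (x s)"]) (simp add: par_one)
  qed
  have shift: "LD (\<lambda>s. d (s - \<beta>)) (a s) s {\<beta>..\<beta> + \<delta>}"
    if d: "\<forall>s\<in>{0..\<delta>}. LD d (a (s + \<beta>)) s {0..\<delta>}" and s: "s \<in> {\<beta>..\<beta> + \<delta>}" for d \<beta> s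
    using LD_affine[of d "a s" 1 s "- \<beta>" "{0..\<delta>}" "{\<beta>..\<beta> + \<delta>}"] bspec[OF d, of "s - \<beta>"] s by auto
  have "\<exists>c. c \<alpha> = \<one> \<and> (\<forall>s\<in>{\<alpha>..\<alpha> + real (Suc n) * \<delta>}. LD c (a s) s {\<alpha>..\<alpha> + real (Suc n) * \<delta>})" for n
  proof (induction n)
    case 0
    obtain d where "d 0 = \<one>" "\<forall>s\<in>{0..\<delta>}. LD d (a (s + \<alpha>)) s {0..\<delta>}"
      using step by blast
    then show ?case
      using shift[of d \<alpha>] by (intro exI[of _ "\<lambda>s. d (s - \<alpha>)"]) auto
  next
    case (Suc n)
    define \<beta> where "\<beta> = \<alpha> + real (Suc n) * \<delta>"
    have \<beta>: "\<alpha> < \<beta>" "\<alpha> + real (Suc (Suc n)) * \<delta> = \<beta> + \<delta>"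
      using \<delta> by (auto simp: \<beta>_def algebra_simps intro: add_pos_nonneg)
    obtain c where c: "c \<alpha> = \<one>" "\<And>s. s \<in> {\<alpha>..\<beta>} \<Longrightarrow> LD c (a s) s {\<alpha>..\<beta>}"
      using Suc unfolding \<beta>_def by blast
    obtain d where d: "d 0 = \<one>" "\<forall>s\<in>{0..\<delta>}. LD d (a (s + \<beta>)) s {0..\<delta>}"
      using step by blast
    have p: "c \<beta> \<in> carrier G"
      using LD_carrier[OF c(2)[of \<beta>]] \<beta>(1) by simp
    \<comment> \<open>The new piece starts at the identity, and left translation by
      \<open>c \<beta>\<close> attaches it without changing its logarithmic derivative.\<close>
    define e where "e s = (if s \<le> \<beta> then c s else c \<beta> \<otimes> d (s - \<beta>))" for s
    have 1: "LD e (a s) s {\<alpha>..\<beta>}" if "s \<in> {\<alpha>..\<beta>}" for s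
      using c(2)[OF that] by (rule LD_cong) (simp add: e_def)
    have 2: "LD e (a s) s {\<beta>..\<beta> + \<delta>}" if "s \<in> {\<beta>..\<beta> + \<delta>}" for s
      using LD_left_translate[OF shift[OF d(2) that] p] by (rule LD_cong) (auto simp: e_def d(1) p)
    have "LD e (a s) s {\<alpha>..\<beta> + \<delta>}" if s: "s \<in> {\<alpha>..\<beta> + \<delta>}" for s
    proof -
      consider "s < \<beta>" | "s = \<beta>" | "s > \<beta>" by linarith
      then show ?thesis
      proof cases
        case 1
        show ?thesis
          by (rule LD_localize[OF \<open>\<And>s. s \<in> {\<alpha>..\<beta>} \<Longrightarrow> LD e (a s) s {\<alpha>..\<beta>}\<close>, of _ "{..<\<beta>}"]) (use 1 s \<delta> in auto)
      next
        case 2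
        have "{\<alpha>..\<beta>} \<union> {\<beta>..\<beta> + \<delta>} = {\<alpha>..\<beta> + \<delta>}"
          using \<beta>(1) \<delta> by auto
        then show ?thesis
          using LD_Un[OF 1[of s] \<open>\<And>s. s \<in> {\<beta>..\<beta> + \<delta>} \<Longrightarrow> LD e (a s) s {\<beta>..\<beta> + \<delta>}\<close>[of s]] 2 \<beta>(1) \<delta> by simp
      next
        case 3
        show ?thesis
          by (rule LD_localize[OF 2, of _ "{\<beta><..}"]) (use 3 s \<beta> in auto)
      qed
    qed
    moreover have "e \<alpha> = \<one>"
      using \<beta>(1) c(1) by (simp add: e_def)
    ultimately show ?case
      unfolding \<beta>(2) by blast
  qed
  then show thesis
    using that \<delta> by blast
qed

text \<open>Solutions started at the left ends of growing intervals are translated so as to be the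
  identity at 0; by uniqueness they then agree on common domains. The whole line is required by the
  definition of \<open>lie_exp\<close>.\<close>

lemma global_solution:
  assumes a: "continuous_on UNIV a" and M: "\<And>s. norm (a s) \<le> M"
  obtains c where "c 0 = \<one>" "\<And>s. LD c (a s) s UNIV"
proof -
  have "\<exists>c. c 0 = \<one> \<and> (\<forall>s\<in>{- real n..real n}. LD c (a s) s {- real n..real n})" if "n \<ge> 1" for n
  proof -
    obtain \<delta> where \<delta>: "\<delta> > 0" "\<And>k :: nat. \<exists>c. c (- real n) = \<one> \<and>
      (\<forall>s\<in>{- real n..- real n + real (Suc k) * \<delta>}. LD c (a s) s {- real n..- real n + real (Suc k) * \<delta>})"
      using finite_interval_solution[OF a M, of "- real n"] by blast
    obtain k :: nat where "real k * \<delta> > 2 * real n"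
      using \<delta>(1) ex_less_of_nat_mult by blast
    then have k: "- real n + real (Suc k) * \<delta> \<ge> real n"
      using \<delta>(1) by (simp add: algebra_simps)
    obtain c where c: "\<And>s. s \<in> {- real n..- real n + real (Suc k) * \<delta>} \<Longrightarrow> LD c (a s) s {- real n..- real n + real (Suc k) * \<delta>}"
      using \<delta>(2) by blast
    have c': "LD c (a s) s {- real n..real n}" if "s \<in> {- real n..real n}" for s
      using that k by (intro LD_subset[OF c]) auto
    have p: "c 0 \<in> carrier G"
      using LD_carrier[OF c'[of 0]] by simp
    then have "\<forall>s\<in>{- real n..real n}. LD (\<lambda>s. inv (c 0) \<otimes> c s) (a s) s {- real n..real n}"
      using LD_left_translate[OF c'] by simp
    then show ?thesis
      using p by (intro exI[of _ "\<lambda>s. inv (c 0) \<otimes> c s"]) simp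
  qed
  then obtain cs where cs: "\<And>n. n \<ge> 1 \<Longrightarrow> cs n 0 = \<one>"
    "\<And>n s. n \<ge> 1 \<Longrightarrow> s \<in> {- real n..real n} \<Longrightarrow> LD (cs n) (a s) s {- real n..real n}"
    by metis
  have mono: "cs m s = cs n s" if "1 \<le> m" "m \<le> n" "s \<in> {- real m..real m}" for m n s
  proof (rule LD_eq[where S = "{- real m..real m}" and a = a and ?s0.0 = 0])
    show "LD (cs m) (a s) s {- real m..real m}" if "s \<in> {- real m..real m}" for s
      using cs(2) that \<open>1 \<le> m\<close> by blast
    show "LD (cs n) (a s) s {- real m..real m}" if "s \<in> {- real m..real m}" for s
      using that \<open>1 \<le> m\<close> \<open>m \<le> n\<close> by (intro LD_subset[OF cs(2)[of n s]]) auto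
  qed (use that cs(1) in auto)
  \<comment> \<open>The added 1 keeps the index in the range \<open>n \<ge> 1\<close> where
    \<open>cs n\<close> is specified.\<close>
  define c where "c s = cs (nat \<lceil>\<bar>s\<bar>\<rceil> + 1) s" for s
  have c_eq: "c s = cs n s" if "n \<ge> 1" "s \<in> {- real n..real n}" for n s
  proof -
    let ?k = "nat \<lceil>\<bar>s\<bar>\<rceil> + 1"
    have k: "s \<in> {- real ?k..real ?k}"
    proof -
      have "\<bar>s\<bar> \<le> real ?k"
        using real_nat_ceiling_ge[of "\<bar>s\<bar>"] unfolding of_nat_add by linarith
      then show ?thesis
        unfolding atLeastAtMost_iff by linarith
    qed
    have "1 \<le> ?k" by simp
    show ?thesis
      unfolding c_def
    proof (cases "?k \<le> n")
      case True
      show "cs ?k s = cs n s" by (rule mono[OF \<open>1 \<le> ?k\<close> True k])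
    next
      case False
      then show "cs ?k s = cs n s"
        by (intro mono[OF that(1) _ that(2), symmetric]) (rule less_imp_le, rule not_le_imp_less)
    qed
  qed
  show thesis
  proof
    show "c 0 = \<one>" using cs(1)[of 1] by (simp add: c_def)
    fix s
    obtain n :: nat where n: "\<bar>s\<bar> < real n" using reals_Archimedean2 by blast
    then have n1: "n \<ge> 1" by (cases n) auto
    have "LD (cs n) (a s) s UNIV"
      by (rule LD_localize[OF cs(2)[of n s], of "{- real n<..<real n}"]) (use n in auto)
    then show "LD c (a s) s UNIV"
    proof (rule LD_cong_eventually)
      have "\<forall>\<^sub>F r in at s. r \<in> {- real n<..<real n}"
        using n by (intro eventually_at_in_open') auto
      then show "\<forall>\<^sub>F r in at s. cs n r = c r"
        by eventually_elim (use c_eq[of n] n1 in auto)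
      show "cs n s = c s"
        by (rule c_eq[OF n1, symmetric]) (use n in auto)
    qed
  qed
qed


section \<open>The adjoint action along curves\<close>

text \<open>Puts the dependence on \<open>g\<close> into finitely many vectors
  \<open>Ad G g i\<close>, so that \<open>Ad_LD\<close>, which treats constant vectors, suffices for
  moving ones.\<close>

lemma Ad_coordinates:
  assumes E: "finite E" "\<And>x :: 'e. x = (\<Sum>i\<in>E. (x \<bullet> n i) *\<^sub>R i)" and g: "g \<in> carrier G"
  shows "Ad G g v = (\<Sum>i\<in>E. (v \<bullet> n i) *\<^sub>R Ad G g i)"
proof -
  have "Ad G g v = Ad G g (\<Sum>i\<in>E. (v \<bullet> n i) *\<^sub>R i)"
    by (rule arg_cong[OF E(2)])
  also have "\<dots> = (\<Sum>i\<in>E. (v \<bullet> n i) *\<^sub>R Ad G g i)"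
    by (simp add: linear_sum[OF linear_Ad[OF g]] linear_scale[OF linear_Ad[OF g]])
  finally show ?thesis .
qed

lemma Ad_curve_derivative:
  assumes c: "LD c X t S" and v: "(v has_vector_derivative v') (at t within S)"
  shows "((\<lambda>r. Ad G (c r) (v r)) has_vector_derivative Ad G (c t) (lie_bracket G X (v t) + v')) (at t within S)"
proof -
  obtain E :: "'e set" and n where E: "finite E" "\<And>x. x = (\<Sum>i\<in>E. (x \<bullet> n i) *\<^sub>R i)"
    using coordinates by blast
  have t: "t \<in> S" and p: "c t \<in> carrier G"
    using c by (auto simp: LD_iff)
  have "((\<lambda>r. (v r \<bullet> n i) *\<^sub>R Ad G (c r) i) has_vector_derivative
      (v t \<bullet> n i) *\<^sub>R Ad G (c t) (lie_bracket G X i) + (v' \<bullet> n i) *\<^sub>R Ad G (c t) i) (at t within S)" for i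
  proof -
    have "((\<lambda>r. v r \<bullet> n i) has_vector_derivative v' \<bullet> n i) (at t within S)"
      by (rule bounded_linear.has_vector_derivative[OF bounded_linear_inner_left v])
    then have "((\<lambda>r. v r \<bullet> n i) has_field_derivative v' \<bullet> n i) (at t within S)"
      by (simp add: has_real_derivative_iff_has_vector_derivative)
    from has_vector_derivative_scaleR[OF this Ad_LD[OF c]] show ?thesis .
  qed
  then have "((\<lambda>r. \<Sum>i\<in>E. (v r \<bullet> n i) *\<^sub>R Ad G (c r) i) has_vector_derivative
      (\<Sum>i\<in>E. (v t \<bullet> n i) *\<^sub>R Ad G (c t) (lie_bracket G X i) + (v' \<bullet> n i) *\<^sub>R Ad G (c t) i)) (at t within S)"
    by (intro has_vector_derivative_sum)
  also have "(\<Sum>i\<in>E. (v t \<bullet> n i) *\<^sub>R Ad G (c t) (lie_bracket G X i) + (v' \<bullet> n i) *\<^sub>R Ad G (c t) i)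
      = Ad G (c t) (lie_bracket G X (v t) + v')"
  proof -
    have l: "linear (\<lambda>Y. Ad G (c t) (lie_bracket G X Y))"
      using linear_compose[OF _ linear_Ad[OF p], of "lie_bracket G X"] bilinear_lie_bracket
      by (simp add: bilinear_def o_def)
    have "Ad G (c t) (lie_bracket G X (v t)) = Ad G (c t) (lie_bracket G X (\<Sum>i\<in>E. (v t \<bullet> n i) *\<^sub>R i))"
      by (rule arg_cong[OF E(2)])
    also have "\<dots> = (\<Sum>i\<in>E. (v t \<bullet> n i) *\<^sub>R Ad G (c t) (lie_bracket G X i))"
      by (simp add: linear_sum[OF l] linear_scale[OF l])
    finally show ?thesis
      by (simp add: Ad_add[OF p] sum.distrib Ad_coordinates[OF E p, of v'])
  qed
  finally show ?thesis
  proof (rule has_vector_derivative_cong_eventually)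
    obtain w where "vel c w t S" using c unfolding LD_def by blast
    from vel_ev_carrier[OF this]
    show "\<forall>\<^sub>F r in at t within S. (\<Sum>i\<in>E. (v r \<bullet> n i) *\<^sub>R Ad G (c r) i) = Ad G (c r) (v r)"
      by eventually_elim (rule Ad_coordinates[OF E, symmetric])
    show "(\<Sum>i\<in>E. (v t \<bullet> n i) *\<^sub>R Ad G (c t) i) = Ad G (c t) (v t)"
      by (rule Ad_coordinates[OF E p, symmetric])
  qed fact
qed

lemma continuous_on_Ad:
  assumes c: "\<And>s. s \<in> S \<Longrightarrow> LD c (X s) s S" and v: "continuous_on S v"
  shows "continuous_on S (\<lambda>s. Ad G (c s) (v s))"
proof -
  obtain E :: "'e set" and n where E: "finite E" "\<And>x. x = (\<Sum>i\<in>E. (x \<bullet> n i) *\<^sub>R i)"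
    using coordinates by blast
  have "continuous_on S (\<lambda>s. Ad G (c s) i)" for i
    using Ad_LD[OF c] by (intro continuous_on_vector_derivative)
  then have "continuous_on S (\<lambda>s. \<Sum>i\<in>E. (v s \<bullet> n i) *\<^sub>R Ad G (c s) i)"
    using v by (intro continuous_intros)
  moreover have "(\<Sum>i\<in>E. (v s \<bullet> n i) *\<^sub>R Ad G (c s) i) = Ad G (c s) (v s)" if "s \<in> S" for s
    by (rule Ad_coordinates[OF E LD_carrier[OF c[OF that]], symmetric])
  ultimately show ?thesis
    by (rule continuous_on_eq)
qed

lemma Ad_bounded_on_compact:
  assumes c: "\<And>s. s \<in> S \<Longrightarrow> LD c (X s) s S" and S: "compact S"
  obtains C where "C > 0" "\<And>s v. s \<in> S \<Longrightarrow> norm (Ad G (c s) v) \<le> C * norm v"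
proof -
  obtain E :: "'e set" and n where E: "finite E" "\<And>x. x = (\<Sum>i\<in>E. (x \<bullet> n i) *\<^sub>R i)"
    using coordinates by blast
  define k where "k s = (\<Sum>i\<in>E. norm (n i) * norm (Ad G (c s) i))" for s
  have "continuous_on S k"
    unfolding k_def by (intro continuous_intros continuous_on_Ad[OF c]) auto
  then have "bounded (k ` S)"
    by (intro compact_imp_bounded compact_continuous_image S)
  then obtain C where C: "\<And>s. s \<in> S \<Longrightarrow> norm (k s) \<le> C" "C > 0"
    unfolding bounded_pos by blast
  have "norm (Ad G (c s) v) \<le> C * norm v" if s: "s \<in> S" for s v
  proof -
    have "norm (Ad G (c s) v) \<le> norm v * k s"
      unfolding k_def by (rule linear_bound[OF linear_Ad[OF LD_carrier[OF c[OF s]]] E(1) E(2)])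
    also have "\<dots> \<le> norm v * C"
      using C(1)[OF s] by (intro mult_left_mono) auto
    finally show ?thesis by (simp add: mult.commute)
  qed
  then show thesis using that C(2) by blast
qed

section \<open>The exponential map\<close>

lemma flow:
  obtains c where "c 0 = \<one>" "\<And>t. LD c X t UNIV"
  using global_solution[of "\<lambda>_. X" "norm X"] by auto

text \<open>The curve \<open>r \<mapsto> c (t * r)\<close> is an integral curve for
  \<open>t *\<^sub>R X\<close>, and uniqueness identifies it with the one chosen in
  \<open>lie_exp\<close>.\<close>

lemma lie_exp_eq:
  assumes c: "c 0 = \<one>" "\<And>t. LD c X t UNIV"
  shows "lie_exp G (t *\<^sub>R X) = c t"
proof -
  define e where "e = (SOME c. c 0 = \<one> \<and> (\<forall>r. LD c (t *\<^sub>R X) r UNIV))"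
  have c': "LD (\<lambda>r. c (t * r + 0)) (t *\<^sub>R X) r UNIV" for r
    by (rule LD_affine) (use c(2) in auto)
  have "\<exists>c. c 0 = \<one> \<and> (\<forall>r. LD c (t *\<^sub>R X) r UNIV)"
    using c(1) c' by (intro exI[of _ "\<lambda>r. c (t * r + 0)"]) simp
  then have e: "e 0 = \<one>" "\<And>r. LD e (t *\<^sub>R X) r UNIV"
    unfolding e_def using someI_ex[of "\<lambda>c. c 0 = \<one> \<and> (\<forall>r. LD c (t *\<^sub>R X) r UNIV)"] by auto
  have "e 1 = c (t * 1 + 0)"
    by (rule LD_eq[where S = UNIV and a = "\<lambda>_. t *\<^sub>R X" and d = "\<lambda>r. c (t * r + 0)" and ?s0.0 = 0])
      (use e c c' in auto)
  moreover have "lie_exp G (t *\<^sub>R X) = e 1"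
    unfolding lie_exp_def e_def LD_def by simp
  ultimately show ?thesis by simp
qed

lemma lie_exp_zero [simp]: "lie_exp G 0 = \<one>"
proof -
  obtain c where "c 0 = \<one>" "\<And>t. LD c 0 t UNIV" using flow[of 0] by blast
  then show ?thesis using lie_exp_eq[of c 0 0] by simp
qed

lemma LD_lie_exp: "LD (\<lambda>t. lie_exp G (t *\<^sub>R X)) X t UNIV"
proof -
  obtain c where c: "c 0 = \<one>" "\<And>t. LD c X t UNIV" using flow[of X] by blast
  then have "(\<lambda>t. lie_exp G (t *\<^sub>R X)) = c" using lie_exp_eq by blast
  then show ?thesis using c by simp
qed

lemma lie_exp_closed [simp]: "lie_exp G X \<in> carrier G"
  using LD_carrier[OF LD_lie_exp[of X 1]] by simp

lemma LD_lie_exp_within: "t \<in> S \<Longrightarrow> LD (\<lambda>t. lie_exp G (t *\<^sub>R X)) X t S"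
  by (rule LD_subset[OF LD_lie_exp]) auto

text \<open>One-parameter groups are commutative, so \<open>Ad (exp (tX))\<close> fixes \<open>X\<close>.\<close>
lemma lie_bracket_self: "lie_bracket G X X = 0"
proof -
  obtain c where c: "c 0 = \<one>" "\<And>t. LD c X t UNIV" using flow[of X] by blast
  have carr: "c t \<in> carrier G" for t using LD_carrier[OF c(2)] .
  have add: "c t \<otimes> c s = c (s + t)" for s t
  proof (rule LD_eq[where S = UNIV and a = "\<lambda>_. X" and ?s0.0 = 0 and c = "\<lambda>s. c t \<otimes> c s" and d = "\<lambda>s. c (s + t)"])
    show "LD (\<lambda>s. c t \<otimes> c s) X s UNIV" for s
      using c(2) carr by (rule LD_left_translate)
    show "LD (\<lambda>s. c (s + t)) X s UNIV" for s
      using LD_affine[of c X 1 s t UNIV UNIV] c(2) by simp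
  qed (use c(1) carr in auto)
  have Ad: "Ad G (c t) X = X" for t
  proof -
    have "LD (\<lambda>s. c t \<otimes> c s \<otimes> inv (c t)) (Ad G (inv (inv (c t))) X) 0 UNIV"
      by (intro LD_right_translate LD_left_translate c(2) carr inv_closed)
    moreover have "c t \<otimes> c s \<otimes> inv (c t) = c s" for s
    proof -
      have "c t \<otimes> c s = c s \<otimes> c t"
        unfolding add by (simp add: add.commute)
      then show ?thesis
        using carr by (simp add: m_assoc)
    qed
    ultimately have "LD c (Ad G (c t) X) 0 UNIV"
      using carr by simp
    then show ?thesis
      by (rule LD_unique[OF _ c(2)]) simp
  qed
  have "((\<lambda>r. X) has_vector_derivative lie_bracket G X X) (at 0)"
    using Ad_LD[OF c(2)[of 0], of X] by (simp add: Ad c(1))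
  then show ?thesis
    using vector_derivative_unique_at has_vector_derivative_const by blast
qed

text \<open>Polarisation of \<open>lie_bracket_self\<close>.\<close>

lemma lie_bracket_antisym: "lie_bracket G X Y = - lie_bracket G Y X"
proof -
  have "0 = lie_bracket G (X + Y) (X + Y)" by (simp add: lie_bracket_self)
  also have "\<dots> = lie_bracket G X Y + lie_bracket G Y X"
    unfolding bilinear_ladd[OF bilinear_lie_bracket] bilinear_radd[OF bilinear_lie_bracket] by (simp add: lie_bracket_self)
  finally show ?thesis by (simp add: eq_neg_iff_add_eq_0)
qed

section \<open>Dependence of solutions on parameters\<close>

text \<open>The logarithmic derivative \<open>a \<epsilon>\<close> is
  \<open>\<epsilon> *\<^sub>R a0\<close> up to a uniform o(\<epsilon>). For small \<epsilon> a
  solution on all of \<open>{0..1}\<close> stays in the chart around \<one>, and uniqueness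
  identifies it with \<open>K \<epsilon>\<close>. The quadratic error in
  \<open>local_solution\<close> then leaves \<open>\<epsilon> *\<^sub>R integral {0..s} a0\<close>
  as the first-order term.\<close>

lemma LD_small_solution:
  fixes a :: "real \<Rightarrow> real \<Rightarrow> 'e"
  assumes a0: "continuous_on {0..1} a0" and a: "\<And>\<epsilon>. continuous_on {0..1} (a \<epsilon>)"
    and small: "\<And>\<eta>. \<eta> > 0 \<Longrightarrow> \<forall>\<^sub>F \<epsilon> in nhds 0. \<forall>r\<in>{0..1}. norm (a \<epsilon> r - \<epsilon> *\<^sub>R a0 r) \<le> \<eta> * \<bar>\<epsilon>\<bar>"
    and K: "\<And>\<epsilon>. K \<epsilon> 0 = \<one>" "\<And>\<epsilon> r. r \<in> {0..1} \<Longrightarrow> LD (K \<epsilon>) (a \<epsilon> r) r {0..1}"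
    and s: "s \<in> {0..1}"
  shows "LD (\<lambda>\<epsilon>. K \<epsilon> s) (integral {0..s} a0) 0 UNIV"
proof -
  let ?I = "integral {0..s} a0"
  let ?x = "\<lambda>\<epsilon>. coord \<one> (K \<epsilon> s)"
  obtain b where b: "b > 0" "\<And>r. r \<in> {0..1} \<Longrightarrow> norm (a0 r) \<le> b"
    using compact_imp_bounded[OF compact_continuous_image[OF a0]] unfolding bounded_pos by auto
  obtain R L N :: real where RLN: "R > 0" "L \<ge> 0" "N \<ge> 0"
    and sol: "\<And>T a M. 0 \<le> T \<Longrightarrow> continuous_on {0..T} a \<Longrightarrow> (\<And>s. s \<in> {0..T} \<Longrightarrow> norm (a s) \<le> M) \<Longrightarrow> 0 \<le> M \<Longrightarrow>
      N * M * T \<le> R \<Longrightarrow> L * M * T \<le> 1/2 \<Longrightarrow>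
      \<exists>x. x 0 = origin \<and> (\<forall>s\<in>{0..T}. x s \<in> chart_dom \<and> LD (\<lambda>s. par \<one> (x s)) (a s) s {0..T} \<and>
         norm (x s - origin - integral {0..s} a) \<le> L * (N * M * T) * M * T)"
    using local_solution by blast
  \<comment> \<open>A bound for \<open>a \<epsilon>\<close>: the part \<open>b\<close> comes from
    \<open>a0\<close>, the 1 from \<open>small\<close> with \<eta> = 1.\<close>
  define M where "M \<epsilon> = (b + 1) * \<bar>\<epsilon>\<bar>" for \<epsilon> :: real
  have tend: "((\<lambda>\<epsilon>. k * M \<epsilon>) \<longlongrightarrow> 0) (nhds 0)" for k
  proof -
    have "continuous_on UNIV (\<lambda>\<epsilon>. k * M \<epsilon>)"
      unfolding M_def by (intro continuous_intros)
    then have "((\<lambda>\<epsilon>. k * M \<epsilon>) \<longlongrightarrow> k * M 0) (nhds 0)"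
      using tendsto_at_iff_tendsto_nhds[of "\<lambda>\<epsilon>. k * M \<epsilon>" 0] by (simp add: continuous_on_def)
    then show ?thesis by (simp add: M_def)
  qed
  \<comment> \<open>The coefficient of the squared parameter in the error term of
    \<open>local_solution\<close>, once \<open>M \<epsilon>\<close> is inserted.\<close>
  define C where "C = L * N * (b + 1) * (b + 1)"
  have C: "C \<ge> 0" using RLN b by (simp add: C_def)
  have ev1: "\<forall>\<^sub>F \<epsilon> in nhds 0. K \<epsilon> s \<in> cdom \<one> \<and> norm (?x \<epsilon> - origin - integral {0..s} (a \<epsilon>)) \<le> C * \<bar>\<epsilon>\<bar> * \<bar>\<epsilon>\<bar>"
    using small[OF zero_less_one] order_tendstoD(2)[OF tend[of N] RLN(1)]
      order_tendstoD(2)[OF tend[of L], of "1/2", simplified]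
  proof eventually_elim
    case (elim \<epsilon>)
      have "norm (a \<epsilon> r) \<le> M \<epsilon>" if r: "r \<in> {0..1}" for r
      proof -
        have "norm (a \<epsilon> r) \<le> norm (\<epsilon> *\<^sub>R a0 r) + norm (a \<epsilon> r - \<epsilon> *\<^sub>R a0 r)"
          by (rule norm_triangle_sub)
        also have "\<dots> \<le> \<bar>\<epsilon>\<bar> * b + 1 * \<bar>\<epsilon>\<bar>"
          using elim(1) r b(2)[OF r] by (intro add_mono) (auto intro: mult_left_mono)
        finally show ?thesis by (simp add: M_def algebra_simps)
      qed
      then obtain x where x: "x 0 = origin" "\<And>r. r \<in> {0..1} \<Longrightarrow> x r \<in> chart_dom"
        "\<And>r. r \<in> {0..1} \<Longrightarrow> LD (\<lambda>r. par \<one> (x r)) (a \<epsilon> r) r {0..1}"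
        "\<And>r. r \<in> {0..1} \<Longrightarrow> norm (x r - origin - integral {0..r} (a \<epsilon>)) \<le> L * (N * M \<epsilon> * 1) * M \<epsilon> * 1"
        using sol[of 1 "a \<epsilon>" "M \<epsilon>"] a elim b(1) by (auto simp: M_def)
      have "K \<epsilon> s = par \<one> (x s)"
        by (rule LD_eq[where S = "{0..1}" and a = "a \<epsilon>" and ?s0.0 = 0]) (use x K s in \<open>auto simp: par_one\<close>)
      moreover have "coord \<one> (par \<one> (x s)) = x s" "par \<one> (x s) \<in> cdom \<one>"
        using par_one x(2)[OF s] by auto
      moreover have "L * (N * M \<epsilon> * 1) * M \<epsilon> * 1 = C * \<bar>\<epsilon>\<bar> * \<bar>\<epsilon>\<bar>"
        by (simp add: C_def M_def)
      ultimately show ?case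
        using x(4)[OF s] by simp
  qed
  have ev2: "\<forall>\<^sub>F \<epsilon> in nhds 0. norm (integral {0..s} (a \<epsilon>) - \<epsilon> *\<^sub>R ?I) \<le> \<eta> * \<bar>\<epsilon>\<bar>" if "\<eta> > 0" for \<eta>
    using small[OF that]
  proof eventually_elim
    case (elim \<epsilon>)
    have sub: "continuous_on {0..s} (a \<epsilon>)" "continuous_on {0..s} a0"
      using s by (auto intro: continuous_on_subset[OF a] continuous_on_subset[OF a0])
    have "integral {0..s} (a \<epsilon>) - \<epsilon> *\<^sub>R ?I = integral {0..s} (\<lambda>r. a \<epsilon> r - \<epsilon> *\<^sub>R a0 r)"
      using sub by (subst Henstock_Kurzweil_Integration.integral_diff)
        (auto intro!: integrable_continuous_real continuous_intros)
    also have "norm \<dots> \<le> (\<eta> * \<bar>\<epsilon>\<bar>) * (s - 0)"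
      using s elim sub by (intro integral_bound continuous_intros) auto
    also have "\<dots> \<le> \<eta> * \<bar>\<epsilon>\<bar>"
      using s that by (simp add: mult_left_le)
    finally show ?case .
  qed
  have ev3: "\<forall>\<^sub>F \<epsilon> in nhds 0. norm (?x \<epsilon> - origin - \<epsilon> *\<^sub>R ?I) \<le> \<eta> * \<bar>\<epsilon>\<bar>" if \<eta>: "\<eta> > 0" for \<eta>
  proof -
    have "((\<lambda>\<epsilon>. C * \<bar>\<epsilon>\<bar>) \<longlongrightarrow> 0) (nhds 0)"
      using tend[of "C / (b + 1)"] b(1) by (simp add: M_def)
    then have "\<forall>\<^sub>F \<epsilon> in nhds 0. C * \<bar>\<epsilon>\<bar> < \<eta> / 2"
      using \<eta> by (intro order_tendstoD) auto
    then show ?thesis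
      using ev1 ev2[OF half_gt_zero[OF \<eta>]]
    proof eventually_elim
      case (elim \<epsilon>)
      have "norm (?x \<epsilon> - origin - \<epsilon> *\<^sub>R ?I) \<le> norm (?x \<epsilon> - origin - integral {0..s} (a \<epsilon>)) + norm (integral {0..s} (a \<epsilon>) - \<epsilon> *\<^sub>R ?I)"
        using norm_triangle_ineq[of "?x \<epsilon> - origin - integral {0..s} (a \<epsilon>)" "integral {0..s} (a \<epsilon>) - \<epsilon> *\<^sub>R ?I"] by simp
      also have "\<dots> \<le> \<eta> / 2 * \<bar>\<epsilon>\<bar> + \<eta> / 2 * \<bar>\<epsilon>\<bar>"
        using elim by (intro add_mono order_trans[OF conjunct2[OF elim(2)]] mult_right_mono) auto
      finally show ?case by simp
    qed
  qed
  \<comment> \<open>The estimates hold for the filter \<open>nhds 0\<close>, which includes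
    \<epsilon> = 0; this yields \<open>K 0 s = \<one>\<close>.\<close>
  have x0: "?x 0 = origin"
    using eventually_nhds_x_imp_x[OF ev3[OF zero_less_one]] by simp
  have dom0: "K 0 s \<in> cdom \<one>"
    using eventually_nhds_x_imp_x[OF ev1] by blast
  then have K0: "K 0 s = \<one>"
    using x0 par_coord[OF one_closed] par_one(1) by metis
  have D: "(?x has_vector_derivative ?I) (at 0)"
    unfolding has_vector_derivative_def has_derivative_at_alt
  proof (intro conjI allI impI bounded_linear_scaleR_left)
    fix e :: real assume "e > 0"
    from ev3[OF this] show "\<exists>d>0. \<forall>y. norm (y - 0) < d \<longrightarrow> norm (?x y - ?x 0 - (y - 0) *\<^sub>R ?I) \<le> e * norm (y - 0)"
      unfolding eventually_nhds_metric by (simp add: x0 dist_norm)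
  qed
  then have "(?x \<longlongrightarrow> ?x 0) (at 0)"
    using has_vector_derivative_continuous continuous_at by blast
  then have "limitin (gtop G) (\<lambda>\<epsilon>. par \<one> (?x \<epsilon>)) \<one> (at 0)"
    using limitin_par_curve[OF chart_one(1,2)] by (simp only: x0)
  moreover have "\<forall>\<^sub>F \<epsilon> in at 0. par \<one> (?x \<epsilon>) = K \<epsilon> s"
    using eventually_nhds_conv_at[THEN iffD1, OF ev1, THEN conjunct1] by eventually_elim (simp add: par_coord)
  ultimately have "limitin (gtop G) (\<lambda>\<epsilon>. K \<epsilon> s) \<one> (at 0)"
    by (rule limitin_cong_eventually)
  then have "vel (\<lambda>\<epsilon>. K \<epsilon> s) ?I 0 UNIV"
    using D by (simp add: has_velocity_def K0)
  then show "LD (\<lambda>\<epsilon>. K \<epsilon> s) ?I 0 UNIV"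
    using mc_left_one unfolding LD_def K0 by auto
qed


section \<open>Holonomy and its variation\<close>

definition hol_sol :: "(real \<Rightarrow> 'e) \<Rightarrow> (real \<Rightarrow> 'g) \<Rightarrow> bool" where
  "hol_sol A h \<longleftrightarrow> h 0 = \<one> \<and> (\<forall>s\<in>{0..1}. LD h (- A s) s {0..1})"

lemma hol_sol_LD: "hol_sol A h \<Longrightarrow> s \<in> {0..1} \<Longrightarrow> LD h (- A s) s {0..1}"
  by (simp add: hol_sol_def)

lemma hol_sol_carrier: "hol_sol A h \<Longrightarrow> s \<in> {0..1} \<Longrightarrow> h s \<in> carrier G"
  using LD_carrier[OF hol_sol_LD] .

lemma hol_sol_hol:
  assumes "hol_sol A h"
  shows "hol_sol A (hol G A)"
proof -
  have *: "hol_sol A h \<longleftrightarrow> h 0 = \<one> \<and>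
        (\<forall>s\<in>{0..1}. \<exists>w. vel h w s {0..1} \<and> mc_left G (h s) w = - A s)" for h
    by (auto simp: hol_sol_def LD_def)
  show ?thesis
    unfolding hol_def *[symmetric] by (rule someI[of "hol_sol A"]) fact
qed

text \<open>\<open>hol\<close> is a choice constrained on \<open>{0..1}\<close> only. Uniqueness
  lets any explicit solution evaluate it there.\<close>

lemma hol_eq:
  assumes h: "hol_sol A h" and s: "s \<in> {0..1}"
  shows "hol G A s = h s"
proof (rule LD_eq[where S = "{0..1}" and a = "\<lambda>s. - A s" and ?s0.0 = 0 and c = "hol G A" and d = h])
  show "LD (hol G A) (- A s) s {0..1}" if "s \<in> {0..1}" for s
    using hol_sol_hol[OF h] that by (rule hol_sol_LD)
  show "LD h (- A s) s {0..1}" if "s \<in> {0..1}" for s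
    using h that by (rule hol_sol_LD)
  show "hol G A 0 = h 0"
    using hol_sol_hol[OF h] h by (simp add: hol_sol_def)
qed (use s in auto)

lemma interval_solution:
  fixes a :: "real \<Rightarrow> 'e"
  assumes a: "continuous_on {0..1} a"
  obtains h where "h 0 = \<one>" "\<And>s. s \<in> {0..1} \<Longrightarrow> LD h (a s) s {0..1}"
proof -
  \<comment> \<open>Continuing \<open>a\<close> by its end values makes it continuous and bounded on
    the line, as \<open>global_solution\<close> demands.\<close>
  let ?cl = "\<lambda>s :: real. max 0 (min 1 s)"
  have cl: "?cl s \<in> {0..1}" for s by auto
  have "continuous_on UNIV (\<lambda>s. a (?cl s))"
    by (rule continuous_on_compose2[OF a]) (auto intro!: continuous_intros)
  moreover obtain M where "\<And>s. s \<in> {0..1} \<Longrightarrow> norm (a s) \<le> M"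
    using compact_imp_bounded[OF compact_continuous_image[OF a compact_Icc]] unfolding bounded_iff by blast
  then have "norm (a (?cl s)) \<le> M" for s
    using cl by blast
  ultimately obtain h where h: "h 0 = \<one>" "\<And>s. LD h (a (?cl s)) s UNIV"
    using global_solution by blast
  have "LD h (a s) s {0..1}" if "s \<in> {0..1}" for s
  proof -
    have "?cl s = s" using that by auto
    then show ?thesis
      using LD_subset[OF h(2)[of s] subset_UNIV that] by simp
  qed
  then show thesis using that h(1) by blast
qed

lemma hol_exists:
  assumes A: "continuous_on {0..1} A"
  shows "hol_sol A (hol G A)"
proof -
  obtain h where "h 0 = \<one>" "\<And>s. s \<in> {0..1} \<Longrightarrow> LD h (- A s) s {0..1}"
    using interval_solution[of "\<lambda>s. - A s"] A continuous_on_minus by blast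
  then show ?thesis
    by (intro hol_sol_hol[of A h]) (simp add: hol_sol_def)
qed

text \<open>The curve of holonomies \<open>t \<mapsto> h\<^sub>t\<close> is written as \<open>k\<^sub>t h\<close>, where \<open>k\<^sub>t\<close> is the holonomy of
  \<open>t Ad\<^sub>h B\<close> and stays close to \<open>\<one>\<close> for small \<open>t\<close>.\<close>
lemma hol_variation:
  assumes h: "hol_sol A h" and B: "continuous_on {0..1} (\<lambda>r. Ad G (h r) (B r))" and s: "s \<in> {0..1}"
  shows "LD (\<lambda>t. hol G (affine_line A B t) s) (Ad G (inv (h s)) (- integral {0..s} (\<lambda>r. Ad G (h r) (B r)))) 0 UNIV"
proof -
  let ?C = "\<lambda>r. Ad G (h r) (B r)"
  have "\<exists>k. k 0 = \<one> \<and> (\<forall>r\<in>{0..1}. LD k (t *\<^sub>R - ?C r) r {0..1})" for t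
  proof -
    have "continuous_on {0..1} (\<lambda>r. t *\<^sub>R - ?C r)"
      using B by (intro continuous_intros)
    from interval_solution[OF this] show ?thesis
      by (metis (no_types))
  qed
  then obtain k where k: "\<And>t. k t 0 = \<one>" "\<And>t r. r \<in> {0..1} \<Longrightarrow> LD (k t) (t *\<^sub>R - ?C r) r {0..1}"
    by metis
  have sol: "hol_sol (affine_line A B t) (\<lambda>r. k t r \<otimes> h r)" for t
    unfolding hol_sol_def
  proof (intro conjI ballI)
    show "k t 0 \<otimes> h 0 = \<one>" using k(1) h by (simp add: hol_sol_def)
    fix r :: real assume r: "r \<in> {0..1}"
    note carr = hol_sol_carrier[OF h r]
    have "Ad G (inv (h r)) (t *\<^sub>R - ?C r) + - A r = - affine_line A B t r"
      using carr by (simp add: affine_line_def Ad_scale Ad_minus)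
    then show "LD (\<lambda>r. k t r \<otimes> h r) (- affine_line A B t r) r {0..1}"
      using LD_mult[OF k(2)[OF r] hol_sol_LD[OF h r], of t] by simp
  qed
  have small: "LD (\<lambda>t. k t s) (integral {0..s} (\<lambda>r. - ?C r)) 0 UNIV"
  proof (rule LD_small_solution[where a = "\<lambda>t r. t *\<^sub>R - ?C r"])
    show "continuous_on {0..1} (\<lambda>r. - ?C r)"
      using B by (intro continuous_intros)
    show "continuous_on {0..1} (\<lambda>r. t *\<^sub>R - ?C r)" for t
      using B by (intro continuous_intros)
  qed (use k s in auto)
  have p: "h s \<in> carrier G" by (rule hol_sol_carrier[OF h s])
  have eq: "(\<lambda>t. hol G (affine_line A B t) s) = (\<lambda>t. k t s \<otimes> h s)"
    using hol_eq[OF sol s] by blast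
  show "LD (\<lambda>t. hol G (affine_line A B t) s) (Ad G (inv (h s)) (- integral {0..s} ?C)) 0 UNIV"
    using LD_right_translate[OF small p] unfolding eq by simp
qed

lemma hol_mc_right_eq:
  assumes h: "hol_sol A h" and B: "continuous_on {0..1} (\<lambda>r. Ad G (h r) (B r))" and s: "s \<in> {0..1}"
  shows "hol_mc_right G s A B = - integral {0..s} (\<lambda>r. Ad G (h r) (B r))"
proof -
  have "hol G (affine_line A B 0) s = h s" "hol G A s = h s"
    using hol_eq[OF h s] by (auto simp: affine_line_def)
  then show ?thesis
    using LD_velocity(2)[OF hol_variation[OF h B s]] hol_sol_carrier[OF h s]
    by (simp add: hol_mc_right_def)
qed

text \<open>\<open>\<eta>1\<close> and \<open>\<eta>2\<close> are characterised by derivative and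
  initial value, so that for transformed connections an explicit primitive can be inserted without
  evaluating an integral.\<close>

lemma varpi_eq:
  assumes h: "hol_sol A h"
    and eta: "\<And>s. s \<in> {0..1} \<Longrightarrow> (\<eta>1 has_vector_derivative - Ad G (h s) (B1 s)) (at s within {0..1})" "\<eta>1 0 = 0"
      "\<And>s. s \<in> {0..1} \<Longrightarrow> (\<eta>2 has_vector_derivative - Ad G (h s) (B2 s)) (at s within {0..1})" "\<eta>2 0 = 0"
    and C: "continuous_on {0..1} (\<lambda>r. Ad G (h r) (B1 r))" "continuous_on {0..1} (\<lambda>r. Ad G (h r) (B2 r))"
  shows "varpi G b A B1 B2 = 1/2 * integral {0..1} (\<lambda>s.
    b (\<eta>1 s) (- Ad G (h s) (B2 s)) - b (\<eta>2 s) (- Ad G (h s) (B1 s)))"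
proof -
  have mc: "hol_mc_right G s A B = \<eta> s"
    if s: "s \<in> {0..1}" and C: "continuous_on {0..1} (\<lambda>r. Ad G (h r) (B r))"
      and \<eta>: "\<And>s. s \<in> {0..1} \<Longrightarrow> (\<eta> has_vector_derivative - Ad G (h s) (B s)) (at s within {0..1})" "\<eta> 0 = 0"
    for s B \<eta>
  proof -
    have "((\<lambda>r. - Ad G (h r) (B r)) has_integral \<eta> s - \<eta> 0) {0..s}"
      using s by (intro fundamental_theorem_of_calculus) (auto intro: has_vector_derivative_within_subset[OF \<eta>(1)])
    then show ?thesis
      using hol_mc_right_eq[OF h C s] \<eta>(2) by (simp add: has_integral_iff)
  qed
  have vd: "vector_derivative (\<lambda>r. hol_mc_right G r A B) (at s within {0..1}) = - Ad G (h s) (B s)"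
    if s: "s \<in> {0..1}" and C: "continuous_on {0..1} (\<lambda>r. Ad G (h r) (B r))"
      and \<eta>: "\<And>s. s \<in> {0..1} \<Longrightarrow> (\<eta> has_vector_derivative - Ad G (h s) (B s)) (at s within {0..1})" "\<eta> 0 = 0"
    for s B \<eta>
  proof (rule vector_derivative_within)
    show "at s within {0..1} \<noteq> bot" using s by (simp add: trivial_limit_within islimpt_Icc)
    show "((\<lambda>r. hol_mc_right G r A B) has_vector_derivative - Ad G (h s) (B s)) (at s within {0..1})"
      using mc[OF _ C \<eta>] by (intro has_vector_derivative_transform[OF s _ \<eta>(1)[OF s]])
  qed
  show ?thesis
    unfolding varpi_def form_pair_def
    using mc[OF _ C(1) eta(1,2)] mc[OF _ C(2) eta(3,4)] vd[OF _ C(1) eta(1,2)] vd[OF _ C(2) eta(3,4)]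
    by (auto intro!: Henstock_Kurzweil_Integration.integral_cong)
qed

text \<open>The factor h contributes -Ad(\<gamma>) A and the inverse of \<gamma> contributes
  -Ad(\<gamma>) \<Gamma>, the derivative term of the gauge action. The constant
  \<open>\<gamma> 0\<close> normalises the start to \<one>.\<close>

lemma hol_sol_gauge:
  assumes h: "hol_sol A h" and g: "\<And>s. LD \<gamma> (\<Gamma> s) s UNIV"
  shows "hol_sol (gauge G \<gamma> A) (\<lambda>s. \<gamma> 0 \<otimes> h s \<otimes> inv (\<gamma> s))"
  unfolding hol_sol_def
proof (intro conjI ballI)
  have carr: "\<gamma> s \<in> carrier G" for s using LD_carrier[OF g] .
  show "\<gamma> 0 \<otimes> h 0 \<otimes> inv (\<gamma> 0) = \<one>" using h carr by (simp add: hol_sol_def)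
  fix s :: real assume s: "s \<in> {0..1}"
  have "LD \<gamma> (\<Gamma> s) s {0..1}" using LD_subset[OF g _ s] by simp
  then have "LD (\<lambda>s. \<gamma> 0 \<otimes> h s \<otimes> inv (\<gamma> s)) (Ad G (inv (inv (\<gamma> s))) (- A s) + - Ad G (\<gamma> s) (\<Gamma> s)) s {0..1}"
    by (intro LD_mult LD_left_translate LD_inv hol_sol_LD[OF h s] carr)
  moreover have "Ad G (inv (inv (\<gamma> s))) (- A s) + - Ad G (\<gamma> s) (\<Gamma> s) = - gauge G \<gamma> A s"
    using carr LD_velocity(2)[OF g] by (simp add: gauge_def Ad_minus)
  ultimately show "LD (\<lambda>s. \<gamma> 0 \<otimes> h s \<otimes> inv (\<gamma> s)) (- gauge G \<gamma> A s) s {0..1}"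
    by simp
qed

lemma hol_sol_inv_loop:
  assumes h: "hol_sol A h"
  shows "hol_sol (inv_loop A) (\<lambda>s. inv (h 1) \<otimes> h (1 - s))"
  unfolding hol_sol_def
proof (intro conjI ballI)
  have carr: "h 1 \<in> carrier G" using hol_sol_carrier[OF h] by simp
  then show "inv (h 1) \<otimes> h (1 - 0) = \<one>" by simp
  fix s :: real assume s: "s \<in> {0..1}"
  \<comment> \<open>Reversal of the path is the affine substitution with factor -1; it turns
    \<open>- A (1 - s)\<close> into \<open>A (1 - s)\<close>, which is
    \<open>- inv_loop A s\<close>.\<close>
  have "LD h (- A (- 1 * s + 1)) (- 1 * s + 1) {0..1}"
    using s by (intro hol_sol_LD[OF h]) auto
  from LD_affine[OF this _ s] have "LD (\<lambda>s. h (- 1 * s + 1)) (- 1 *\<^sub>R - A (- 1 * s + 1)) s {0..1}"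
    by auto
  then have "LD (\<lambda>s. h (1 - s)) (- inv_loop A s) s {0..1}"
    by (simp add: inv_loop_def)
  then show "LD (\<lambda>s. inv (h 1) \<otimes> h (1 - s)) (- inv_loop A s) s {0..1}"
    using carr by (intro LD_left_translate) auto
qed

section \<open>Variation of the gauge action\<close>

text \<open>Duhamel's formula for the derivative of the exponential map. The product
  \<open>K \<epsilon> r\<close> of exp(r u(s + \<epsilon>)) and exp(-r u(s)) starts at \<one> for
  \<open>r = 0\<close> and has the small logarithmic derivative \<open>a \<epsilon> r\<close>. So
  \<open>LD_small_solution\<close> applies at \<open>r = 1\<close>, after which the right factor
  exp(u(s)) is put back.\<close>

lemma lie_exp_variation:
  assumes u: "(u has_vector_derivative y) (at s)"
  shows "LD (\<lambda>r. lie_exp G (u r))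
    (Ad G (inv (lie_exp G (u s))) (integral {0..1} (\<lambda>r. Ad G (lie_exp G (r *\<^sub>R u s)) y))) s UNIV"
proof -
  let ?X = "u s"
  let ?e = "\<lambda>r. lie_exp G (r *\<^sub>R ?X)"
  define a where "a \<epsilon> r = Ad G (?e r) (u (\<epsilon> + s) - u s)" for \<epsilon> r
  define K where "K \<epsilon> r = lie_exp G (r *\<^sub>R u (\<epsilon> + s)) \<otimes> inv (?e r)" for \<epsilon> r
  \<comment> \<open>\<open>LD_small_solution\<close> requires an error uniform in \<open>r\<close>;
    \<open>C\<close> transfers the linearisation error of \<open>u\<close> through all
    \<open>Ad G (?e r)\<close> at once.\<close>
  obtain C where C: "C > 0" "\<And>r v. r \<in> {0..1} \<Longrightarrow> norm (Ad G (?e r) v) \<le> C * norm v"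
    using Ad_bounded_on_compact[of "{0..1}" ?e "\<lambda>_. ?X"] LD_lie_exp_within by (metis compact_Icc)
  have cont: "continuous_on {0..1} (\<lambda>r. Ad G (?e r) v)" for v
    by (intro continuous_on_Ad[where X = "\<lambda>_. ?X"] LD_lie_exp_within continuous_on_const)
  have "LD (\<lambda>\<epsilon>. K \<epsilon> 1) (integral {0..1} (\<lambda>r. Ad G (?e r) y)) 0 UNIV"
  proof (rule LD_small_solution[where a = a])
    show "continuous_on {0..1} (\<lambda>r. Ad G (?e r) y)" "continuous_on {0..1} (a \<epsilon>)" for \<epsilon>
      unfolding a_def by (rule cont)+
    show "K \<epsilon> 0 = \<one>" for \<epsilon> by (simp add: K_def)
    show "LD (K \<epsilon>) (a \<epsilon> r) r {0..1}" if r: "r \<in> {0..1}" for \<epsilon> r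
      using LD_mult[OF LD_lie_exp_within[OF r, of "u (\<epsilon> + s)"] LD_inv[OF LD_lie_exp_within[OF r, of ?X]]]
      by (simp add: K_def[abs_def] a_def Ad_diff)
    show "\<forall>\<^sub>F \<epsilon> in nhds 0. \<forall>r\<in>{0..1}. norm (a \<epsilon> r - \<epsilon> *\<^sub>R Ad G (?e r) y) \<le> \<eta> * \<bar>\<epsilon>\<bar>" if "\<eta> > 0" for \<eta>
    proof -
      have "\<eta> / C > 0" using that C(1) by simp
      then obtain d where d: "d > 0" "\<And>r. norm (r - s) < d \<Longrightarrow> norm (u r - u s - (r - s) *\<^sub>R y) \<le> \<eta> / C * norm (r - s)"
        using u unfolding has_vector_derivative_def has_derivative_at_alt by blast
      have "norm (a \<epsilon> r - \<epsilon> *\<^sub>R Ad G (?e r) y) \<le> \<eta> * \<bar>\<epsilon>\<bar>" if \<epsilon>: "dist \<epsilon> 0 < d" and r: "r \<in> {0..1}" for \<epsilon> r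
      proof -
        have "norm (a \<epsilon> r - \<epsilon> *\<^sub>R Ad G (?e r) y) = norm (Ad G (?e r) (u (\<epsilon> + s) - u s - \<epsilon> *\<^sub>R y))"
          by (simp add: a_def Ad_diff Ad_scale)
        also have "\<dots> \<le> C * norm (u (\<epsilon> + s) - u s - \<epsilon> *\<^sub>R y)"
          by (rule C(2)[OF r])
        also have "\<dots> \<le> C * (\<eta> / C * \<bar>\<epsilon>\<bar>)"
          using d(2)[of "\<epsilon> + s"] \<epsilon> C(1) by (intro mult_left_mono) (auto simp: dist_norm)
        also have "\<dots> = \<eta> * \<bar>\<epsilon>\<bar>" using C(1) by simp
        finally show ?thesis .
      qed
      then show ?thesis
        unfolding eventually_nhds_metric using d(1) by blast
    qed
  qed simp
  from LD_right_translate[OF this lie_exp_closed[of ?X]]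
  have "LD (\<lambda>\<epsilon>. lie_exp G (u (\<epsilon> + s))) (Ad G (inv (lie_exp G ?X)) (integral {0..1} (\<lambda>r. Ad G (?e r) y))) (1 * s + - s) UNIV"
    by (simp add: K_def m_assoc)
  from LD_affine[OF this] show ?thesis by simp
qed

lemma gauge_eq:
  assumes "LD \<gamma> \<Gamma> s UNIV"
  shows "gauge G \<gamma> A s = Ad G (\<gamma> s) (A s + \<Gamma>)"
  using LD_velocity(2)[OF assms] LD_carrier[OF assms] by (simp add: gauge_def Ad_add)

text \<open>The result is Ad(\<gamma>) applied to \<open>B\<close> plus the infinitesimal gauge
  transformation of \<open>A\<close> by \<open>v\<close>. The bracket comes from moving
  \<open>A\<close> by Ad(exp(t v)), and \<open>v'\<close> from the logarithmic derivative of exp(t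
  v) in the loop parameter.\<close>

lemma gauge_variation:
  assumes g: "LD \<gamma> \<Gamma> s UNIV" and v: "(v has_vector_derivative v') (at s)"
  shows "((\<lambda>t. gauge G (\<lambda>s. \<gamma> s \<otimes> lie_exp G (t *\<^sub>R v s)) (affine_line A B t) s) has_vector_derivative
    Ad G (\<gamma> s) (B s + v' + lie_bracket G (v s) (A s))) (at 0)"
proof -
  let ?e = "\<lambda>t. lie_exp G (t *\<^sub>R v s)"
  have p: "\<gamma> s \<in> carrier G" by (rule LD_carrier[OF g])
  \<comment> \<open>The right-trivialised derivative of exp(t v) in the loop parameter, as given by
    Duhamel's formula.\<close>
  define J where "J t = integral {0..1} (\<lambda>r. Ad G (?e (r * t)) (t *\<^sub>R v'))" for t
  have eq: "gauge G (\<lambda>s. \<gamma> s \<otimes> lie_exp G (t *\<^sub>R v s)) (affine_line A B t) s =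
      Ad G (\<gamma> s) (Ad G (?e t) (A s + t *\<^sub>R B s) + \<Gamma> + J t)" for t
  proof -
    have "((\<lambda>s. t *\<^sub>R v s) has_vector_derivative t *\<^sub>R v') (at s)"
      using v by (auto intro!: derivative_eq_intros)
    from lie_exp_variation[OF this]
    have "LD (\<lambda>r. lie_exp G (t *\<^sub>R v r)) (Ad G (inv (?e t)) (J t)) s UNIV"
      by (simp add: J_def)
    from LD_mult[OF g this] have "LD (\<lambda>r. \<gamma> r \<otimes> lie_exp G (t *\<^sub>R v r)) (Ad G (inv (?e t)) (\<Gamma> + J t)) s UNIV"
      by (simp add: Ad_add)
    from gauge_eq[OF this] show ?thesis
      using p by (simp add: affine_line_def Ad_mult Ad_add add.assoc)
  qed
  have "((\<lambda>t. A s + t *\<^sub>R B s) has_vector_derivative B s) (at 0)"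
    by (auto intro!: derivative_eq_intros)
  from Ad_curve_derivative[OF LD_lie_exp this]
  have 1: "((\<lambda>t. Ad G (?e t) (A s + t *\<^sub>R B s)) has_vector_derivative lie_bracket G (v s) (A s) + B s) (at 0)"
    by simp
  \<comment> \<open>For nonzero \<open>t\<close>, \<open>J t\<close> divided by \<open>t\<close> is
    the mean over \<open>r\<close> of Ad(exp(r t v)) v', which tends to v' by continuity.\<close>
  have 2: "(J has_vector_derivative v') (at 0)"
    unfolding has_vector_derivative_def has_derivative_at_alt
  proof (intro conjI allI impI bounded_linear_scaleR_left)
    fix e :: real assume e: "e > 0"
    have "((\<lambda>t. Ad G (?e t) v') has_vector_derivative Ad G (?e 0) (lie_bracket G (v s) v')) (at 0)"
      by (rule Ad_LD[OF LD_lie_exp])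
    then have "isCont (\<lambda>t. Ad G (?e t) v') 0"
      by (rule has_vector_derivative_continuous)
    then obtain d where d: "d > 0" "\<And>t. dist t 0 < d \<Longrightarrow> dist (Ad G (?e t) v') (Ad G (?e 0) v') < e"
      using e unfolding continuous_at_eps_delta by blast
    have "norm (J t - J 0 - (t - 0) *\<^sub>R v') \<le> e * norm (t - 0)" if t: "norm (t - 0) < d" for t
    proof -
      have c: "continuous_on {0..1} (\<lambda>r. Ad G (?e (r * t)) v')"
      proof -
        have "LD (\<lambda>r. ?e (r * t)) (t *\<^sub>R v s) r {0..1}" if "r \<in> {0..1}" for r
          using LD_lie_exp_within[OF that, of "t *\<^sub>R v s"] by simp
        then show ?thesis
          by (intro continuous_on_Ad[where X = "\<lambda>_. t *\<^sub>R v s"] continuous_on_const)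
      qed
      have "J t - J 0 - (t - 0) *\<^sub>R v' = t *\<^sub>R integral {0..1} (\<lambda>r. Ad G (?e (r * t)) v' - v')"
        using c by (simp add: J_def Ad_scale scaleR_diff_right integrable_continuous_real Henstock_Kurzweil_Integration.integral_diff)
      moreover have "norm (integral {0..1} (\<lambda>r. Ad G (?e (r * t)) v' - v')) \<le> e * (1 - 0)"
      proof (rule integral_bound)
        fix r :: real assume r: "r \<in> {0..1}"
        have "\<bar>r\<bar> * \<bar>t\<bar> \<le> 1 * \<bar>t\<bar>"
          using r by (intro mult_right_mono) auto
        then have "dist (r * t) 0 < d"
          using t by (simp add: dist_norm abs_mult)
        from d(2)[OF this] show "norm (Ad G (?e (r * t)) v' - v') \<le> e"
          by (simp add: dist_norm)
      qed (use c in \<open>auto intro: continuous_intros\<close>)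
      ultimately show ?thesis
        using mult_left_mono[of "norm (integral {0..1} (\<lambda>r. Ad G (?e (r * t)) v' - v'))" e "\<bar>t\<bar>"]
        by (simp add: mult.commute)
    qed
    then show "\<exists>d>0. \<forall>t. norm (t - 0) < d \<longrightarrow> norm (J t - J 0 - (t - 0) *\<^sub>R v') \<le> e * norm (t - 0)"
      using d(1) by blast
  qed
  have "((\<lambda>t. Ad G (?e t) (A s + t *\<^sub>R B s) + \<Gamma> + J t) has_vector_derivative lie_bracket G (v s) (A s) + B s + 0 + v') (at 0)"
    by (intro has_vector_derivative_add 1 2 has_vector_derivative_const)
  from bounded_linear.has_vector_derivative[OF bounded_linear_Ad[OF p] this]
  show ?thesis
    unfolding eq by (simp add: algebra_simps)
qed

end

section \<open>Loops and invariant forms\<close>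

lemma Lg_periodic: "A \<in> Lg \<Longrightarrow> A (s + 1) = A s"
  by (simp add: Lg_def)

lemma Lg_smooth:
  assumes "A \<in> Lg"
  shows "(A has_vector_derivative vector_derivative A (at s)) (at s)"
    "continuous_on S A" "continuous_on S (\<lambda>s. vector_derivative A (at s))"
proof -
  have "C_k_on (Suc 0) UNIV A"
    using assms unfolding Lg_def smooth_on_def by blast
  then have A: "A differentiable (at s)" "continuous_on UNIV (\<lambda>s. frechet_derivative A (at s) 1)" for s
    by auto
  show D: "(A has_vector_derivative vector_derivative A (at s)) (at s)" for s
    using A(1) vector_derivative_works by blast
  have "frechet_derivative A (at s) 1 = vector_derivative A (at s)" for s
    using frechet_derivative_at[OF D[of s, unfolded has_vector_derivative_def]] by (metis scaleR_one)
  then have "continuous_on UNIV (\<lambda>s. vector_derivative A (at s))"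
    using A(2) by simp
  then show "continuous_on S (\<lambda>s. vector_derivative A (at s))"
    by (rule continuous_on_subset) simp
  show "continuous_on S A"
    using D by (intro continuous_on_vector_derivative) (auto intro: has_vector_derivative_at_within)
qed

lemma integral_reflect_unit_interval:
  fixes f :: "real \<Rightarrow> real"
  assumes f: "continuous_on {0..1} f"
  shows "integral {0..1} (\<lambda>s. f (1 - s)) = integral {0..1} f"
proof -
  let ?F = "\<lambda>s. integral {0..s} f"
  have "((\<lambda>s. - ?F (1 - s)) has_vector_derivative f (1 - s)) (at s within {0..1})" if s: "s \<in> {0..1}" for s
  proof -
    have 1: "((\<lambda>s. 1 - s) has_vector_derivative - 1) (at s within {0..1})"
      by (auto intro!: derivative_eq_intros)
    have "(?F has_vector_derivative f (1 - s)) (at (1 - s) within {0..1})"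
      using s by (intro integral_has_vector_derivative f) auto
    moreover have "(\<lambda>s. 1 - s) ` {0..1} = {0..1::real}"
      by (auto intro!: image_eqI[where x = "1 - x" for x])
    ultimately have "(?F \<circ> (\<lambda>s. 1 - s) has_vector_derivative - 1 *\<^sub>R f (1 - s)) (at s within {0..1})"
      using vector_diff_chain_within[OF 1, of ?F] by simp
    from has_vector_derivative_minus[OF this] show ?thesis
      by (simp add: o_def)
  qed
  then have "((\<lambda>s. f (1 - s)) has_integral (- ?F (1 - 1) - (- ?F (1 - 0)))) {0..1}"
    by (intro fundamental_theorem_of_calculus) auto
  then show ?thesis
    by (simp add: has_integral_iff)
qed

context lie_grp
begin

lemma LG_LD:
  assumes "\<gamma> \<in> LG G"
  obtains X where "LD \<gamma> X s UNIV"
proof -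
  have s: "smooth_map euclideanreal vec_atlas (gtop G) (gatlas G) \<gamma>"
    using assms by (simp add: LG_def)
  then have cont: "continuous_map euclideanreal (gtop G) \<gamma>"
    by (simp add: smooth_map_def)
  then have p: "\<gamma> s \<in> carrier G"
    using topspace_gtop unfolding continuous_map_def by auto
  have lim: "limitin (gtop G) \<gamma> (\<gamma> s) (at s)"
    using limitin_continuous_map_compose[OF _ cont, of "\<lambda>r. r" s "at s"] by simp
  have "(UNIV, id) \<in> (vec_atlas :: (real, real) chart set)"
    by (simp add: vec_atlas_def)
  then have "smooth_on (id ` (UNIV \<inter> \<gamma> -` cdom (\<gamma> s))) (coord (\<gamma> s) \<circ> \<gamma> \<circ> inv_into UNIV id)"
    using s chart_at_in(1)[OF p] unfolding smooth_map_def by fast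
  then have "C_k_on (Suc 0) (id ` (UNIV \<inter> \<gamma> -` cdom (\<gamma> s))) (coord (\<gamma> s) \<circ> \<gamma> \<circ> inv_into UNIV id)"
    unfolding smooth_on_def by blast
  moreover have "s \<in> id ` (UNIV \<inter> \<gamma> -` cdom (\<gamma> s))"
    using chart_at_in(2)[OF p] by simp
  moreover have "coord (\<gamma> s) \<circ> \<gamma> \<circ> inv_into UNIV id = (\<lambda>r. coord (\<gamma> s) (\<gamma> r))"
    by (auto simp: inv_id)
  ultimately have "(\<lambda>r. coord (\<gamma> s) (\<gamma> r)) differentiable (at s)"
    by (metis C_k_on.simps(2))
  then obtain w where "((\<lambda>r. coord (\<gamma> s) (\<gamma> r)) has_vector_derivative w) (at s)"
    using vector_derivative_works by blast
  then have "vel \<gamma> w s UNIV"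
    using lim by (simp add: has_velocity_def)
  then show thesis
    using that unfolding LD_def by blast
qed

text \<open>Invariance under \<open>Ad (exp (tZ))\<close>, differentiated at
  \<open>t = 0\<close>.\<close>

lemma invariant_form_bracket:
  assumes b: "bilinear b" and inv: "invariant_form G b"
  shows "b (lie_bracket G Z X) Y = - b X (lie_bracket G Z Y)"
proof -
  interpret b: bounded_bilinear b by (rule bilinear_bounded[OF b])
  let ?e = "\<lambda>t. lie_exp G (t *\<^sub>R Z)"
  have "((\<lambda>t. b (Ad G (?e t) X) (Ad G (?e t) Y)) has_vector_derivative
      b (Ad G (?e 0) X) (Ad G (?e 0) (lie_bracket G Z Y)) + b (Ad G (?e 0) (lie_bracket G Z X)) (Ad G (?e 0) Y)) (at 0)"
    by (intro b.has_vector_derivative Ad_LD LD_lie_exp)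
  moreover have "b (Ad G (?e t) X) (Ad G (?e t) Y) = b X Y" for t
    using inv by (simp add: invariant_form_def)
  ultimately have "((\<lambda>t. b X Y) has_vector_derivative b X (lie_bracket G Z Y) + b (lie_bracket G Z X) Y) (at 0)"
    by simp
  then have "b X (lie_bracket G Z Y) + b (lie_bracket G Z X) Y = 0"
    using vector_derivative_unique_at has_vector_derivative_const by blast
  then show ?thesis by simp
qed

text \<open>\<open>omega_D\<close> sees the derivative of \<open>f_map\<close> only through these
  values. The vector \<open>e\<close> is the right-trivialised variation \<eta> of the holonomy at
  the end point 1.\<close>

lemma d_f_map_forms:
  fixes v B :: "real \<Rightarrow> 'e"
  assumes \<gamma>: "\<gamma> \<in> LG G" and h: "hol_sol A h"
    and B: "continuous_on {0..1} (\<lambda>r. Ad G (h r) (B r))"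
  defines "d \<equiv> d_f_map G (\<gamma>, A) (v, B)" and "e \<equiv> - integral {0..1} (\<lambda>r. Ad G (h r) (B r))"
  shows "mc_left G (\<gamma> 0) (fst d) = v 0" "mc_left G (h 1) (snd d) = Ad G (inv (h 1)) e"
    "mc_right G (h 1) (snd d) = e"
proof -
  obtain X where "LD \<gamma> X 0 UNIV" using LG_LD[OF \<gamma>] by blast
  then have p: "\<gamma> 0 \<in> carrier G" by (rule LD_carrier)
  have "LD (\<lambda>t. \<gamma> 0 \<otimes> lie_exp G (t *\<^sub>R v 0)) (v 0) 0 UNIV"
    by (intro LD_left_translate LD_lie_exp p)
  from LD_velocity(1)[OF this] show "mc_left G (\<gamma> 0) (fst d) = v 0"
    using p by (simp add: d_def d_f_map_def f_map_def loop_curve_def)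
  have one: "(1::real) \<in> {0..1}" by simp
  have q: "h 1 \<in> carrier G" by (rule hol_sol_carrier[OF h one])
  have "hol G (affine_line A B 0) 1 = h 1"
    using hol_eq[OF h one] by (simp add: affine_line_def)
  with LD_velocity[OF hol_variation[OF h B one]]
  show "mc_left G (h 1) (snd d) = Ad G (inv (h 1)) e" "mc_right G (h 1) (snd d) = e"
    using q by (simp_all add: d_def e_def d_f_map_def f_map_def loop_curve_def)
qed

lemma d_Phi_eq:
  assumes \<gamma>: "\<And>s. LD \<gamma> (\<Gamma> s) s UNIV" and v: "v \<in> Lg"
  shows "d_Phi G (\<gamma>, A) (v, B) =
    (\<lambda>s. Ad G (\<gamma> s) (B s + vector_derivative v (at s) + lie_bracket G (v s) (A s)), \<lambda>s. - B (1 - s))"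
proof -
  have "vector_derivative (\<lambda>t. gauge G (\<lambda>s. \<gamma> s \<otimes> lie_exp G (t *\<^sub>R v s)) (affine_line A B t) s) (at 0)
      = Ad G (\<gamma> s) (B s + vector_derivative v (at s) + lie_bracket G (v s) (A s))" for s
    by (intro vector_derivative_at gauge_variation[OF \<gamma>] Lg_smooth v)
  moreover have "((\<lambda>t. - (A (1 - s) + t *\<^sub>R B (1 - s))) has_vector_derivative - B (1 - s)) (at 0)" for s
    by (auto intro!: derivative_eq_intros)
  then have "vector_derivative (\<lambda>t. inv_loop (affine_line A B t) s) (at 0) = - B (1 - s)" for s
    unfolding inv_loop_def affine_line_def by (rule vector_derivative_at)
  ultimately show ?thesis
    by (simp add: d_Phi_def Phi_def loop_curve_def)
qed

section \<open>Comparison of the 2-forms\<close>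

lemma omega_LG_pullback:
  assumes bil: "bilinear b" and sym: "\<And>X Y. b X Y = b Y X" and invar: "invariant_form G b"
    and \<gamma>: "\<gamma> \<in> LG G" and Lg: "A \<in> Lg" "v1 \<in> Lg" "A1 \<in> Lg" "v2 \<in> Lg" "A2 \<in> Lg"
  shows "omega_LG G b (\<gamma>, A) (v1, A1) (v2, A2) =
    pullback (f_map G) (d_f_map G) (omega_D G b) (\<gamma>, A) (v1, A1) (v2, A2)
    - pullback (Phi G) (d_Phi G) (sum_form (varpi G b)) (\<gamma>, A) (v1, A1) (v2, A2)"
proof -
  interpret b: bounded_bilinear b by (rule bilinear_bounded[OF bil])
  have Adb: "b (Ad G g X) (Ad G g Y) = b X Y" if "g \<in> carrier G" for g X Y
    using invar that by (simp add: invariant_form_def)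
  obtain \<Gamma> where \<Gamma>: "\<And>s. LD \<gamma> (\<Gamma> s) s UNIV"
  proof -
    have "\<exists>X. LD \<gamma> X s UNIV" for s
      using LG_LD[OF \<gamma>, of s] by blast
    then show ?thesis using that by metis
  qed
  have \<gamma>c: "\<gamma> s \<in> carrier G" for s using LD_carrier[OF \<Gamma>] .
  define h where "h = hol G A"
  have h: "hol_sol A h"
    unfolding h_def by (intro hol_exists Lg_smooth Lg)
  have hc: "h s \<in> carrier G" if "s \<in> {0..1}" for s by (rule hol_sol_carrier[OF h that])
  have y: "h 1 \<in> carrier G" using hc by simp
  have h0: "h 0 = \<one>" using h by (simp add: hol_sol_def)
  let ?I = "{0..1::real}"

  define \<eta> where "\<eta> B s = - integral {0..s} (\<lambda>r. Ad G (h r) (B r))" for B s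
  define \<eta>' where "\<eta>' B s = - Ad G (h s) (B s)" for B :: "real \<Rightarrow> 'e" and s
  define w where "w v s = Ad G (h s) (v s)" for v s
  \<comment> \<open>The infinitesimal gauge action of \<open>v\<close> on \<open>A\<close>. As h^-1
    h' = -A, the derivative of Ad(h) v is Ad(h) applied to this same expression, so the gauge
    variation appears as \<open>w'\<close>.\<close>
  define D where "D v s = vector_derivative v (at s) + lie_bracket G (v s) (A s)" for v s
  define w' where "w' v s = Ad G (h s) (D v s)" for v s
  have cAd: "continuous_on ?I (\<lambda>s. Ad G (h s) (B s))" if "continuous_on ?I B" for B
    using that by (intro continuous_on_Ad[where X = "\<lambda>s. - A s"] hol_sol_LD[OF h])
  have \<eta>: "(\<eta> B has_vector_derivative \<eta>' B s) (at s within ?I)" if "s \<in> ?I" "B \<in> Lg" for B s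
    unfolding \<eta>_def[abs_def] \<eta>'_def using that
    by (intro has_vector_derivative_minus integral_has_vector_derivative cAd Lg_smooth)
  have w: "(w v has_vector_derivative w' v s) (at s within ?I)" if "s \<in> ?I" "v \<in> Lg" for v s
  proof -
    have "(v has_vector_derivative vector_derivative v (at s)) (at s within ?I)"
      using Lg_smooth(1)[OF that(2)] by (rule has_vector_derivative_at_within)
    from Ad_curve_derivative[OF hol_sol_LD[OF h that(1)] this]
    have "(w v has_vector_derivative Ad G (h s) (lie_bracket G (- A s) (v s) + vector_derivative v (at s))) (at s within ?I)"
      by (simp add: w_def[abs_def])
    moreover have "lie_bracket G (- A s) (v s) = lie_bracket G (v s) (A s)"
      using lie_bracket_antisym[of "A s" "v s"] bilinear_lie_bracket by (simp add: bilinear_lneg)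
    ultimately show ?thesis
      by (simp add: w'_def D_def add.commute)
  qed
  have cD: "continuous_on ?I (D v)" if "v \<in> Lg" for v
    unfolding D_def[abs_def] using that Lg
    by (intro continuous_on_add bounded_bilinear.continuous_on[OF bounded_bilinear_lie_bracket] Lg_smooth)
  have cont: "continuous_on ?I (\<eta> B)" "continuous_on ?I (\<eta>' B)" "continuous_on ?I (w B)" "continuous_on ?I (w' B)"
    if "B \<in> Lg" for B
  proof -
    show "continuous_on ?I (\<eta> B)"
      by (rule continuous_on_vector_derivative) (rule \<eta>[OF _ that])
    show "continuous_on ?I (w B)"
      by (rule continuous_on_vector_derivative) (rule w[OF _ that])
    show "continuous_on ?I (\<eta>' B)"
      unfolding \<eta>'_def[abs_def] using that by (intro continuous_on_minus cAd Lg_smooth)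
    show "continuous_on ?I (w' B)"
      unfolding w'_def[abs_def] using that by (intro cAd cD)
  qed
  have \<eta>0: "\<eta> B 0 = 0" for B by (simp add: \<eta>_def)
  have w0: "w v 0 = v 0" for v by (simp add: w_def h0)

  define c1 c2 e1 e2 where "c1 = v1 0" and "c2 = v2 0" and "e1 = \<eta> A1 1" and "e2 = \<eta> A2 1"
  have per: "v1 1 = c1" "v2 1 = c2"
    using Lg_periodic[OF Lg(2), of 0] Lg_periodic[OF Lg(4), of 0] by (simp_all add: c1_def c2_def)

  \<comment> \<open>\<open>P\<close> and \<open>Q\<close> are twice the integrands of the two copies
    of \<open>varpi\<close>, with the constant adjoint factors removed by invariance and, for
    \<open>Q\<close>, with \<open>1 - s\<close> replaced by \<open>s\<close>.\<close>
  define P where "P s = b (\<eta> A1 s - w v1 s + c1) (\<eta>' A2 s - w' v2 s) - b (\<eta> A2 s - w v2 s + c2) (\<eta>' A1 s - w' v1 s)" for s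
  define Q where "Q s = b (\<eta> A2 s - e2) (\<eta>' A1 s) - b (\<eta> A1 s - e1) (\<eta>' A2 s)" for s
  \<comment> \<open>In \<open>Om + P/2 + Q/2\<close> the terms with two \<eta> cancel. The terms
    with two \<open>w\<close> combine with \<open>(v1, dv2)\<close> and \<open>(A, [v1, v2])\<close>
    to half the derivative of \<open>- b v1 v2\<close>. The mixed terms combine with
    \<open>(A1, v2) - (A2, v1)\<close> to half the derivative of
    \<open>b (\<eta> A2) (w v1) - b (\<eta> A1) (w v2)\<close>. The constants \<open>c1\<close>,
    \<open>c2\<close>, \<open>e1\<close>, \<open>e2\<close> are integrated directly.\<close>
  define R where "R s = 1/2 * (b (\<eta> A2 s) (w v1 s) - b (\<eta> A1 s) (w v2 s) - b (v1 s) (v2 s)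
     + b c1 (\<eta> A2 s - w v2 s) - b c2 (\<eta> A1 s - w v1 s) + b e1 (\<eta> A2 s) - b e2 (\<eta> A1 s))" for s
  define Om where "Om s = b (A1 s) (v2 s) - b (A2 s) (v1 s)
       - b (A s) (lie_bracket G (v1 s) (v2 s)) - b (v1 s) (vector_derivative v2 (at s))" for s

  have cP: "continuous_on ?I P"
    unfolding P_def[abs_def] by (intro continuous_intros b.continuous_on cont Lg)
  have cQ: "continuous_on ?I Q"
    unfolding Q_def[abs_def] by (intro continuous_intros b.continuous_on cont Lg)

  have varpi1: "varpi G b (gauge G \<gamma> A) (fst (d_Phi G (\<gamma>, A) (v1, A1))) (fst (d_Phi G (\<gamma>, A) (v2, A2)))
      = 1/2 * integral ?I P"
  proof -
    define g where "g s = \<gamma> 0 \<otimes> h s \<otimes> inv (\<gamma> s)" for s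
    define B where "B v C = fst (d_Phi G (\<gamma>, A) (v, C))" for v C
    \<comment> \<open>The summand \<open>v 0\<close> makes the primitive vanish at 0, where
      \<open>w v\<close> equals \<open>v 0\<close>.\<close>
    define \<xi> where "\<xi> v C s = Ad G (\<gamma> 0) (\<eta> C s - w v s + v 0)" for v C s
    have sol: "hol_sol (gauge G \<gamma> A) g"
      unfolding g_def[abs_def] by (rule hol_sol_gauge[OF h \<Gamma>])
    \<comment> \<open>The inverse of \<open>\<gamma> s\<close> at the end of \<open>g s\<close>
      cancels the factor \<open>Ad G (\<gamma> s)\<close> in \<open>d_Phi\<close>, leaving the
      constant \<open>Ad G (\<gamma> 0)\<close> and the derivatives already computed.\<close>
    have gB: "- Ad G (g s) (B v C s) = Ad G (\<gamma> 0) (\<eta>' C s - w' v s)" if "s \<in> ?I" "v \<in> Lg" for s v C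
      using hc[OF that(1)] \<gamma>c
      by (simp add: B_def d_Phi_eq[OF \<Gamma> that(2)] g_def Ad_mult \<eta>'_def w'_def D_def Ad_add Ad_diff Ad_minus add.assoc)
    have \<xi>: "(\<xi> v C has_vector_derivative - Ad G (g s) (B v C s)) (at s within ?I)" if "s \<in> ?I" "v \<in> Lg" "C \<in> Lg" for s v C
    proof -
      have "((\<lambda>s. \<eta> C s - w v s + v 0) has_vector_derivative \<eta>' C s - w' v s + 0) (at s within ?I)"
        using that by (intro has_vector_derivative_add has_vector_derivative_diff \<eta> w has_vector_derivative_const)
      from bounded_linear.has_vector_derivative[OF bounded_linear_Ad[OF \<gamma>c] this]
      show ?thesis
        unfolding \<xi>_def[abs_def] gB[OF that(1,2)] by simp
    qed
    have cB: "continuous_on ?I (\<lambda>s. Ad G (g s) (B v C s))" if "v \<in> Lg" "C \<in> Lg" for v C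
    proof (rule continuous_on_eq)
      show "continuous_on ?I (\<lambda>s. - Ad G (\<gamma> 0) (\<eta>' C s - w' v s))"
        using that by (intro continuous_on_minus bounded_linear.continuous_on[OF bounded_linear_Ad[OF \<gamma>c]] continuous_on_diff cont)
      show "- Ad G (\<gamma> 0) (\<eta>' C s - w' v s) = Ad G (g s) (B v C s)" if "s \<in> ?I" for s
        using gB[OF that \<open>v \<in> Lg\<close>, of C] by (metis minus_minus)
    qed
    have \<xi>0: "\<xi> v C 0 = 0" for v C
      using \<gamma>c by (simp add: \<xi>_def \<eta>0 w0)
    have "varpi G b (gauge G \<gamma> A) (B v1 A1) (B v2 A2) = 1/2 * integral ?I (\<lambda>s.
       b (\<xi> v1 A1 s) (- Ad G (g s) (B v2 A2 s)) - b (\<xi> v2 A2 s) (- Ad G (g s) (B v1 A1 s)))"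
      using Lg by (intro varpi_eq[OF sol] \<xi> \<xi>0 cB)
    also have "integral ?I (\<lambda>s. b (\<xi> v1 A1 s) (- Ad G (g s) (B v2 A2 s)) - b (\<xi> v2 A2 s) (- Ad G (g s) (B v1 A1 s)))
        = integral ?I P"
      by (intro Henstock_Kurzweil_Integration.integral_cong)
        (simp only: gB Lg \<xi>_def Adb[OF \<gamma>c] P_def c1_def c2_def)
    finally show ?thesis by (simp add: B_def)
  qed

  have varpi2: "varpi G b (inv_loop A) (snd (d_Phi G (\<gamma>, A) (v1, A1))) (snd (d_Phi G (\<gamma>, A) (v2, A2)))
      = 1/2 * integral ?I Q"
  proof -
    define k where "k s = inv (h 1) \<otimes> h (1 - s)" for s
    define B where "B C s = - C (1 - s)" for C :: "real \<Rightarrow> 'e" and s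
    \<comment> \<open>Subtracting the end value \<open>\<eta> C 1\<close> gives the reversed
      primitive the initial value 0; this is the source of \<open>e1\<close> and \<open>e2\<close>
      in \<open>Q\<close>.\<close>
    define \<zeta> where "\<zeta> C s = Ad G (inv (h 1)) (\<eta> C (1 - s) - \<eta> C 1)" for C s
    have sol: "hol_sol (inv_loop A) k"
      unfolding k_def[abs_def] by (rule hol_sol_inv_loop[OF h])
    have kB: "- Ad G (k s) (B C s) = Ad G (inv (h 1)) (- \<eta>' C (1 - s))" if "s \<in> ?I" for s C
      using hc[of "1 - s"] y that by (simp add: k_def B_def Ad_mult \<eta>'_def Ad_minus)
    have \<zeta>: "(\<zeta> C has_vector_derivative - Ad G (k s) (B C s)) (at s within ?I)" if s: "s \<in> ?I" and C: "C \<in> Lg" for s C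
    proof -
      have 1: "((\<lambda>s. 1 - s) has_vector_derivative - 1) (at s within ?I)"
        by (auto intro!: derivative_eq_intros)
      have "(\<eta> C has_vector_derivative \<eta>' C (1 - s)) (at (1 - s) within (\<lambda>s. 1 - s) ` ?I)"
        using s C by (intro has_vector_derivative_within_subset[OF \<eta>[of "1 - s" C]]) auto
      from vector_diff_chain_within[OF 1 this]
      have "((\<lambda>s. \<eta> C (1 - s) - \<eta> C 1) has_vector_derivative - \<eta>' C (1 - s) - 0) (at s within ?I)"
        by (intro has_vector_derivative_diff has_vector_derivative_const) (simp add: o_def)
      from bounded_linear.has_vector_derivative[OF bounded_linear_Ad[OF inv_closed[OF y]] this]
      show ?thesis
        unfolding \<zeta>_def[abs_def] kB[OF s] by simp
    qed
    have refl: "continuous_on ?I (\<lambda>s. f (1 - s))" if "continuous_on ?I f" for f :: "real \<Rightarrow> 'e"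
      by (rule continuous_on_compose2[OF that]) (auto intro!: continuous_intros)
    have cB: "continuous_on ?I (\<lambda>s. Ad G (k s) (B C s))" if "C \<in> Lg" for C
    proof (rule continuous_on_eq)
      show "continuous_on ?I (\<lambda>s. - Ad G (inv (h 1)) (- \<eta>' C (1 - s)))"
        using that by (intro continuous_on_minus bounded_linear.continuous_on[OF bounded_linear_Ad[OF inv_closed[OF y]]] refl cont)
      show "- Ad G (inv (h 1)) (- \<eta>' C (1 - s)) = Ad G (k s) (B C s)" if "s \<in> ?I" for s
        using kB[OF that, of C] by (metis minus_minus)
    qed
    have \<zeta>0: "\<zeta> C 0 = 0" for C
      using y by (simp add: \<zeta>_def)
    have "varpi G b (inv_loop A) (B A1) (B A2) = 1/2 * integral ?I (\<lambda>s.
       b (\<zeta> A1 s) (- Ad G (k s) (B A2 s)) - b (\<zeta> A2 s) (- Ad G (k s) (B A1 s)))"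
      using Lg by (intro varpi_eq[OF sol] \<zeta> \<zeta>0 cB)
    also have "integral ?I (\<lambda>s. b (\<zeta> A1 s) (- Ad G (k s) (B A2 s)) - b (\<zeta> A2 s) (- Ad G (k s) (B A1 s)))
        = integral ?I (\<lambda>s. Q (1 - s))"
      by (intro Henstock_Kurzweil_Integration.integral_cong)
        (simp add: kB \<zeta>_def Adb[OF inv_closed[OF y]] Q_def e1_def e2_def b.minus_right)
    also have "\<dots> = integral ?I Q"
      by (rule integral_reflect_unit_interval[OF cQ])
    finally show ?thesis
      using Lg by (simp add: d_Phi_eq[OF \<Gamma>] B_def[abs_def])
  qed

  have "(R has_vector_derivative Om s + 1/2 * P s + 1/2 * Q s) (at s within ?I)" if s: "s \<in> ?I" for s
  proof -
    have v: "(v has_vector_derivative vector_derivative v (at s)) (at s within ?I)" if "v \<in> Lg" for v :: "real \<Rightarrow> 'e"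
      using Lg_smooth(1)[OF that] by (rule has_vector_derivative_at_within)
    have "(R has_vector_derivative 1/2 * (
       (b (\<eta> A2 s) (w' v1 s) + b (\<eta>' A2 s) (w v1 s)) - (b (\<eta> A1 s) (w' v2 s) + b (\<eta>' A1 s) (w v2 s))
       - (b (v1 s) (vector_derivative v2 (at s)) + b (vector_derivative v1 (at s)) (v2 s))
       + b c1 (\<eta>' A2 s - w' v2 s) - b c2 (\<eta>' A1 s - w' v1 s) + b e1 (\<eta>' A2 s) - b e2 (\<eta>' A1 s))) (at s within ?I)"
      (is "(_ has_vector_derivative ?D) _")
      unfolding R_def[abs_def] using s Lg
      by (intro has_vector_derivative_mult_right has_vector_derivative_add has_vector_derivative_diff
          b.has_vector_derivative bounded_linear.has_vector_derivative[OF b.bounded_linear_right] \<eta> w v)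
    moreover have "?D = Om s + 1/2 * P s + 1/2 * Q s"
    proof -
      have "b (w v s) (\<eta>' C s) = - b (v s) (C s)" for v C
        by (simp add: w_def \<eta>'_def b.minus_right Adb[OF hc[OF s]])
      moreover have "b (w v s) (w' u s) = b (v s) (vector_derivative u (at s)) + b (v s) (lie_bracket G (u s) (A s))" for v u
        by (simp add: w_def w'_def D_def b.add_right Adb[OF hc[OF s]])
      \<comment> \<open>The two bracket terms have opposite values and enter \<open>P\<close> with
        opposite signs, so they add up to twice \<open>(A, [v1, v2])\<close>; the factor 1/2 of
        \<open>varpi\<close> then matches the term in \<open>Om\<close>.\<close>
      moreover have "b (v1 s) (lie_bracket G (v2 s) (A s)) = b (A s) (lie_bracket G (v1 s) (v2 s))"
        using invariant_form_bracket[OF bil invar, of "v2 s" "v1 s" "A s"] lie_bracket_antisym[of "v2 s" "v1 s"]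
        by (simp add: b.minus_right sym)
      moreover have "b (v2 s) (lie_bracket G (v1 s) (A s)) = - b (A s) (lie_bracket G (v1 s) (v2 s))"
        using invariant_form_bracket[OF bil invar, of "v1 s" "v2 s" "A s"] by (simp add: sym)
      ultimately show ?thesis
        by (simp add: Om_def P_def Q_def b.add_left b.add_right b.diff_left b.diff_right sym field_simps)
    qed
    ultimately show ?thesis
      by (simp only:)
  qed
  then have "((\<lambda>s. Om s + 1/2 * P s + 1/2 * Q s) has_integral R 1 - R 0) ?I"
    by (intro fundamental_theorem_of_calculus) auto
  moreover have "((\<lambda>s. 1/2 * P s) has_integral 1/2 * integral ?I P) ?I" "((\<lambda>s. 1/2 * Q s) has_integral 1/2 * integral ?I Q) ?I"
    by (intro has_integral_mult_right integrable_integral integrable_continuous_real cP cQ)+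
  \<comment> \<open>Removing the integrals of \<open>P\<close> and \<open>Q\<close> yields both the
    integrability of \<open>Om\<close> and its value.\<close>
  ultimately have "((\<lambda>s. Om s + 1/2 * P s + 1/2 * Q s - 1/2 * Q s - 1/2 * P s) has_integral
      R 1 - R 0 - 1/2 * integral ?I Q - 1/2 * integral ?I P) ?I"
    by (intro has_integral_diff)
  then have main: "integral ?I Om = R 1 - R 0 - 1/2 * integral ?I Q - 1/2 * integral ?I P"
    by (simp add: has_integral_iff)

  have fD: "pullback (f_map G) (d_f_map G) (omega_D G b) (\<gamma>, A) (v1, A1) (v2, A2) = R 1 - R 0"
  proof -
    note forms = d_f_map_forms[OF \<gamma> h cAd[OF Lg_smooth(2)]]
    have eq: "b (Ad G (h 1) X) Y = b X (Ad G (inv (h 1)) Y)" for X Y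
      using Adb[OF inv_closed[OF y], of "Ad G (h 1) X" Y] y by simp
    have "e1 = - integral ?I (\<lambda>r. Ad G (h r) (A1 r))" "e2 = - integral ?I (\<lambda>r. Ad G (h r) (A2 r))"
      by (simp_all add: e1_def e2_def \<eta>_def)
    then have "pullback (f_map G) (d_f_map G) (omega_D G b) (\<gamma>, A) (v1, A1) (v2, A2)
      = 1/2 * (b (Ad G (h 1) c1) c2 - b (Ad G (h 1) c2) c1)
        + 1/2 * (b c1 (Ad G (inv (h 1)) e2 + e2) - b c2 (Ad G (inv (h 1)) e1 + e1))"
      using forms[OF Lg(3), of v1] forms[OF Lg(5), of v2]
      by (simp add: pullback_def f_map_def omega_D_def form_pair_def c1_def c2_def h_def[symmetric])
    \<comment> \<open>At 1, periodicity of the loops gives \<open>w v = Ad G (h 1) (v 0)\<close>,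
      and the terms in \<open>e1\<close> and \<open>e2\<close> alone cancel by symmetry. At 0 only
      \<open>- 1/2 * b c1 c2\<close> is left, which cancels the same term at 1.\<close>
    also have "\<dots> = R 1 - R 0"
      using eq[of c1 e2] eq[of c2 e1]
      by (simp add: R_def \<eta>0 h0 w_def per e1_def[symmetric] e2_def[symmetric] c1_def[symmetric] c2_def[symmetric]
          b.add_right b.diff_right b.minus_right b.zero_left b.zero_right sym field_simps)
    finally show ?thesis .
  qed
  have "omega_LG G b (\<gamma>, A) (v1, A1) (v2, A2) = integral ?I Om"
    by (simp add: omega_LG_def Om_def[abs_def])
  then show ?thesis
    using main fD varpi1 varpi2 by (simp add: pullback_def sum_form_def Phi_def)
qed

end

theorem theorem4p8:
  fixes G :: "('g, 'e::{real_inner, banach, heine_borel}) lie_data"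
    and b :: "'e \<Rightarrow> 'e \<Rightarrow> real"
  assumes "lie_group G"
    and "compact_space (gtop G)" and "connected_space (gtop G)"
    and "bilinear b" and "\<And>X Y. b X Y = b Y X" and "invariant_form G b"
    and "p \<in> LG G \<times> Lg" and "X \<in> Lg \<times> Lg" and "Y \<in> Lg \<times> Lg"
  shows "omega_LG G b p X Y =
    pullback (f_map G) (d_f_map G) (omega_D G b) p X Y
    - pullback (Phi G) (d_Phi G) (sum_form (varpi G b)) p X Y"
proof -
  interpret lie_grp G by unfold_locales fact
  obtain \<gamma> A v1 A1 v2 A2 where "p = (\<gamma>, A)" "X = (v1, A1)" "Y = (v2, A2)"
    by (metis surj_pair)
  then show ?thesis
    using omega_LG_pullback[OF assms(4-6), of \<gamma> A v1 A1 v2 A2] assms(7-9) by simp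
qed

end
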